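(* Let $\nu>0$, $\lambda_0>0$, $\lambda(t)=\sqrt{\lambda_0^2+4\nu t}$, and $N\ge1$. Let $\omega_0=\sum_{j=1}^N w_0^j$ with $\omega_0\in L^\infty(\mathbb{R}^2)$, and suppose that for every $j=1,\dots,N$, $$\mathcal{E}^j(0)=\int_{\mathbb{R}^2}\Phi_{\lambda_0}(x)^{-1}\,w_0^j(x)^2\,dx<\infty.$$ Let $\omega$ be the solution of the two-dimensional vorticity equation with initial datum $\omega_0$ and $\mathbf{u}$ its Biot–Savart velocity field, and for each $j$ let $w^j(x,t)$ be the solution of the linear advection–diffusion equation $$\partial_t w^j=\nu\Delta w^j-\mathbf{u}(x,t)\cdot\nabla w^j,\qquad w^j(x,0)=w_0^j(x).$$ Then for every $j$ and every $t>0$, $\mathcal{E}^j(t)=\int_{\mathbb{R}^2}\Phi_{\lambda(t)}(x)^{-1}w^j(x,t)^2\,dx<\infty$.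
   Context: $\Phi_\lambda(x)=\frac{1}{\pi\lambda^2}e^{-|x|^2/\lambda^2}$. The two-dimensional vorticity equation is $\partial_t\omega=\nu\Delta\omega-\mathbf{u}\cdot\nabla\omega$ on $\mathbb{R}^2$, with $\mathbf{u}(x,t)=\frac{1}{2\pi}\int_{\mathbb{R}^2}\frac{(x-y)^\perp}{|x-y|^2}\omega(y,t)\,dy$, $z^\perp=(-z_2,z_1)$. In the paper, $w^j(x,t)=\omega^j(x-x^j(t),t)$ is the $j$-th vortex component of the multi-vortex decomposition $\omega=\sum_j w^j$, and the total advecting field $\sum_\ell \mathbf{u}^\ell$ is the velocity $\mathbf{u}$ of the full solution. *)

theory Defs
  imports "HOL-Analysis.Analysis"
begin

definition Phi :: "real \<Rightarrow> real^2 \<Rightarrow> real" where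
  "Phi lam x = 1 / (pi * lam\<^sup>2) * exp (- (norm x)\<^sup>2 / lam\<^sup>2)"

definition lam :: "real \<Rightarrow> real \<Rightarrow> real \<Rightarrow> real" where
  "lam \<nu> lam0 t = sqrt (lam0\<^sup>2 + 4 * \<nu> * t)"

definition perp :: "real^2 \<Rightarrow> real^2" where
  "perp z = vector [- (z $ 2), z $ 1]"

definition biot_savart :: "(real^2 \<Rightarrow> real \<Rightarrow> real) \<Rightarrow> real^2 \<Rightarrow> real \<Rightarrow> real^2" where
  "biot_savart \<omega> x t =
     (LINT y|lebesgue. (\<omega> y t / (2 * pi * (norm (x - y))\<^sup>2)) *\<^sub>R perp (x - y))"

definition dt :: "(real^2 \<Rightarrow> real \<Rightarrow> real) \<Rightarrow> real^2 \<Rightarrow> real \<Rightarrow> real" where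
  "dt f x t = deriv (\<lambda>s. f x s) t"

definition grad :: "(real^2 \<Rightarrow> real \<Rightarrow> real) \<Rightarrow> real^2 \<Rightarrow> real \<Rightarrow> real^2" where
  "grad f x t = (\<chi> i. deriv (\<lambda>h. f (x + h *\<^sub>R axis i 1) t) 0)"

definition d2 :: "(real^2 \<Rightarrow> real \<Rightarrow> real) \<Rightarrow> 2 \<Rightarrow> real^2 \<Rightarrow> real \<Rightarrow> real" where
  "d2 f i x t = deriv (\<lambda>h. grad f (x + h *\<^sub>R axis i 1) t $ i) 0"

definition lap :: "(real^2 \<Rightarrow> real \<Rightarrow> real) \<Rightarrow> real^2 \<Rightarrow> real \<Rightarrow> real" where
  "lap f x t = (\<Sum>i\<in>UNIV. d2 f i x t)"

definition C21 :: "(real^2 \<Rightarrow> real \<Rightarrow> real) \<Rightarrow> bool" where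
  "C21 f \<longleftrightarrow>
     (\<forall>x t. t > 0 \<longrightarrow>
        (\<lambda>s. f x s) differentiable (at t) \<and>
        (\<forall>i. (\<lambda>h. f (x + h *\<^sub>R axis i 1) t) differentiable (at 0) \<and>
             (\<lambda>h. grad f (x + h *\<^sub>R axis i 1) t $ i) differentiable (at 0))) \<and>
     continuous_on (UNIV \<times> {0<..}) (\<lambda>p. f (fst p) (snd p)) \<and>
     continuous_on (UNIV \<times> {0<..}) (\<lambda>p. dt f (fst p) (snd p)) \<and>
     continuous_on (UNIV \<times> {0<..}) (\<lambda>p. grad f (fst p) (snd p)) \<and>
     (\<forall>i. continuous_on (UNIV \<times> {0<..}) (\<lambda>p. d2 f i (fst p) (snd p)))"

definition vorticity_solution ::
  "real \<Rightarrow> (real^2 \<Rightarrow> real \<Rightarrow> real) \<Rightarrow> (real^2 \<Rightarrow> real) \<Rightarrow> bool" where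
  "vorticity_solution \<nu> \<omega> \<omega>0 \<longleftrightarrow>
     C21 \<omega> \<and>
     (\<forall>x t. t > 0 \<longrightarrow>
        dt \<omega> x t = \<nu> * lap \<omega> x t - biot_savart \<omega> x t \<bullet> grad \<omega> x t) \<and>
     (\<forall>t > 0. integrable lebesgue (\<lambda>x. \<omega> x t)) \<and>
     (\<forall>T > 0. \<exists>C. \<forall>t\<in>{0<..T}. \<forall>x. \<bar>\<omega> x t\<bar> \<le> C) \<and>
     ((\<lambda>t. LINT x|lebesgue. \<bar>\<omega> x t - \<omega>0 x\<bar>) \<longlongrightarrow> 0) (at_right 0)"

definition adv_diff_solution ::
  "real \<Rightarrow> (real^2 \<Rightarrow> real \<Rightarrow> real^2) \<Rightarrow> (real^2 \<Rightarrow> real \<Rightarrow> real) \<Rightarrow> (real^2 \<Rightarrow> real) \<Rightarrow> bool" where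
  "adv_diff_solution \<nu> u w w0 \<longleftrightarrow>
     C21 w \<and>
     (\<forall>x t. t > 0 \<longrightarrow> dt w x t = \<nu> * lap w x t - u x t \<bullet> grad w x t) \<and>
     (\<forall>t > 0. integrable lebesgue (\<lambda>x. (w x t)\<^sup>2)) \<and>
     (\<forall>T > 0. \<exists>C. \<forall>t\<in>{0<..T}. (LINT x|lebesgue. (w x t)\<^sup>2) \<le> C) \<and>
     ((\<lambda>t. LINT x|lebesgue. (w x t - w0 x)\<^sup>2) \<longlongrightarrow> 0) (at_right 0)"

end

theory Submission
  imports Defs
begin

text \<open>
  If \<open>\<bar>u\<bar> \<le> U\<close> and \<open>u\<close> is divergence free, then for a weight \<open>p = exp h\<close> the integral
  \<open>J = \<integral> p w\<^sup>2\<close> satisfies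
  \<open>J' \<le> \<integral> w\<^sup>2 p (h\<^sub>t + \<nu> \<bar>\<nabla>h\<bar>\<^sup>2 + U\<^sup>2/\<nu>)\<close>: the dissipation absorbs the cross term. The Gaussian
  weight \<open>h = r\<^sup>2/\<lambda>(t)\<^sup>2\<close> solves \<open>h\<^sub>t + \<nu> \<bar>\<nabla>h\<bar>\<^sup>2 = 0\<close>, and suitable truncations are
  subsolutions, so Gronwall's inequality and Fatou's lemma bound the Gaussian energy.

  The real difficulty is the bound on \<open>u\<close>. A solution is only assumed to be integrable at each
  time separately, and \<open>\<bar>u\<bar>\<close> is controlled by \<open>sup \<bar>\<omega>\<bar>\<close> and the mass
  \<open>\<integral> \<bar>\<omega>\<bar>\<close>. While \<open>u\<close> is bounded the mass does not increase; what has to be excluded is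
  mass entering from infinity at infinite speed. Since \<open>\<omega> u\<close> is a divergence of quadratic
  expressions in \<open>u\<close>, the part of the velocity generated beyond distance \<open>R\<close> changes at rate
  \<open>O((\<nu> M + U\<^sup>2)/R)\<close>, while the rest is \<open>O(M R)\<close>, where \<open>M = sup \<bar>\<omega>\<bar>\<close>. With \<open>R\<close> proportional
  to \<open>U / M\<close>, the velocity cannot drop from arbitrarily large values within a time step depending
  only on \<open>M\<close>. Together with Baire's theorem this shows that the mass is bounded on bounded time
  intervals.
\<close>

section \<open>Integration on the plane\<close>

text \<open>Integrability at each single time gives no bound for the velocity on any time interval,
  so a forward continuity argument has nothing to start from. The estimate therefore runs backwards:
  if all times of (a, t] are locally harmless, the velocity on [s, t] is finite for every s > a, and
  it is then bounded by its size at the right end, which the mass there controls. This bound is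
  uniform in s, so it survives s -> a even if \<open>a\<close> is bad, and the mass at
  \<open>a\<close> controls the mass to its right.

  In the energy estimate the weight must have exactly the width lambda(t), without loss. There is
  room because absorbing the cross term into the dissipation costs only (nu/2) |grad h|^2 of the
  available nu |grad h|^2; the rest pays for the drift u . grad h and for the cutoff. Truncating h
  makes the weight bounded, so that convergence to the datum in L2, with no weight, suffices to
  compare with the initial energy; the truncation is removed only after the estimate.\<close>

lemma cball_real2: "r \<ge> 0 \<Longrightarrow> emeasure lborel (cball (c::real^2) r) = ennreal (unit_ball_vol 2 * r\<^sup>2)"
  by (simp add: emeasure_cball)

text \<open>Selects the dyadic shell of a point. Kernels are integrated by summing over balls of
  radii 2^k, which replaces polar coordinates.\<close>

lemma dyadic_scale:
  fixes x :: real assumes "x \<ge> 1"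
  obtains k :: nat where "2^k \<le> x" "x \<le> 2^(Suc k)"
proof -
  define P where "P = (\<lambda>n::nat. x \<le> 2^(Suc n))"
  obtain n where "x < 2^n" using real_arch_pow[of 2 x] by auto
  then have "P n" unfolding P_def using zero_less_power[of "2::real" n] by (simp, linarith)
  then have L: "P (LEAST n. P n)" by (rule LeastI)
  have "2^(LEAST n. P n) \<le> x"
  proof (cases "LEAST n. P n")
    case 0 then show ?thesis using assms by simp
  next
    case (Suc m)
    then have "\<not> P m" using not_less_Least[of m P] by simp
    then show ?thesis using Suc by (simp add: P_def)
  qed
  then show ?thesis using L that unfolding P_def by blast
qed

text \<open>12 = 4 + 8: the shells inside radius R contribute 4 ball volumes, those outside
  contribute 8.\<close>

definition ker_const :: real where "ker_const = 12 * unit_ball_vol 2"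

lemma ker_const_pos: "ker_const > 0"
  by (simp add: ker_const_def)

text \<open>Like 1 / (R^2 |z|) inside radius R and 1 / |z|^3 outside, so its integral is O(1/R). It
  is the common majorant for the error of regularising the Biot--Savart kernel at scale R and for
  the second derivatives of \<open>far_kernel\<close>.\<close>

definition riesz_ker :: "real \<Rightarrow> real^2 \<Rightarrow> real" where
  "riesz_ker R z = 1 / (norm z * ((norm z)\<^sup>2 + R\<^sup>2))"

lemma riesz_ker_nonneg: "riesz_ker R z \<ge> 0"
  by (simp add: riesz_ker_def)

lemma riesz_ker_measurable [measurable]: "riesz_ker R \<in> borel_measurable borel"
  unfolding riesz_ker_def by measurable

lemma nn_integral_riesz_ker:
  assumes R: "R > 0"
  shows "(\<integral>\<^sup>+ z. ennreal (riesz_ker R z) \<partial>lborel) \<le> ennreal (ker_const / R)"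
proof -
  let ?v = "unit_ball_vol 2 :: real"
  have v: "?v > 0" by simp
  \<comment> \<open>Constants on balls: \<open>a k\<close> dominates the kernel on the k-th shell
    inside radius R, \<open>b k\<close> on the k-th shell outside. Both integrals form geometric
    sequences of ratio 1/2.\<close>
  define a where "a = (\<lambda>(k::nat) (z::real^2). ennreal (2^(Suc k)/R^3) * indicator (cball 0 (R/2^k)) z)"
  define b where "b = (\<lambda>(k::nat) (z::real^2). ennreal ((1/8)^k/R^3) * indicator (cball 0 (R*2^Suc k)) z)"
  have am[measurable]: "a k \<in> borel_measurable borel" for k unfolding a_def by (intro borel_measurable_times_ennreal borel_measurable_const borel_measurable_indicator) simp
  have bm[measurable]: "b k \<in> borel_measurable borel" for k unfolding b_def by (intro borel_measurable_times_ennreal borel_measurable_const borel_measurable_indicator) simp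
  have single: "f k \<le> (\<Sum>k. f k)" for f :: "nat \<Rightarrow> ennreal" and k
    using sum_le_suminf[of f "{k}"] by simp
  have pt: "ennreal (riesz_ker R z) \<le> (\<Sum>k. a k z) + (\<Sum>k. b k z)" for z
  proof (cases "z = 0")
    \<comment> \<open>Division by zero gives the kernel the value 0 at the origin.\<close>
    case True then show ?thesis by (simp add: riesz_ker_def)
  next
    case False
    define r where "r = norm z"
    have r: "r > 0" using False by (simp add: r_def)
    show ?thesis
    proof (cases "r \<le> R")
      case True
      then have "R / r \<ge> 1" using r by simp
      then obtain k where k: "2^k \<le> R/r" "R/r \<le> 2^Suc k" by (rule dyadic_scale)
      have "r \<le> R / 2^k" using k(1) r by (simp add: field_simps)
      then have z: "z \<in> cball 0 (R/2^k)" by (simp add: r_def)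
      have "riesz_ker R z \<le> 1 / (r * R\<^sup>2)"
        unfolding riesz_ker_def r_def[symmetric] using r R by (intro divide_left_mono mult_left_mono mult_pos_pos add_pos_nonneg) auto
      also have "\<dots> = (R/r) / R^3" using r R by (simp add: field_simps power3_eq_cube power2_eq_square)
      also have "\<dots> \<le> 2^Suc k / R^3" using k R by (intro divide_right_mono) auto
      finally have "ennreal (riesz_ker R z) \<le> a k z"
        unfolding a_def using z by (simp add: ennreal_leI)
      also have "\<dots> \<le> (\<Sum>k. a k z)" by (rule single)
      finally show ?thesis by (simp add: add_increasing2)
    next
      case F: False
      then have "r / R \<ge> 1" using R by simp
      then obtain k where k: "2^k \<le> r/R" "r/R \<le> 2^Suc k" by (rule dyadic_scale)
      have "r \<le> R * 2^Suc k" using k(2) R by (simp add: field_simps)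
      then have z: "z \<in> cball 0 (R*2^Suc k)" by (simp add: r_def)
      have k1: "R*2^k \<le> r" using k(1) R by (simp add: field_simps)
      have "riesz_ker R z \<le> 1 / (r * r\<^sup>2)"
        unfolding riesz_ker_def r_def[symmetric] using r R by (intro divide_left_mono mult_left_mono mult_pos_pos add_pos_nonneg) auto
      also have "\<dots> = 1 / r^3" by (simp add: power3_eq_cube power2_eq_square)
      also have "\<dots> \<le> 1 / (R*2^k)^3" using k1 R r by (intro divide_left_mono power_mono) auto
      also have "\<dots> = (1/8)^k / R^3"
      proof -
        have "((2::real)^k)^3 = 8^k" by (simp flip: power_mult power_mult_distrib add: mult.commute[of k] power_mult)
        then show ?thesis by (simp add: power_mult_distrib power_one_over)
      qed
      finally have "ennreal (riesz_ker R z) \<le> b k z"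
        unfolding b_def using z by (simp add: ennreal_leI)
      also have "\<dots> \<le> (\<Sum>k. b k z)" by (rule single)
      finally show ?thesis by (simp add: add_increasing)
    qed
  qed
  have g: "(\<lambda>k. c * (1/2)^k) sums (c * 2)" for c :: real
    using sums_mult[OF geometric_sums[of "1/2::real"], of c] by simp
  have ia: "(\<integral>\<^sup>+z. a k z \<partial>lborel) = ennreal (2 * ?v / R * (1/2)^k)" for k
  proof -
    have "(\<integral>\<^sup>+z. a k z \<partial>lborel) = ennreal (2^(Suc k)/R^3) * ennreal (?v * (R/2^k)\<^sup>2)"
      unfolding a_def using R by (simp add: nn_integral_cmult_indicator cball_real2)
    also have "\<dots> = ennreal (2^(Suc k)/R^3 * (?v * (R/2^k)\<^sup>2))"
      using R v by (subst ennreal_mult) auto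
    also have "2^(Suc k)/R^3 * (?v * (R/2^k)\<^sup>2) = 2 * ?v / R * (1/2)^k"
      using R by (simp add: field_simps power3_eq_cube power2_eq_square power_one_over)
    finally show ?thesis .
  qed
  have ib: "(\<integral>\<^sup>+z. b k z \<partial>lborel) = ennreal (4 * ?v / R * (1/2)^k)" for k
  proof -
    have "(\<integral>\<^sup>+z. b k z \<partial>lborel) = ennreal ((1/8)^k/R^3) * ennreal (?v * (R*2^Suc k)\<^sup>2)"
      unfolding b_def using R by (simp add: nn_integral_cmult_indicator cball_real2)
    also have "\<dots> = ennreal ((1/8)^k/R^3 * (?v * (R*2^Suc k)\<^sup>2))"
      using R v by (subst ennreal_mult) auto
    also have "(1/8)^k/R^3 * (?v * (R*2^Suc k)\<^sup>2) = 4 * ?v / R * ((1/8)^k * (2^k * 2^k))"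
      using R by (simp add: field_simps power3_eq_cube power2_eq_square)
    also have "(1/8)^k * (2^k * 2^k) = (1/2::real)^k"
      by (simp flip: power_mult_distrib)
    finally show ?thesis .
  qed
  have "(\<integral>\<^sup>+ z. ennreal (riesz_ker R z) \<partial>lborel) \<le> (\<integral>\<^sup>+ z. (\<Sum>k. a k z) + (\<Sum>k. b k z) \<partial>lborel)"
    by (intro nn_integral_mono pt)
  also have "\<dots> = (\<Sum>k. \<integral>\<^sup>+z. a k z \<partial>lborel) + (\<Sum>k. \<integral>\<^sup>+z. b k z \<partial>lborel)"
    by (simp add: nn_integral_add nn_integral_suminf)
  also have "\<dots> = ennreal (2 * ?v / R * 2) + ennreal (4 * ?v / R * 2)"
    unfolding ia ib using R v by (intro arg_cong2[where f="(+)"] suminf_ennreal_eq g) auto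
  also have "\<dots> = ennreal (ker_const / R)"
    using R v by (simp flip: ennreal_plus add: ker_const_def field_simps)
  finally show ?thesis .
qed

lemma integrable_riesz_ker: "R > 0 \<Longrightarrow> integrable lborel (riesz_ker R)"
  and integral_riesz_ker: "R > 0 \<Longrightarrow> (LINT z|lborel. riesz_ker R z) \<le> ker_const / R"
proof -
  assume R: "R > 0"
  show i: "integrable lborel (riesz_ker R)"
  proof (rule integrableI_bounded)
    show "(\<integral>\<^sup>+ x. ennreal (norm (riesz_ker R x)) \<partial>lborel) < \<infinity>"
      using nn_integral_riesz_ker[OF R] ennreal_less_top order_le_less_trans
      by (fastforce simp: riesz_ker_nonneg)
  qed simp
  have "ennreal (LINT z|lborel. riesz_ker R z) \<le> ennreal (ker_const / R)"
    using nn_integral_riesz_ker[OF R] i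
    by (simp add: nn_integral_eq_integral riesz_ker_nonneg)
  then show "(LINT z|lborel. riesz_ker R z) \<le> ker_const / R"
    using R ker_const_pos by (simp add: ennreal_le_iff)
qed

lemma lborel_distr_shift: "distr lborel borel (\<lambda>x. a + x) = (lborel :: 'a::euclidean_space measure)"
  using lborel_affine[of 1 a] by (simp add: density_1)

lemma lborel_distr_reflect: "distr lborel borel (\<lambda>x. a - x) = (lborel :: 'a::euclidean_space measure)"
  using lborel_affine[of "-1" a] by (simp add: density_1)

lemma
  fixes f :: "'a::euclidean_space \<Rightarrow> real"
  assumes [measurable]: "f \<in> borel_measurable borel"
  shows integral_shift: "(LINT x|lborel. f (a + x)) = (LINT x|lborel. f x)"
    and integral_reflect: "(LINT x|lborel. f (a - x)) = (LINT x|lborel. f x)"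
    and integrable_shift: "integrable lborel (\<lambda>x. f (a + x)) \<longleftrightarrow> integrable lborel f"
    and integrable_reflect: "integrable lborel (\<lambda>x. f (a - x)) \<longleftrightarrow> integrable lborel f"
proof -
  have [measurable]: "f \<in> borel_measurable lborel" by simp
  show "(LINT x|lborel. f (a + x)) = (LINT x|lborel. f x)"
    by (subst (2) lborel_distr_shift[of a, symmetric], subst integral_distr) simp_all
  show "(LINT x|lborel. f (a - x)) = (LINT x|lborel. f x)"
    by (subst (2) lborel_distr_reflect[of a, symmetric], subst integral_distr) simp_all
  show "integrable lborel (\<lambda>x. f (a + x)) \<longleftrightarrow> integrable lborel f"
    by (subst (2) lborel_distr_shift[of a, symmetric], subst integrable_distr_eq) simp_all
  show "integrable lborel (\<lambda>x. f (a - x)) \<longleftrightarrow> integrable lborel f"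
    by (subst (2) lborel_distr_reflect[of a, symmetric], subst integrable_distr_eq) simp_all
qed

lemma integrable_compact_support:
  fixes f :: "'a::euclidean_space \<Rightarrow> real"
  assumes c: "continuous_on UNIV f" and s: "\<And>x. norm x > r \<Longrightarrow> f x = 0"
  shows "integrable lborel f"
proof -
  have "integrable lborel (\<lambda>x. indicator (cball 0 r) x *\<^sub>R f x)"
    by (rule borel_integrable_compact) (use c continuous_on_subset in auto)
  also have "(\<lambda>x. indicator (cball 0 r) x *\<^sub>R f x) = f"
    using s by (auto simp: fun_eq_iff indicator_def)
  finally show ?thesis .
qed

text \<open>The Leibniz rule differentiates gauge integrals over boxes; this transfers its results
  to Lebesgue integrals over the plane.\<close>

lemma integral_cbox_eq_lborel:
  fixes g :: "'a::euclidean_space \<Rightarrow> real"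
  assumes g: "continuous_on UNIV g" and s: "\<And>x. x \<notin> cbox a b \<Longrightarrow> g x = 0"
  shows "integral (cbox a b) g = (LINT x|lborel. g x)"
proof -
  obtain R where R: "\<And>x. x \<in> cbox a b \<Longrightarrow> norm x \<le> R"
    using bounded_cbox[of a b] by (auto simp: bounded_iff)
  have "integrable lborel g"
    by (rule integrable_compact_support[of _ R]) (use g s R in \<open>auto simp: not_le[symmetric]\<close>)
  then have "(g has_integral (LINT x|lborel. g x)) UNIV" by (rule has_integral_integral_lborel)
  then have "(g has_integral (LINT x|lborel. g x)) (cbox a b)"
    using s has_integral_restrict_UNIV[of "cbox a b" g "LINT x|lborel. g x"]
    by (smt (verit) has_integral_cong)
  then show ?thesis by (rule integral_unique)
qed

section \<open>Partial derivatives and integration by parts\<close>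

definition has_pd :: "(real^2 \<Rightarrow> real) \<Rightarrow> 2 \<Rightarrow> real \<Rightarrow> real^2 \<Rightarrow> bool" where
  "has_pd f i D x \<longleftrightarrow> ((\<lambda>h. f (x + h *\<^sub>R axis i 1)) has_real_derivative D) (at 0)"

lemma has_pd_at:
  assumes "has_pd f i D (x + h *\<^sub>R axis i 1)"
  shows "((\<lambda>h. f (x + h *\<^sub>R axis i 1)) has_real_derivative D) (at h)"
proof -
  have "((\<lambda>k. f (x + (h + k) *\<^sub>R axis i 1)) has_real_derivative D) (at 0)"
    using assms unfolding has_pd_def by (simp add: algebra_simps)
  then show ?thesis
    by (simp add: DERIV_shift[where z=h and x=0, simplified] add.commute)
qed

lemma has_pd_mult:
  assumes "has_pd f i D x" "has_pd g i E x"
  shows "has_pd (\<lambda>x. f x * g x) i (D * g x + E * f x) x"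
  using DERIV_mult[OF assms[unfolded has_pd_def]] by (simp add: has_pd_def)

lemma has_pd_add:
  assumes "has_pd f i D x" "has_pd g i E x"
  shows "has_pd (\<lambda>x. f x + g x) i (D + E) x"
  using DERIV_add[OF assms[unfolded has_pd_def]] by (simp add: has_pd_def)

lemma has_pd_chain:
  assumes "has_pd f i D x" "(b has_real_derivative b') (at (f x))"
  shows "has_pd (\<lambda>x. b (f x)) i (b' * D) x"
  using DERIV_chain2[of b b' "\<lambda>h. f (x + h *\<^sub>R axis i 1)" 0 D UNIV] assms by (simp add: has_pd_def)

lemma has_pd_support:
  assumes F: "has_pd F i D x" and s: "\<And>x. norm x > r \<Longrightarrow> F x = 0" and x: "norm x > r"
  shows "D = 0"
proof -
  let ?g = "\<lambda>h. F (x + h *\<^sub>R axis i 1)"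
  have "((\<lambda>h. 0) has_real_derivative D) (at 0)"
  proof (rule has_field_derivative_transform_within[where f="?g" and d="norm x - r"])
    show "(?g has_real_derivative D) (at 0)" using F by (simp add: has_pd_def)
    show "?g h = 0" if "dist h 0 < norm x - r" for h
    proof (rule s)
      have "norm x \<le> norm (x + h *\<^sub>R axis i 1) + norm (h *\<^sub>R (axis i 1 :: real^2))"
        by (metis add_diff_cancel_right' norm_triangle_ineq4)
      then show "norm (x + h *\<^sub>R axis i 1) > r" using that by simp
    qed
  qed (use x in auto)
  then show ?thesis using DERIV_unique DERIV_const by blast
qed

text \<open>By translation invariance the integral of F (x + h e_i) does not depend on h;
  differentiating under the integral at h = 0 gives the claim.\<close>

lemma integral_pd_eq_0:
  assumes F: "\<And>x. has_pd F i (F' x) x"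
    and c: "continuous_on UNIV F" and c': "continuous_on UNIV F'"
    and s: "\<And>x. norm x > r \<Longrightarrow> F x = 0"
  shows "(LINT x|lborel. F' x) = 0"
proof -
  note s' = has_pd_support[OF F s]
  \<comment> \<open>The box has a margin, so that translates by at most 1 still vanish outside
    it.\<close>
  define a :: "real^2" where "a = (\<chi> i. - (\<bar>r\<bar> + 2))"
  define b :: "real^2" where "b = (\<chi> i. \<bar>r\<bar> + 2)"
  have out: "norm x > \<bar>r\<bar> + 1" if x: "x \<notin> cbox a b" for x
  proof -
    obtain j where "\<not> (a $ j \<le> x $ j \<and> x $ j \<le> b $ j)" using x by (auto simp: mem_box_cart)
    then have "\<bar>x $ j\<bar> > \<bar>r\<bar> + 2" by (auto simp: a_def b_def)
    then show ?thesis using component_le_norm_cart[of x j] by linarith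
  qed
  have cs: "continuous_on UNIV (\<lambda>x. F (x + h *\<^sub>R axis i 1))" for h
    by (rule continuous_on_compose2[OF c]) (auto intro!: continuous_intros)
  have cF': "continuous_on S (\<lambda>p. F' (snd p + fst p *\<^sub>R axis i 1))" for S
    by (rule continuous_on_compose2[OF c']) (auto intro!: continuous_intros)
  have I: "integral (cbox a b) (\<lambda>x. F (x + h *\<^sub>R axis i 1)) = (LINT x|lborel. F x)" if "h \<in> {-1..1}" for h
  proof -
    have "integral (cbox a b) (\<lambda>x. F (x + h *\<^sub>R axis i 1)) = (LINT x|lborel. F (x + h *\<^sub>R axis i 1))"
    proof (rule integral_cbox_eq_lborel[OF cs])
      fix x assume "x \<notin> cbox a b"
      then have "norm x > \<bar>r\<bar> + 1" by (rule out)
      moreover have "norm x \<le> norm (x + h *\<^sub>R axis i 1) + norm (h *\<^sub>R (axis i 1 :: real^2))"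
        by (metis add_diff_cancel_right' norm_triangle_ineq4)
      ultimately show "F (x + h *\<^sub>R axis i 1) = 0" using that by (intro s) auto
    qed
    also have "\<dots> = (LINT x|lborel. F x)"
      using integral_shift[of F "h *\<^sub>R axis i 1"] c
      by (simp add: add.commute borel_measurable_continuous_onI)
    finally show ?thesis .
  qed
  have "((\<lambda>h. integral (cbox a b) (\<lambda>x. F (x + h *\<^sub>R axis i 1))) has_field_derivative
     integral (cbox a b) (\<lambda>x. F' (x + 0 *\<^sub>R axis i 1))) (at 0 within {-1..1})"
  proof (rule leibniz_rule_field_derivative)
    show "((\<lambda>h. F (x + h *\<^sub>R axis i 1)) has_field_derivative F' (x + h *\<^sub>R axis i 1)) (at h within {- 1..1})" for x h
      by (rule has_field_derivative_at_within, rule has_pd_at, rule F)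
    show "(\<lambda>x. F (x + h *\<^sub>R axis i 1)) integrable_on cbox a b" for h
      by (rule integrable_continuous) (use cs continuous_on_subset in blast)
    show "continuous_on ({- 1..1} \<times> cbox a b) (\<lambda>(h, x). F' (x + h *\<^sub>R axis i 1))"
      using cF' by (simp add: case_prod_unfold)
  qed auto
  moreover have "((\<lambda>h. integral (cbox a b) (\<lambda>x. F (x + h *\<^sub>R axis i 1))) has_field_derivative 0) (at 0 within {-1..1})"
    by (rule has_field_derivative_transform_within[where f="\<lambda>_. LINT x|lborel. F x" and d=1])
      (auto simp: I)
  ultimately have "integral (cbox a b) F' = 0"
    using at_within_interior[of "0::real" "{-1..1}"] DERIV_unique by fastforce
  moreover have "integral (cbox a b) F' = (LINT x|lborel. F' x)"
    by (rule integral_cbox_eq_lborel[OF c']) (use s' out in force)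
  ultimately show ?thesis by simp
qed

section \<open>Regularised Biot--Savart kernels\<close>

lemma norm_sq_2: "(norm (z::real^2))\<^sup>2 = (z $ 1)\<^sup>2 + (z $ 2)\<^sup>2"
  by (simp add: norm_vec_def L2_set_def sum_2)

lemma perp_nth: "perp z $ 1 = - z $ 2" "perp z $ 2 = z $ 1"
  by (simp_all add: perp_def)

lemma perp_nth_le: "\<bar>perp z $ i\<bar> \<le> norm z"
  using exhaust_2[of i] component_le_norm_cart[of z 1] component_le_norm_cart[of z 2]
  by (auto simp: perp_nth)

lemma axis_2 [simp]: "axis (1::2) (1::real) $ (2::2) = 0" "axis (2::2) (1::real) $ (1::2) = 0"
  by (simp_all add: axis_def)

lemma continuous_on_perp_nth [continuous_intros]:
  "continuous_on S f \<Longrightarrow> continuous_on S (\<lambda>x. perp (f x) $ i)"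
proof -
  assume f: "continuous_on S f"
  consider "i = 1" | "i = 2" using exhaust_2[of i] by auto
  then show ?thesis
  proof cases
    case 1 show ?thesis unfolding 1 perp_nth by (intro continuous_intros f)
  next
    case 2 show ?thesis unfolding 2 perp_nth by (intro continuous_intros f)
  qed
qed

lemma has_pd_nth: "has_pd (\<lambda>z. z $ i) j (axis j 1 $ i) z"
  unfolding has_pd_def by (auto intro!: derivative_eq_intros)

lemma has_pd_perp: "has_pd (\<lambda>z. perp z $ i) j (perp (axis j 1) $ i) z"
  using exhaust_2[of i] by (auto simp: perp_nth has_pd_def intro!: derivative_eq_intros)

lemma has_pd_norm_sq: "has_pd (\<lambda>z. (norm z)\<^sup>2) j (2 * z $ j) z"
proof -
  have "has_pd (\<lambda>z. z$1 * z$1 + z$2 * z$2) j ((axis j 1 $ 1 * z$1 + axis j 1 $ 1 * z$1) + (axis j 1 $ 2 * z$2 + axis j 1 $ 2 * z$2)) z"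
    by (intro has_pd_add has_pd_mult has_pd_nth)
  moreover have "(axis j 1 $ 1 * z$1 + axis j 1 $ 1 * z$1) + (axis j 1 $ 2 * z$2 + axis j 1 $ 2 * z$2) = 2 * z $ j"
    using exhaust_2[of j] by auto
  ultimately show ?thesis unfolding norm_sq_2 unfolding power2_eq_square by simp
qed

lemma has_pd_cong: "has_pd f i D x \<Longrightarrow> (\<And>x. f x = g x) \<Longrightarrow> D = E \<Longrightarrow> has_pd g i E x"
  by (simp add: has_pd_def)

text \<open>Regularising the Biot--Savart kernel by \<open>d\<close> in this way keeps it divergence free, and makes
  its curl the nonnegative approximate identity \<open>curl_kernel d\<close>.\<close>

definition bs_kernel :: "real \<Rightarrow> 2 \<Rightarrow> real^2 \<Rightarrow> real" where
  "bs_kernel d i z = perp z $ i * (1 / (2 * pi * ((norm z)\<^sup>2 + d\<^sup>2)))"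

definition bs_kernel_pd :: "real \<Rightarrow> 2 \<Rightarrow> 2 \<Rightarrow> real^2 \<Rightarrow> real" where
  "bs_kernel_pd d i j z = perp (axis j 1) $ i / (2 * pi * ((norm z)\<^sup>2 + d\<^sup>2))
     - perp z $ i * z $ j / (pi * ((norm z)\<^sup>2 + d\<^sup>2)\<^sup>2)"

definition curl_kernel :: "real \<Rightarrow> real^2 \<Rightarrow> real" where
  "curl_kernel d z = d\<^sup>2 / (pi * ((norm z)\<^sup>2 + d\<^sup>2)\<^sup>2)"

lemma bs_kernel_measurable [measurable]: "bs_kernel d i \<in> borel_measurable borel"
proof -
  have [measurable]: "(\<lambda>z. perp z $ i) \<in> borel_measurable borel"
    by (intro borel_measurable_continuous_onI continuous_intros)
  show ?thesis unfolding bs_kernel_def by measurable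
qed

lemma nsq_pos: "d > 0 \<Longrightarrow> (norm z)\<^sup>2 + d\<^sup>2 > (0::real)"
  by (simp add: add_nonneg_pos)

lemma continuous_on_bs_kernel: "d > 0 \<Longrightarrow> continuous_on UNIV (bs_kernel d i)"
  unfolding bs_kernel_def[abs_def] by (intro continuous_intros) (auto simp: nsq_pos less_imp_neq[OF nsq_pos, symmetric])

lemma continuous_on_bs_kernel_pd: "d > 0 \<Longrightarrow> continuous_on UNIV (bs_kernel_pd d i j)"
  unfolding bs_kernel_pd_def[abs_def] by (intro continuous_intros) (auto simp: nsq_pos less_imp_neq[OF nsq_pos, symmetric])

lemma continuous_on_curl_kernel: "d > 0 \<Longrightarrow> continuous_on UNIV (curl_kernel d)"
  unfolding curl_kernel_def[abs_def] by (intro continuous_intros) (auto simp: nsq_pos less_imp_neq[OF nsq_pos, symmetric])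

lemma has_pd_bs_kernel:
  assumes "d > 0"
  shows "has_pd (bs_kernel d i) j (bs_kernel_pd d i j z) z"
proof -
  let ?N = "(norm z)\<^sup>2 + d\<^sup>2"
  have N: "?N > 0" by (rule nsq_pos[OF assms])
  have "((\<lambda>s. 1 / (2 * pi * (s + d\<^sup>2))) has_real_derivative - 1 / (2 * pi * ?N\<^sup>2)) (at ((norm z)\<^sup>2))"
  proof -
    have "((\<lambda>s. 1 / (2 * pi) * inverse (s + d\<^sup>2)) has_real_derivative 1 / (2 * pi) * (- (inverse ?N * 1 * inverse ?N))) (at ((norm z)\<^sup>2))"
      using N by (intro DERIV_cmult DERIV_inverse') (auto intro!: derivative_eq_intros)
    then show ?thesis by (simp add: inverse_eq_divide power2_eq_square)
  qed
  then have "has_pd (\<lambda>z. 1 / (2 * pi * ((norm z)\<^sup>2 + d\<^sup>2))) j (- 1 / (2 * pi * ?N\<^sup>2) * (2 * z $ j)) z"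
    by (rule has_pd_chain[OF has_pd_norm_sq])
  from has_pd_mult[OF has_pd_perp[of i] this]
  show ?thesis unfolding bs_kernel_def[abs_def]
    by (rule has_pd_cong) (simp_all add: bs_kernel_pd_def)
qed

lemma bs_kernel_div: "bs_kernel_pd d 1 1 z + bs_kernel_pd d 2 2 z = 0"
  by (simp add: bs_kernel_pd_def perp_nth)

lemma bs_kernel_curl:
  assumes "d > 0" shows "bs_kernel_pd d 2 1 z - bs_kernel_pd d 1 2 z = curl_kernel d z"
proof -
  have "(z$1)\<^sup>2 + (z$2)\<^sup>2 + d\<^sup>2 > 0" using nsq_pos[OF assms, of z] by (simp add: norm_sq_2)
  then have *: "(z$1)\<^sup>2 + (z$2)\<^sup>2 + d\<^sup>2 \<noteq> 0" by simp
  define N where "N = (z$1)\<^sup>2 + (z$2)\<^sup>2 + d\<^sup>2"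
  have "bs_kernel_pd d 2 1 z - bs_kernel_pd d 1 2 z = 1 / (pi * N) - ((z$1)\<^sup>2 + (z$2)\<^sup>2) / (pi * N\<^sup>2)"
    unfolding N_def bs_kernel_pd_def norm_sq_2 by (simp add: perp_nth power2_eq_square add_divide_distrib)
  also have "\<dots> = (N - ((z$1)\<^sup>2 + (z$2)\<^sup>2)) / (pi * N\<^sup>2)"
    using * unfolding N_def[symmetric] by (simp add: field_simps power2_eq_square)
  also have "\<dots> = curl_kernel d z" by (simp add: N_def curl_kernel_def norm_sq_2)
  finally show ?thesis .
qed

text \<open>Uniform in \<open>d\<close>, including 0. The first summand is integrable and is paired
  with the sup norm of the vorticity, the second is bounded and is paired with its mass.\<close>

lemma bs_kernel_le: "\<bar>bs_kernel d i z\<bar> \<le> riesz_ker 1 z + 1"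
proof (cases "z = 0")
  case True then show ?thesis using perp_nth_le[of 0 i] by (simp add: bs_kernel_def riesz_ker_def)
next
  case False
  define r where "r = norm z"
  have r: "r > 0" using False by (simp add: r_def)
  have "\<bar>bs_kernel d i z\<bar> = \<bar>perp z $ i\<bar> * (1 / (2 * pi * (r\<^sup>2 + d\<^sup>2)))"
    by (simp add: bs_kernel_def abs_mult r_def)
  also have "\<dots> \<le> r * (1 / (2 * pi * (r\<^sup>2 + d\<^sup>2)))"
    using perp_nth_le[of z i] by (intro mult_right_mono) (auto simp: r_def)
  also have "\<dots> \<le> r * (1 / (2 * 1 * r\<^sup>2))"
    using r pi_gt3 by (intro mult_left_mono divide_left_mono mult_mono mult_pos_pos) (auto simp: add_pos_nonneg)
  also have "\<dots> = 1 / (2 * r)" using r by (simp add: power2_eq_square)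
  also have "\<dots> \<le> 1 / (r * (r\<^sup>2 + 1)) + 1"
  proof (cases "r \<le> 1")
    case True
    then have "r * (r\<^sup>2 + 1) \<le> 2 * r" using r power_mono[of r 1 2] by simp
    then have "1 / (2 * r) \<le> 1 / (r * (r\<^sup>2 + 1))" using r by (intro divide_left_mono) (auto simp: add_nonneg_pos)
    then show ?thesis by simp
  next
    case False
    then have "1 / (2 * r) \<le> 1" by simp
    moreover have "1 / (r * (r\<^sup>2 + 1)) \<ge> 0" using r by simp
    ultimately show ?thesis by linarith
  qed
  finally show ?thesis by (simp add: riesz_ker_def r_def)
qed

text \<open>The difference of the radial factors is d^2 / (2 pi r^2 (r^2 + d^2)). Paired with a
  bounded vorticity this integrates to O(d), uniformly in space.\<close>

lemma bs_kernel_diff_le: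
  assumes d: "d > 0" shows "\<bar>bs_kernel 0 i z - bs_kernel d i z\<bar> \<le> d\<^sup>2 * riesz_ker d z"
proof (cases "z = 0")
  case True then show ?thesis using perp_nth_le[of 0 i] by (simp add: bs_kernel_def riesz_ker_def)
next
  case False
  define r where "r = norm z"
  have r: "r > 0" using False by (simp add: r_def)
  then have p: "r\<^sup>2 + d\<^sup>2 > 0" by (simp add: add_pos_nonneg)
  have "bs_kernel 0 i z - bs_kernel d i z = perp z $ i * (1 / (2*pi*r\<^sup>2) - 1 / (2 * pi * (r\<^sup>2 + d\<^sup>2)))"
    by (simp add: bs_kernel_def r_def right_diff_distrib)
  also have "1 / (2*pi*r\<^sup>2) - 1 / (2 * pi * (r\<^sup>2 + d\<^sup>2)) = d\<^sup>2 / (2*pi*r\<^sup>2*(r\<^sup>2 + d\<^sup>2))"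
  proof -
    have "1 / (2*pi*a) - 1 / (2*pi*b) = (b - a) / (2*pi*a*b)" if "a > 0" "b > 0" for a b :: real
      using that by (simp add: field_simps)
    from this[of "r\<^sup>2" "r\<^sup>2 + d\<^sup>2"] show ?thesis using r p by simp
  qed
  finally have "\<bar>bs_kernel 0 i z - bs_kernel d i z\<bar> = \<bar>perp z $ i\<bar> * (d\<^sup>2 / (2*pi*r\<^sup>2*(r\<^sup>2 + d\<^sup>2)))"
    by (simp add: abs_mult)
  also have "\<dots> \<le> r * (d\<^sup>2 / (2*pi*r\<^sup>2*(r\<^sup>2 + d\<^sup>2)))"
    using perp_nth_le[of z i] by (intro mult_right_mono) (auto simp: r_def)
  also have "\<dots> \<le> r * (d\<^sup>2 / (1*r\<^sup>2*(r\<^sup>2 + d\<^sup>2)))"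
    using r p pi_gt3 by (intro mult_left_mono divide_left_mono mult_right_mono mult_pos_pos) auto
  also have "\<dots> = d\<^sup>2 * riesz_ker d z"
    using r p by (simp add: riesz_ker_def r_def power2_eq_square)
  finally show ?thesis .
qed

lemma bs_kernel_bounded:
  assumes d: "d > 0" shows "\<bar>bs_kernel d i z\<bar> \<le> 1 / d"
proof -
  define r where "r = norm z"
  have p: "r\<^sup>2 + d\<^sup>2 > 0" using d by (simp add: add_nonneg_pos)
  have "\<bar>bs_kernel d i z\<bar> = \<bar>perp z $ i\<bar> * (1 / (2 * pi * (r\<^sup>2 + d\<^sup>2)))"
    by (simp add: bs_kernel_def abs_mult r_def)
  also have "\<dots> \<le> r * (1 / (2 * pi * (r\<^sup>2 + d\<^sup>2)))"
    using perp_nth_le[of z i] by (intro mult_right_mono) (auto simp: r_def)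
  also have "\<dots> \<le> r * (1 / (1 * (r\<^sup>2 + d\<^sup>2)))"
    using pi_gt3 p by (intro mult_left_mono divide_left_mono mult_right_mono mult_pos_pos) (auto simp: r_def)
  also have "\<dots> \<le> 1 / d"
  proof -
    have "r * d \<le> r\<^sup>2 + d\<^sup>2" using sum_squares_bound[of r d] mult_nonneg_nonneg[of r d] d norm_ge_zero[of z] unfolding r_def by linarith
    then show ?thesis using p d by (simp add: field_simps)
  qed
  finally show ?thesis .
qed

lemma bs_kernel_pd_bounded:
  assumes d: "d > 0" shows "\<bar>bs_kernel_pd d i j z\<bar> \<le> 2 / d\<^sup>2"
proof -
  define N where "N = (norm z)\<^sup>2 + d\<^sup>2"
  have N: "N > 0" "N \<ge> d\<^sup>2" "N \<ge> (norm z)\<^sup>2" using nsq_pos[OF d] by (auto simp: N_def)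
  have "\<bar>perp (axis j 1) $ i / (2 * pi * N)\<bar> = \<bar>perp (axis j 1) $ i\<bar> / (2 * pi * N)"
    using N by (simp add: abs_mult)
  also have "\<dots> \<le> 1 / (1 * d\<^sup>2)"
    using perp_nth_le[of "axis j 1" i] N d pi_gt3 by (intro frac_le mult_mono) auto
  finally have 1: "\<bar>perp (axis j 1) $ i / (2 * pi * N)\<bar> \<le> 1 / d\<^sup>2" by simp
  have "\<bar>perp z $ i * z $ j / (pi * N\<^sup>2)\<bar> = (\<bar>perp z $ i\<bar> * \<bar>z $ j\<bar>) / (pi * N\<^sup>2)"
    using N by (simp add: abs_mult)
  also have "\<dots> \<le> (norm z * norm z) / (1 * N\<^sup>2)"
    using perp_nth_le[of z i] component_le_norm_cart[of z j] N pi_gt3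
    by (intro frac_le mult_mono) auto
  also have "\<dots> \<le> N / N\<^sup>2" using N divide_right_mono[OF N(3), of "N\<^sup>2"] by (simp add: power2_eq_square[of "norm z"])
  also have "\<dots> = 1 / N" using N by (simp add: power2_eq_square)
  also have "\<dots> \<le> 1 / d\<^sup>2" using N d by (intro divide_left_mono) auto
  finally have 2: "\<bar>perp z $ i * z $ j / (pi * N\<^sup>2)\<bar> \<le> 1 / d\<^sup>2" .
  have "\<bar>bs_kernel_pd d i j z\<bar> \<le> 1/d\<^sup>2 + 1/d\<^sup>2"
    using abs_triangle_ineq4[of "perp (axis j 1) $ i / (2 * pi * N)" "perp z $ i * z $ j / (pi * N\<^sup>2)"] 1 2
    unfolding bs_kernel_pd_def N_def by linarith
  then show ?thesis by simp
qed

lemma integrable_curl_kernel: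
  assumes d: "d > 0" shows "integrable lborel (curl_kernel d)"
proof (rule Bochner_Integration.integrable_bound)
  show "integrable lborel (\<lambda>z. d * riesz_ker d z)" using integrable_riesz_ker[OF d] by simp
  show "curl_kernel d \<in> borel_measurable lborel"
    using borel_measurable_continuous_onI[OF continuous_on_curl_kernel[OF d]] by simp
  \<comment> \<open>The origin has to be excluded: there \<open>riesz_ker\<close> is 0 by convention
    while \<open>curl_kernel\<close> is positive.\<close>
  have "norm (curl_kernel d z) \<le> norm (d * riesz_ker d z)" if "z \<noteq> 0" for z :: "real^2"
  proof -
    define r where "r = norm z"
    have r: "r > 0" using that by (simp add: r_def)
    have p: "r\<^sup>2 + d\<^sup>2 > 0" using r by (simp add: add_pos_nonneg)
    have "d * r \<le> r\<^sup>2 + d\<^sup>2" using sum_squares_bound[of r d] mult_pos_pos[OF d r] by (simp add: mult.commute)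
    also have "\<dots> \<le> pi * (r\<^sup>2 + d\<^sup>2)" using p pi_gt3 mult_right_mono[of 1 pi "r\<^sup>2 + d\<^sup>2"] by simp
    finally have "d * r * (d * (r\<^sup>2 + d\<^sup>2)) \<le> pi * (r\<^sup>2 + d\<^sup>2) * (d * (r\<^sup>2 + d\<^sup>2))"
      using d p by (intro mult_right_mono) auto
    then have "d\<^sup>2 / (pi * (r\<^sup>2 + d\<^sup>2)\<^sup>2) \<le> d / (r * (r\<^sup>2 + d\<^sup>2))"
      using r d p by (simp add: pos_divide_le_eq pos_le_divide_eq divide_simps power2_eq_square mult.assoc mult.left_commute mult.commute)
    then show ?thesis using r d p by (simp add: curl_kernel_def riesz_ker_def r_def[symmetric])
  qed
  then show "AE z in lborel. norm (curl_kernel d z) \<le> norm (d * riesz_ker d z)"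
    using AE_lborel_singleton[of "0::real^2"] by (auto elim: eventually_mono)
qed

text \<open>Polar coordinates would give the value 1. It is kept symbolic and enters
  \<open>osc_const\<close> as a positive factor.\<close>

definition curl_mass :: real where "curl_mass = (LINT z|lborel. curl_kernel 1 z)"

lemma curl_mass_pos: "curl_mass > 0"
proof -
  have "curl_mass \<ge> 0" unfolding curl_mass_def
    by (rule integral_nonneg_AE) (simp add: curl_kernel_def)
  moreover have "curl_mass \<noteq> 0"
  proof
    assume "curl_mass = 0"
    then have "AE z in lborel. curl_kernel 1 z = 0"
      using integrable_curl_kernel[of 1] unfolding curl_mass_def
      by (subst (asm) integral_nonneg_eq_0_iff_AE) (auto simp: curl_kernel_def)
    then have "AE z::real^2 in lborel. False"
      by (rule eventually_mono) (use less_imp_neq[OF nsq_pos[of 1], symmetric] in \<open>fastforce simp: curl_kernel_def\<close>)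
    then show False using ae_filter_eq_bot_iff[of "lborel :: (real^2) measure"] by (simp add: trivial_limit_def)
  qed
  ultimately show ?thesis by simp
qed

section \<open>Convolution of an integrable function with bounded smooth kernels\<close>

lemma continuous_on_convolution:
  fixes om g :: "real^2 \<Rightarrow> real"
  assumes i: "integrable lborel om" and c: "continuous_on UNIV g" and b: "\<And>z. \<bar>g z\<bar> \<le> C"
  shows "continuous_on UNIV (\<lambda>x. LINT y|lborel. om y * g (x - y))"
  unfolding continuous_on_sequentially o_def
proof safe
  fix X :: "nat \<Rightarrow> real^2" and a
  assume X: "X \<longlonglongrightarrow> a"
  have [measurable]: "g \<in> borel_measurable borel" by (rule borel_measurable_continuous_onI[OF c])
  have [measurable]: "om \<in> borel_measurable borel" using i by simp
  have "C \<ge> 0" using b[of 0] by linarith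
  show "(\<lambda>n. LINT y|lborel. om y * g (X n - y)) \<longlonglongrightarrow> (LINT y|lborel. om y * g (a - y))"
  proof (rule integral_dominated_convergence[where w="\<lambda>y. \<bar>om y\<bar> * C"])
    show "AE y in lborel. (\<lambda>n. om y * g (X n - y)) \<longlonglongrightarrow> om y * g (a - y)"
    proof (rule AE_I2)
      fix y
      have "(\<lambda>n. g (X n - y)) \<longlonglongrightarrow> g (a - y)"
        using c X by (intro isCont_tendsto_compose[of _ g]) (auto simp: continuous_on_eq_continuous_at intro!: tendsto_intros)
      then show "(\<lambda>n. om y * g (X n - y)) \<longlonglongrightarrow> om y * g (a - y)" by (intro tendsto_intros)
    qed
    show "AE y in lborel. norm (om y * g (X n - y)) \<le> \<bar>om y\<bar> * C" for n
      using b by (auto simp: abs_mult intro!: mult_left_mono)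
    show "integrable lborel (\<lambda>y. \<bar>om y\<bar> * C)" using i by simp
  qed measurable
qed

lemma has_pd_convolution:
  fixes om g :: "real^2 \<Rightarrow> real"
  assumes i: "integrable lborel om" and c: "continuous_on UNIV g" and b: "\<And>z. \<bar>g z\<bar> \<le> C"
    and g': "\<And>z. has_pd g j (g' z) z" and c': "continuous_on UNIV g'" and b': "\<And>z. \<bar>g' z\<bar> \<le> C'"
  shows "has_pd (\<lambda>x. LINT y|lborel. om y * g (x - y)) j (LINT y|lborel. om y * g' (x - y)) x"
proof -
  have [measurable]: "g \<in> borel_measurable borel" "g' \<in> borel_measurable borel"
    by (auto intro!: borel_measurable_continuous_onI c c')
  have [measurable]: "om \<in> borel_measurable borel" using i by simp
  have C: "C \<ge> 0" "C' \<ge> 0" using b[of 0] b'[of 0] by linarith+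
  let ?e = "axis j 1 :: real^2"
  \<comment> \<open>The mean value bound makes all difference quotients of g at most C' in modulus,
    which yields the dominating function |om| * C'.\<close>
  have lip: "\<bar>g (z + h *\<^sub>R ?e) - g z\<bar> \<le> C' * \<bar>h\<bar>" for z h
  proof -
    have "norm ((\<lambda>h. g (z + h *\<^sub>R ?e)) h - (\<lambda>h. g (z + h *\<^sub>R ?e)) 0) \<le> C' * norm (h - 0)"
    proof (rule field_differentiable_bound[where S=UNIV])
      show "((\<lambda>h. g (z + h *\<^sub>R ?e)) has_field_derivative g' (z + k *\<^sub>R ?e)) (at k within UNIV)" for k
        by (rule has_pd_at, rule g')
    qed (use b' in auto)
    then show ?thesis by simp
  qed
  have int: "integrable lborel (\<lambda>y. om y * g (x - y))" for x
  proof (rule Bochner_Integration.integrable_bound[where f="\<lambda>y. om y * C"])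
    show "AE y in lborel. norm (om y * g (x - y)) \<le> norm (om y * C)"
      using b C by (auto simp: abs_mult intro!: mult_left_mono)
  qed (use i in auto)
  show ?thesis
    unfolding has_pd_def DERIV_def tendsto_at_iff_sequentially o_def
  proof (safe, goal_cases)
    case (1 X)
    note X = 1
    have eq: "((LINT y|lborel. om y * g (x + (0 + X n) *\<^sub>R ?e - y)) - (LINT y|lborel. om y * g (x + 0 *\<^sub>R ?e - y))) / X n
      = (LINT y|lborel. om y * ((g ((x - y) + X n *\<^sub>R ?e) - g (x - y)) / X n))" for n
    proof -
      have 1: "x + (0 + X n) *\<^sub>R ?e - y = x - y + X n *\<^sub>R ?e" "x + 0 *\<^sub>R ?e - y = x - y" for y by simp_all
      have 2: "integrable lborel (\<lambda>y. om y * g (x - y + X n *\<^sub>R ?e))" using int[of "x + X n *\<^sub>R ?e"] by (simp add: algebra_simps)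
      have "(LINT y|lborel. om y * ((g ((x - y) + X n *\<^sub>R ?e) - g (x - y)) / X n))
        = (LINT y|lborel. (om y * g (x - y + X n *\<^sub>R ?e) - om y * g (x - y)) / X n)"
        by (intro Bochner_Integration.integral_cong) (auto simp: right_diff_distrib)
      also have "\<dots> = ((LINT y|lborel. om y * g (x - y + X n *\<^sub>R ?e)) - (LINT y|lborel. om y * g (x - y))) / X n"
        by (simp only: integral_divide_zero Bochner_Integration.integral_diff[OF 2 int])
      finally show ?thesis unfolding 1 by (rule sym)
    qed
    have "(\<lambda>n. LINT y|lborel. om y * ((g ((x - y) + X n *\<^sub>R ?e) - g (x - y)) / X n)) \<longlonglongrightarrow> (LINT y|lborel. om y * g' (x - y))"
    proof (rule integral_dominated_convergence[where w="\<lambda>y. \<bar>om y\<bar> * C'"])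
      show "AE y in lborel. (\<lambda>n. om y * ((g ((x - y) + X n *\<^sub>R ?e) - g (x - y)) / X n)) \<longlonglongrightarrow> om y * g' (x - y)"
      proof (rule AE_I2)
        fix y
        have "(\<lambda>n. (g ((x - y) + X n *\<^sub>R ?e) - g (x - y)) / X n) \<longlonglongrightarrow> g' (x - y)"
          using g'[of "x - y", unfolded has_pd_def DERIV_def tendsto_at_iff_sequentially o_def] X by auto
        then show "(\<lambda>n. om y * ((g ((x - y) + X n *\<^sub>R ?e) - g (x - y)) / X n)) \<longlonglongrightarrow> om y * g' (x - y)"
          by (intro tendsto_intros)
      qed
      show "AE y in lborel. norm (om y * ((g ((x - y) + X n *\<^sub>R ?e) - g (x - y)) / X n)) \<le> \<bar>om y\<bar> * C'" for n
      proof (intro AE_I2)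
        fix y
        have "\<bar>(g ((x - y) + X n *\<^sub>R ?e) - g (x - y)) / X n\<bar> \<le> C'"
          using lip[of "x - y" "X n"] X(1) by (simp add: pos_divide_le_eq)
        then show "norm (om y * ((g ((x - y) + X n *\<^sub>R ?e) - g (x - y)) / X n)) \<le> \<bar>om y\<bar> * C'"
          unfolding real_norm_def abs_mult by (intro mult_left_mono) auto
      qed
    qed (use i in auto)
    then show ?case unfolding eq .
  qed
qed

section \<open>Velocity fields of bounded integrable vorticities\<close>

text \<open>The derivative is carried as an explicit family, \<open>F' i\<close> in direction i, so
  that product and chain rules compose and compute its formula along the way.\<close>

definition C1_fun :: "(real^2 \<Rightarrow> real) \<Rightarrow> (2 \<Rightarrow> real^2 \<Rightarrow> real) \<Rightarrow> bool" where
  "C1_fun F F' \<longleftrightarrow> (\<forall>i x. has_pd F i (F' i x) x) \<and> continuous_on UNIV F \<and> (\<forall>i. continuous_on UNIV (F' i))"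

lemma C1_funD:
  assumes "C1_fun F F'"
  shows "has_pd F i (F' i x) x" "continuous_on UNIV F" "continuous_on UNIV (F' i)"
  using assms by (auto simp: C1_fun_def)

lemma C1_fun_support:
  assumes "C1_fun F F'" "\<And>x. norm x > r \<Longrightarrow> F x = 0" "norm x > r"
  shows "F' i x = 0"
  using has_pd_support[of F i "F' i x" x r] C1_funD(1)[OF assms(1)] assms by blast

lemma C1_fun_mult:
  assumes "C1_fun F F'" "C1_fun G G'"
  shows "C1_fun (\<lambda>x. F x * G x) (\<lambda>i x. F' i x * G x + G' i x * F x)"
  using C1_funD[OF assms(1)] C1_funD[OF assms(2)] unfolding C1_fun_def
  by (auto intro!: has_pd_mult continuous_intros)

lemma C1_fun_chain:
  assumes F: "C1_fun F F'" and b: "\<And>y. (b has_real_derivative b' y) (at y)" and b': "continuous_on UNIV b'"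
  shows "C1_fun (\<lambda>x. b (F x)) (\<lambda>i x. b' (F x) * F' i x)"
proof -
  have "continuous_on UNIV b" by (rule DERIV_continuous_on) (use b in auto)
  then have "continuous_on UNIV (\<lambda>x. b (F x))" "continuous_on UNIV (\<lambda>x. b' (F x))"
    using continuous_on_compose2[of UNIV _ UNIV F] b' C1_funD(2)[OF F] by auto
  then show ?thesis using C1_funD[OF F] b unfolding C1_fun_def
    by (auto intro!: has_pd_chain[where b=b] continuous_intros)
qed

lemma C1_fun_cmult: "C1_fun F F' \<Longrightarrow> C1_fun (\<lambda>x. c * F x) (\<lambda>i x. c * F' i x)"
  using C1_fun_chain[of F F' "\<lambda>y. c * y" "\<lambda>_. c"] by (auto intro!: derivative_eq_intros)

lemma C1_fun_add:
  assumes "C1_fun F F'" "C1_fun G G'"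
  shows "C1_fun (\<lambda>x. F x + G x) (\<lambda>i x. F' i x + G' i x)"
  using C1_funD[OF assms(1)] C1_funD[OF assms(2)] unfolding C1_fun_def
  by (auto intro!: has_pd_add continuous_intros)

lemma C1_fun_integral_pd:
  assumes "C1_fun F F'" "\<And>x. norm x > r \<Longrightarrow> F x = 0"
  shows "integrable lborel (F' i)" "(LINT x|lborel. F' i x) = 0"
proof -
  show "integrable lborel (F' i)"
    by (rule integrable_compact_support[of _ r]) (use C1_funD[OF assms(1)] C1_fun_support[OF assms] in auto)
  show "(LINT x|lborel. F' i x) = 0"
    by (rule integral_pd_eq_0[of F]) (use C1_funD[OF assms(1)] assms in auto)
qed

text \<open>At d = 0 this is the i-th component of the Biot--Savart velocity itself; positive d
  gives a C1 approximation of it.\<close>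

definition bs_reg :: "real \<Rightarrow> (real^2 \<Rightarrow> real) \<Rightarrow> 2 \<Rightarrow> real^2 \<Rightarrow> real" where
  "bs_reg d om i x = (LINT y|lborel. om y * bs_kernel d i (x - y))"

text \<open>One time slice of a solution. The sup norm has a name because it is controlled uniformly
  in time; the L1 norm is merely finite at this stage.\<close>

locale bounded_vorticity =
  fixes om :: "real^2 \<Rightarrow> real" and M :: real
  assumes cont: "continuous_on UNIV om" and int: "integrable lborel om" and bd: "\<bar>om x\<bar> \<le> M"
begin

lemma om_meas [measurable]: "om \<in> borel_measurable borel"
  using int by simp

lemma M_nonneg: "M \<ge> 0" using bd[of 0] by linarith

lemma int_om_riesz:
  assumes "d > 0" 
  shows "integrable lborel (\<lambda>y. M * riesz_ker d (x - y))"
    and "(LINT y|lborel. M * riesz_ker d (x - y)) \<le> M * ker_const / d"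
proof -
  show "integrable lborel (\<lambda>y. M * riesz_ker d (x - y))"
    using integrable_riesz_ker[OF assms] by (simp add: integrable_reflect)
  have "(LINT y|lborel. M * riesz_ker d (x - y)) = M * (LINT y|lborel. riesz_ker d y)"
    by (simp add: integral_reflect)
  also have "\<dots> \<le> M * (ker_const / d)"
    by (intro mult_left_mono integral_riesz_ker assms M_nonneg)
  finally show "(LINT y|lborel. M * riesz_ker d (x - y)) \<le> M * ker_const / d" by simp
qed

lemma om_kernel_le: "\<bar>om y * bs_kernel d i z\<bar> \<le> M * riesz_ker 1 z + \<bar>om y\<bar>"
proof -
  have "\<bar>om y * bs_kernel d i z\<bar> \<le> \<bar>om y\<bar> * (riesz_ker 1 z + 1)"
    unfolding abs_mult by (intro mult_left_mono bs_kernel_le) auto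
  also have "\<dots> \<le> M * riesz_ker 1 z + \<bar>om y\<bar>"
    using bd[of y] riesz_ker_nonneg[of 1 z] by (simp add: distrib_left mult_right_mono)
  finally show ?thesis .
qed

lemma bs_integrable: "integrable lborel (\<lambda>y. om y * bs_kernel d i (x - y))"
proof (rule Bochner_Integration.integrable_bound)
  show "integrable lborel (\<lambda>y. M * riesz_ker 1 (x - y) + \<bar>om y\<bar>)"
    using int int_om_riesz(1)[of 1] by auto
  show "AE y in lborel. norm (om y * bs_kernel d i (x - y)) \<le> norm (M * riesz_ker 1 (x - y) + \<bar>om y\<bar>)"
    using order_trans[OF om_kernel_le abs_ge_self] by simp
qed measurable

lemma bs_le: "\<bar>bs_reg d om i x\<bar> \<le> M * ker_const + (LINT y|lborel. \<bar>om y\<bar>)"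
proof -
  have "\<bar>bs_reg d om i x\<bar> \<le> (LINT y|lborel. M * riesz_ker 1 (x - y) + \<bar>om y\<bar>)"
    unfolding bs_reg_def
    by (rule order_trans[OF integral_abs_bound], intro integral_mono)
      (use bs_integrable int int_om_riesz(1)[of 1] om_kernel_le in auto)
  also have "\<dots> = (LINT y|lborel. M * riesz_ker 1 (x - y)) + (LINT y|lborel. \<bar>om y\<bar>)"
    using int int_om_riesz(1)[of 1] by (intro Bochner_Integration.integral_add) auto
  finally show ?thesis using int_om_riesz(2)[of 1 x] by simp
qed

lemma bs_diff_le:
  assumes "d > 0" shows "\<bar>bs_reg 0 om i x - bs_reg d om i x\<bar> \<le> M * ker_const * d"
proof -
  have "bs_reg 0 om i x - bs_reg d om i x = (LINT y|lborel. om y * (bs_kernel 0 i (x - y) - bs_kernel d i (x - y)))"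
    unfolding bs_reg_def right_diff_distrib
    by (rule Bochner_Integration.integral_diff[symmetric]) (rule bs_integrable)+
  also have "\<bar>\<dots>\<bar> \<le> (LINT y|lborel. d\<^sup>2 * (M * riesz_ker d (x - y)))"
  proof (rule order_trans[OF integral_abs_bound], intro integral_mono)
    show "integrable lborel (\<lambda>y. \<bar>om y * (bs_kernel 0 i (x - y) - bs_kernel d i (x - y))\<bar>)"
      using bs_integrable[of 0 i x] bs_integrable[of d i x] by (simp add: right_diff_distrib)
    show "integrable lborel (\<lambda>y. d\<^sup>2 * (M * riesz_ker d (x - y)))" using int_om_riesz(1)[OF assms] by auto
    show "\<bar>om y * (bs_kernel 0 i (x - y) - bs_kernel d i (x - y))\<bar> \<le> d\<^sup>2 * (M * riesz_ker d (x - y))" for y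
      unfolding abs_mult using mult_mono[OF bd[of y] bs_kernel_diff_le[OF assms, of i "x - y"]] M_nonneg
      by (simp add: algebra_simps)
  qed
  also have "\<dots> = d\<^sup>2 * (LINT y|lborel. M * riesz_ker d (x - y))" by simp
  also have "\<dots> \<le> d\<^sup>2 * (M * ker_const / d)"
    by (intro mult_left_mono int_om_riesz(2) assms) auto
  also have "\<dots> = M * ker_const * d" using assms by (simp add: power2_eq_square)
  finally show ?thesis .
qed

definition bs_pd :: "real \<Rightarrow> 2 \<Rightarrow> 2 \<Rightarrow> real^2 \<Rightarrow> real" where
  "bs_pd d i j x = (LINT y|lborel. om y * bs_kernel_pd d i j (x - y))"

lemma bs_C1:
  assumes "d > 0" shows "C1_fun (bs_reg d om i) (bs_pd d i)"
  unfolding C1_fun_def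
proof (intro conjI allI)
  show "has_pd (bs_reg d om i) j (bs_pd d i j x) x" for j x
    unfolding bs_reg_def[abs_def] bs_pd_def
    by (rule has_pd_convolution[OF int continuous_on_bs_kernel bs_kernel_bounded has_pd_bs_kernel
          continuous_on_bs_kernel_pd bs_kernel_pd_bounded]) (rule assms)+
  show "continuous_on UNIV (bs_reg d om i)" unfolding bs_reg_def[abs_def]
    by (rule continuous_on_convolution[OF int continuous_on_bs_kernel bs_kernel_bounded]) (rule assms)+
  show "continuous_on UNIV (bs_pd d i j)" for j unfolding bs_pd_def[abs_def]
    by (rule continuous_on_convolution[OF int continuous_on_bs_kernel_pd bs_kernel_pd_bounded]) (rule assms)+
qed

definition reg_seq :: "nat \<Rightarrow> real" where "reg_seq n = 1 / Suc n"

lemma reg_seq: "reg_seq n > 0" "reg_seq \<longlonglongrightarrow> 0" "reg_seq n \<le> 1"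
  using LIMSEQ_inverse_real_of_nat by (simp_all add: reg_seq_def[abs_def] inverse_eq_divide)

lemma bs_tendsto: "(\<lambda>n. bs_reg (reg_seq n) om i x) \<longlonglongrightarrow> bs_reg 0 om i x"
proof (rule LIM_zero_cancel, rule Lim_null_comparison)
  show "\<forall>\<^sub>F n in sequentially. norm (bs_reg (reg_seq n) om i x - bs_reg 0 om i x) \<le> M * ker_const * reg_seq n"
    using bs_diff_le[OF reg_seq(1), of i x] by (simp add: abs_minus_commute)
  show "(\<lambda>n. M * ker_const * reg_seq n) \<longlonglongrightarrow> 0"
    using tendsto_mult_right_zero[OF reg_seq(2)] by simp
qed

lemma continuous_on_bs: "continuous_on UNIV (bs_reg 0 om i)"
proof (rule uniform_limit_theorem[where F=sequentially])
  show "\<forall>\<^sub>F n in sequentially. continuous_on UNIV (bs_reg (reg_seq n) om i)"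
    using C1_funD(2)[OF bs_C1[OF reg_seq(1)]] by simp
  show "uniform_limit UNIV (\<lambda>n. bs_reg (reg_seq n) om i) (bs_reg 0 om i) sequentially"
  proof (rule uniform_limitI)
    fix e :: real assume e: "e > 0"
    have "(\<lambda>n. M * ker_const * reg_seq n) \<longlonglongrightarrow> 0"
      using tendsto_mult_right_zero[OF reg_seq(2)] by simp
    then have "\<forall>\<^sub>F n in sequentially. M * ker_const * reg_seq n < e" using e by (rule order_tendstoD)
    then show "\<forall>\<^sub>F n in sequentially. \<forall>x\<in>UNIV. dist (bs_reg (reg_seq n) om i x) (bs_reg 0 om i x) < e"
      by eventually_elim (use bs_diff_le[OF reg_seq(1), of i] in \<open>auto simp: dist_real_def abs_minus_commute intro: le_less_trans\<close>)
  qed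
qed simp

lemma bs_pd_integrable:
  assumes "d > 0" shows "integrable lborel (\<lambda>y. om y * bs_kernel_pd d k j (x - y))"
proof (rule Bochner_Integration.integrable_bound[where f="\<lambda>y. om y * (2 / d\<^sup>2)"])
  have "bs_kernel_pd d k j \<in> borel_measurable borel"
    by (rule borel_measurable_continuous_onI[OF continuous_on_bs_kernel_pd[OF assms]])
  then show "(\<lambda>y. om y * bs_kernel_pd d k j (x - y)) \<in> borel_measurable lborel" by measurable
  show "AE y in lborel. norm (om y * bs_kernel_pd d k j (x - y)) \<le> norm (om y * (2 / d\<^sup>2))"
  proof (rule AE_I2)
    fix y
    have "\<bar>bs_kernel_pd d k j (x - y)\<bar> \<le> \<bar>2 / d\<^sup>2\<bar>" using bs_kernel_pd_bounded[OF assms, of k j "x - y"] by linarith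
    then show "norm (om y * bs_kernel_pd d k j (x - y)) \<le> norm (om y * (2 / d\<^sup>2))"
      unfolding real_norm_def abs_mult[of "om y"] by (intro mult_left_mono) auto
  qed
qed (use int in auto)

lemma bs_pd_div:
  assumes "d > 0" shows "bs_pd d 1 1 x + bs_pd d 2 2 x = 0"
proof -
  note i = bs_pd_integrable[OF assms]
  show ?thesis unfolding bs_pd_def
    by (subst Bochner_Integration.integral_add[symmetric, OF i i])
      (simp add: distrib_left[symmetric] bs_kernel_div)
qed

text \<open>The kernel \<open>curl_kernel d\<close> is the d-dilate of \<open>curl_kernel 1\<close>.
  Rescaling fixes the kernel and moves d into the argument of \<open>om\<close>, so that d -> 0
  becomes dominated convergence.\<close>

lemma bs_pd_curl:
  assumes "d > 0" shows "bs_pd d 2 1 x - bs_pd d 1 2 x = (LINT z|lborel. curl_kernel 1 z * om (x - d *\<^sub>R z))"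
proof -
  note i = bs_pd_integrable[OF assms]
  have [measurable]: "curl_kernel d \<in> borel_measurable borel"
    by (rule borel_measurable_continuous_onI[OF continuous_on_curl_kernel[OF assms]])
  have "bs_pd d 2 1 x - bs_pd d 1 2 x = (LINT y|lborel. om y * curl_kernel d (x - y))"
    unfolding bs_pd_def
    by (subst Bochner_Integration.integral_diff[symmetric, OF i i])
      (simp add: right_diff_distrib[symmetric] bs_kernel_curl[OF assms])
  also have "\<dots> = (LINT y|lborel. om (x - y) * curl_kernel d y)"
    using integral_reflect[of "\<lambda>y. om y * curl_kernel d (x - y)" x] by simp
  also have "\<dots> = (LINT z|lborel. (d^2) * (om (x - d *\<^sub>R z) * curl_kernel d (d *\<^sub>R z)))"
    using assms by (subst lborel_affine[of d 0]) (auto simp: integral_density integral_distr)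
  also have "\<dots> = (LINT z|lborel. curl_kernel 1 z * om (x - d *\<^sub>R z))"
  proof (rule Bochner_Integration.integral_cong[OF refl])
    fix z :: "real^2"
    have "(norm z)\<^sup>2 + 1 > 0" using nsq_pos[of 1 z] by simp
    moreover have "d\<^sup>2 * (norm z)\<^sup>2 + d\<^sup>2 = d\<^sup>2 * ((norm z)\<^sup>2 + 1)" by (simp add: algebra_simps)
    ultimately have "d\<^sup>2 * curl_kernel d (d *\<^sub>R z) = curl_kernel 1 z"
      using assms by (simp add: curl_kernel_def power_mult_distrib power2_eq_square[of "d\<^sup>2"] power2_eq_square[of "d\<^sup>2 * _"])
    then show "(d^2) * (om (x - d *\<^sub>R z) * curl_kernel d (d *\<^sub>R z)) = curl_kernel 1 z * om (x - d *\<^sub>R z)"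
      by (metis mult.assoc mult.commute)
  qed
  finally show ?thesis .
qed

lemma curl_bound: "\<bar>LINT z|lborel. curl_kernel 1 z * om (x - d *\<^sub>R z)\<bar> \<le> curl_mass * M"
  and curl_tendsto: "(\<lambda>n. LINT z|lborel. curl_kernel 1 z * om (x - reg_seq n *\<^sub>R z)) \<longlonglongrightarrow> curl_mass * om x"
proof -
  have k: "curl_kernel 1 z \<ge> 0" for z by (simp add: curl_kernel_def)
  have [measurable]: "curl_kernel 1 \<in> borel_measurable borel"
    by (rule borel_measurable_continuous_onI[OF continuous_on_curl_kernel]) simp
  have b: "norm (curl_kernel 1 z * om y) \<le> curl_kernel 1 z * M" for z y
    using bd[of y] k[of z] by (simp add: abs_mult mult_left_mono)
  have ib: "integrable lborel (\<lambda>z. curl_kernel 1 z * M)" using integrable_curl_kernel[of 1] by simp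
  have "integrable lborel (\<lambda>z. curl_kernel 1 z * om (x - d *\<^sub>R z))"
    by (rule Bochner_Integration.integrable_bound[OF ib]) (use b in \<open>auto intro: order_trans[OF _ abs_ge_self]\<close>)
  then have "\<bar>LINT z|lborel. curl_kernel 1 z * om (x - d *\<^sub>R z)\<bar> \<le> (LINT z|lborel. curl_kernel 1 z * M)"
    using b ib by (intro order_trans[OF integral_abs_bound] integral_mono) auto
  then show "\<bar>LINT z|lborel. curl_kernel 1 z * om (x - d *\<^sub>R z)\<bar> \<le> curl_mass * M"
    by (simp add: curl_mass_def)
  have "(\<lambda>n. LINT z|lborel. curl_kernel 1 z * om (x - reg_seq n *\<^sub>R z)) \<longlonglongrightarrow> (LINT z|lborel. curl_kernel 1 z * om x)"
  proof (rule integral_dominated_convergence[where w="\<lambda>z. curl_kernel 1 z * M"])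
    show "AE z in lborel. (\<lambda>n. curl_kernel 1 z * om (x - reg_seq n *\<^sub>R z)) \<longlonglongrightarrow> curl_kernel 1 z * om x"
    proof (intro AE_I2 tendsto_intros isCont_tendsto_compose[of _ om])
      fix z
      show "isCont om x" using cont by (simp add: continuous_on_eq_continuous_at)
      have "(\<lambda>n. x - reg_seq n *\<^sub>R z) \<longlonglongrightarrow> x - 0 *\<^sub>R z" by (intro tendsto_intros reg_seq)
      then show "(\<lambda>n. x - reg_seq n *\<^sub>R z) \<longlonglongrightarrow> x" by simp
    qed
    show "AE z in lborel. norm (curl_kernel 1 z * om (x - reg_seq n *\<^sub>R z)) \<le> curl_kernel 1 z * M" for n
      using b by simp
  qed (use ib in measurable)
  then show "(\<lambda>n. LINT z|lborel. curl_kernel 1 z * om (x - reg_seq n *\<^sub>R z)) \<longlonglongrightarrow> curl_mass * om x"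
    by (simp add: curl_mass_def)
qed

text \<open>The velocity is only known to be continuous, hence the weak form. The regularised fields
  are divergence free classically, and their bound \<open>bs_le\<close>, uniform in d, allows
  passage to the limit.\<close>

lemma bs_div_free:
  assumes F: "C1_fun F F'" and s: "\<And>x. norm x > r \<Longrightarrow> F x = 0"
  shows "(LINT x|lborel. bs_reg 0 om 1 x * F' 1 x + bs_reg 0 om 2 x * F' 2 x) = 0"
proof -
  note s' = C1_fun_support[OF F s]
  have reg: "(LINT x|lborel. bs_reg d om 1 x * F' 1 x + bs_reg d om 2 x * F' 2 x) = 0" if d: "d > 0" for d
  proof -
    note c = C1_fun_mult[OF bs_C1[OF d] F]
    have z: "bs_reg d om i x * F x = 0" if "norm x > r" for i x using s that by simp
    have "(LINT x|lborel. bs_reg d om 1 x * F' 1 x + bs_reg d om 2 x * F' 2 x)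
      = (LINT x|lborel. (bs_pd d 1 1 x * F x + F' 1 x * bs_reg d om 1 x) + (bs_pd d 2 2 x * F x + F' 2 x * bs_reg d om 2 x))"
    proof (rule Bochner_Integration.integral_cong[OF refl])
      fix x
      have "bs_pd d 1 1 x * F x + bs_pd d 2 2 x * F x = 0"
        using bs_pd_div[OF d, of x] by (simp flip: distrib_right)
      then show "bs_reg d om 1 x * F' 1 x + bs_reg d om 2 x * F' 2 x =
        (bs_pd d 1 1 x * F x + F' 1 x * bs_reg d om 1 x) + (bs_pd d 2 2 x * F x + F' 2 x * bs_reg d om 2 x)"
        by (simp add: algebra_simps)
    qed
    also have "\<dots> = 0"
      by (subst Bochner_Integration.integral_add[OF C1_fun_integral_pd(1)[OF c z] C1_fun_integral_pd(1)[OF c z]])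
        (auto simp: C1_fun_integral_pd(2)[OF c z])
    finally show ?thesis .
  qed
  have iF: "integrable lborel (F' i)" for i by (rule C1_fun_integral_pd[OF F s])
  have [measurable]: "F' i \<in> borel_measurable borel" for i using iF[of i] by simp
  have [measurable]: "bs_reg (reg_seq n) om i \<in> borel_measurable borel" for n i
    by (rule borel_measurable_continuous_onI[OF C1_funD(2)[OF bs_C1[OF reg_seq(1)]]])
  have [measurable]: "bs_reg 0 om i \<in> borel_measurable borel" for i
    by (rule borel_measurable_continuous_onI[OF continuous_on_bs])
  define B where "B = M * ker_const + (LINT y|lborel. \<bar>om y\<bar>)"
  have "(\<lambda>n. LINT x|lborel. bs_reg (reg_seq n) om 1 x * F' 1 x + bs_reg (reg_seq n) om 2 x * F' 2 x)
    \<longlonglongrightarrow> (LINT x|lborel. bs_reg 0 om 1 x * F' 1 x + bs_reg 0 om 2 x * F' 2 x)"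
  proof (rule integral_dominated_convergence[where w="\<lambda>x. B * \<bar>F' 1 x\<bar> + B * \<bar>F' 2 x\<bar>"])
    show "AE x in lborel. (\<lambda>n. bs_reg (reg_seq n) om 1 x * F' 1 x + bs_reg (reg_seq n) om 2 x * F' 2 x)
      \<longlonglongrightarrow> bs_reg 0 om 1 x * F' 1 x + bs_reg 0 om 2 x * F' 2 x"
      by (intro AE_I2 tendsto_intros bs_tendsto)
    show "AE x in lborel. norm (bs_reg (reg_seq n) om 1 x * F' 1 x + bs_reg (reg_seq n) om 2 x * F' 2 x)
      \<le> B * \<bar>F' 1 x\<bar> + B * \<bar>F' 2 x\<bar>" for n
      unfolding B_def by (intro AE_I2 order_trans[OF norm_triangle_ineq] add_mono)
        (auto simp: abs_mult intro!: mult_right_mono bs_le)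
    show "integrable lborel (\<lambda>x. B * \<bar>F' 1 x\<bar> + B * \<bar>F' 2 x\<bar>)" using iF by auto
  qed measurable
  then show ?thesis using reg[OF reg_seq(1)] by (simp add: LIMSEQ_const_iff)
qed

text \<open>Writing \<open>om * u\<close> as a divergence of quadratic expressions in \<open>u\<close> trades the vorticity for
  a second velocity.\<close>

lemma bs_quadratic:
  assumes G: "C1_fun g1 g1'" and H: "C1_fun g2 g2'"
    and s1: "\<And>x. norm x > r \<Longrightarrow> g1 x = 0" and s2: "\<And>x. norm x > r \<Longrightarrow> g2 x = 0"
    and U: "\<And>i x. \<bar>bs_reg 0 om i x\<bar> \<le> U"
  shows "curl_mass * \<bar>LINT x|lborel. om x * (bs_reg 0 om 1 x * g1 x + bs_reg 0 om 2 x * g2 x)\<bar>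
     \<le> U\<^sup>2 * (LINT x|lborel. \<bar>g1' 1 x\<bar> + \<bar>g1' 2 x\<bar> + \<bar>g2' 1 x\<bar> + \<bar>g2' 2 x\<bar>)"
proof -
  let ?D = "LINT x|lborel. \<bar>g1' 1 x\<bar> + \<bar>g1' 2 x\<bar> + \<bar>g2' 1 x\<bar> + \<bar>g2' 2 x\<bar>"
  have U0: "U \<ge> 0" using U[of 1 0] by linarith
  note s1' = C1_fun_support[OF G s1] and s2' = C1_fun_support[OF H s2]
  have ig: "integrable lborel (g1' i)" "integrable lborel (g2' i)" for i
    by (rule C1_fun_integral_pd[OF G s1], assumption, rule C1_fun_integral_pd[OF H s2])
  have ig0: "integrable lborel g1" "integrable lborel g2"
    by (rule integrable_compact_support[of _ r]; use C1_funD[OF G] C1_funD[OF H] s1 s2 in simp)+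
  have iD: "integrable lborel (\<lambda>x. \<bar>g1' 1 x\<bar> + \<bar>g1' 2 x\<bar> + \<bar>g2' 1 x\<bar> + \<bar>g2' 2 x\<bar>)" using ig by auto
  define cu where "cu = (\<lambda>n x. LINT z|lborel. curl_kernel 1 z * om (x - reg_seq n *\<^sub>R z))"
  have cu_eq: "cu n x = bs_pd (reg_seq n) 2 1 x - bs_pd (reg_seq n) 1 2 x" for n x
    unfolding cu_def by (rule bs_pd_curl[OF reg_seq(1), symmetric])
  have reg: "\<bar>LINT x|lborel. cu n x * (bs_reg (reg_seq n) om 1 x * g1 x + bs_reg (reg_seq n) om 2 x * g2 x)\<bar>
     \<le> (U + M * ker_const * reg_seq n)\<^sup>2 * ?D" for n
  proof -
    define d where "d = reg_seq n"
    have d: "d > 0" unfolding d_def by (rule reg_seq)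
    \<comment> \<open>The bound U concerns the true velocity; the regularised one can exceed it by
      the approximation error, which vanishes as n grows.\<close>
    define V where "V = U + M * ker_const * d"
    let ?v = "\<lambda>i x. bs_reg d om i x" and ?p = "\<lambda>i j x. bs_pd d i j x"
    have v: "\<bar>?v i x\<bar> \<le> V" for i x
      using bs_diff_le[OF d, of i x] U[of i x] unfolding V_def by linarith
    have V0: "V \<ge> 0" using v[of 1 0] by linarith
    note C = bs_C1[OF d]
    \<comment> \<open>Here q = v1 v2 and w = (v2^2 - v1^2) / 2. As div v = 0, curl v * v1 = d_1 q +
      d_2 w and curl v * v2 = d_1 w - d_2 q.\<close>
    note q = C1_fun_mult[OF C[of 1] C[of 2]]
    note w = C1_fun_cmult[OF C1_fun_add[OF C1_fun_mult[OF C[of 2] C[of 2]] C1_fun_cmult[OF C1_fun_mult[OF C[of 1] C[of 1]], of "-1"]], of "1/2"]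
    note F1 = C1_fun_mult[OF q G] and F2 = C1_fun_mult[OF w G] and F3 = C1_fun_mult[OF w H]
      and F4 = C1_fun_cmult[OF C1_fun_mult[OF q H], of "-1"]
    \<comment> \<open>The remainder once the four exact derivatives F1 to F4 have integrated to 0:
      all derivatives now fall on g1 and g2.\<close>
    define R where "R = (\<lambda>x. ?v 1 x * ?v 2 x * (g2' 2 x - g1' 1 x) - 1/2 * ((?v 2 x)\<^sup>2 - (?v 1 x)\<^sup>2) * (g1' 2 x + g2' 1 x))"
    have cV: "continuous_on UNIV (?v i)" for i by (rule C1_funD(2)[OF C])
    have iR: "integrable lborel R"
      by (rule integrable_compact_support[of _ r])
        (use cV C1_funD(3)[OF G] C1_funD(3)[OF H] s1' s2' in \<open>auto simp: R_def intro!: continuous_intros\<close>)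
    have "(LINT x|lborel. cu n x * (?v 1 x * g1 x + ?v 2 x * g2 x)) = (LINT x|lborel. 
       (((?p 1 1 x * ?v 2 x + ?p 2 1 x * ?v 1 x) * g1 x + g1' 1 x * (?v 1 x * ?v 2 x))
      + (1/2 * ((?p 2 2 x * ?v 2 x + ?p 2 2 x * ?v 2 x) + -1 * (?p 1 2 x * ?v 1 x + ?p 1 2 x * ?v 1 x)) * g1 x
          + g1' 2 x * (1/2 * (?v 2 x * ?v 2 x + -1 * (?v 1 x * ?v 1 x))))
      + (1/2 * ((?p 2 1 x * ?v 2 x + ?p 2 1 x * ?v 2 x) + -1 * (?p 1 1 x * ?v 1 x + ?p 1 1 x * ?v 1 x)) * g2 x
          + g2' 1 x * (1/2 * (?v 2 x * ?v 2 x + -1 * (?v 1 x * ?v 1 x))))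
      + -1 * ((?p 1 2 x * ?v 2 x + ?p 2 2 x * ?v 1 x) * g2 x + g2' 2 x * (?v 1 x * ?v 2 x))) + R x)"
    proof (rule Bochner_Integration.integral_cong[OF refl])
      fix x
      have e: "?p 1 1 x = - ?p 2 2 x" using bs_pd_div[OF d, of x] by linarith
      show "cu n x * (?v 1 x * g1 x + ?v 2 x * g2 x) = 
       (((?p 1 1 x * ?v 2 x + ?p 2 1 x * ?v 1 x) * g1 x + g1' 1 x * (?v 1 x * ?v 2 x))
      + (1/2 * ((?p 2 2 x * ?v 2 x + ?p 2 2 x * ?v 2 x) + -1 * (?p 1 2 x * ?v 1 x + ?p 1 2 x * ?v 1 x)) * g1 x
          + g1' 2 x * (1/2 * (?v 2 x * ?v 2 x + -1 * (?v 1 x * ?v 1 x))))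
      + (1/2 * ((?p 2 1 x * ?v 2 x + ?p 2 1 x * ?v 2 x) + -1 * (?p 1 1 x * ?v 1 x + ?p 1 1 x * ?v 1 x)) * g2 x
          + g2' 1 x * (1/2 * (?v 2 x * ?v 2 x + -1 * (?v 1 x * ?v 1 x))))
      + -1 * ((?p 1 2 x * ?v 2 x + ?p 2 2 x * ?v 1 x) * g2 x + g2' 2 x * (?v 1 x * ?v 2 x))) + R x"
        unfolding cu_eq d_def[symmetric] e R_def by (simp add: algebra_simps power2_eq_square add_divide_distrib diff_divide_distrib)
    qed
    also have "\<dots> = (LINT x|lborel. R x)"
    proof -
      have z1: "?v 1 x * ?v 2 x * g1 x = 0" and z2: "1/2 * (?v 2 x * ?v 2 x + -1 * (?v 1 x * ?v 1 x)) * g1 x = 0"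
        and z3: "1/2 * (?v 2 x * ?v 2 x + -1 * (?v 1 x * ?v 1 x)) * g2 x = 0"
        and z4: "-1 * (?v 1 x * ?v 2 x * g2 x) = 0" if "norm x > r" for x
        using s1 s2 that by auto
      note I = C1_fun_integral_pd(1)[OF F1 z1, where i=1] C1_fun_integral_pd(1)[OF F2 z2, where i=2]
         C1_fun_integral_pd(1)[OF F3 z3, where i=1] C1_fun_integral_pd(1)[OF F4 z4, where i=2]
      note J = C1_fun_integral_pd(2)[OF F1 z1, where i=1] C1_fun_integral_pd(2)[OF F2 z2, where i=2]
         C1_fun_integral_pd(2)[OF F3 z3, where i=1] C1_fun_integral_pd(2)[OF F4 z4, where i=2]
      have hb: "has_bochner_integral lborel f 0" if "integrable lborel f" "integral\<^sup>L lborel f = 0" for f :: "real^2 \<Rightarrow> real"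
        using that by (simp add: has_bochner_integral_iff)
      note A = has_bochner_integral_add
      from A[OF A[OF A[OF A[OF hb[OF I(1) J(1)] hb[OF I(2) J(2)]] hb[OF I(3) J(3)]] hb[OF I(4) J(4)]]
          has_bochner_integral_integrable[OF iR]]
      show ?thesis by (simp only: has_bochner_integral_iff add_0)
    qed
    finally have eq: "(LINT x|lborel. cu n x * (?v 1 x * g1 x + ?v 2 x * g2 x)) = (LINT x|lborel. R x)" .
    have "\<bar>LINT x|lborel. R x\<bar> \<le> (LINT x|lborel. V\<^sup>2 * (\<bar>g1' 1 x\<bar> + \<bar>g1' 2 x\<bar> + \<bar>g2' 1 x\<bar> + \<bar>g2' 2 x\<bar>))"
    proof (rule order_trans[OF integral_abs_bound], intro integral_mono)
      show "integrable lborel (\<lambda>x. \<bar>R x\<bar>)" using iR by auto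
      show "integrable lborel (\<lambda>x. V\<^sup>2 * (\<bar>g1' 1 x\<bar> + \<bar>g1' 2 x\<bar> + \<bar>g2' 1 x\<bar> + \<bar>g2' 2 x\<bar>))" using iD by (intro integrable_mult_right) 
      fix x
      have a: "\<bar>?v 1 x * ?v 2 x\<bar> \<le> V\<^sup>2"
        unfolding abs_mult power2_eq_square by (intro mult_mono v V0) auto
      have b: "(?v i x)\<^sup>2 \<le> V\<^sup>2" for i using power_mono[OF v[of i x], of 2] by simp
      have half: "\<bar>1/2 * (p - q)\<bar> \<le> c" if "0 \<le> p" "p \<le> c" "0 \<le> q" "q \<le> c" for p q c :: real
        using that by (auto simp: abs_le_iff field_simps)
      have b': "\<bar>1/2 * ((?v 2 x)\<^sup>2 - (?v 1 x)\<^sup>2)\<bar> \<le> V\<^sup>2"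
        by (intro half b zero_le_power2)
      have "\<bar>R x\<bar> \<le> \<bar>?v 1 x * ?v 2 x\<bar> * \<bar>g2' 2 x - g1' 1 x\<bar> + \<bar>1/2 * ((?v 2 x)\<^sup>2 - (?v 1 x)\<^sup>2)\<bar> * \<bar>g1' 2 x + g2' 1 x\<bar>"
        unfolding R_def by (rule order_trans[OF abs_triangle_ineq4]) (simp only: abs_mult order_refl)
      also have "\<dots> \<le> V\<^sup>2 * (\<bar>g2' 2 x\<bar> + \<bar>g1' 1 x\<bar>) + V\<^sup>2 * (\<bar>g1' 2 x\<bar> + \<bar>g2' 1 x\<bar>)"
        by (intro add_mono mult_mono a b') auto
      finally show "\<bar>R x\<bar> \<le> V\<^sup>2 * (\<bar>g1' 1 x\<bar> + \<bar>g1' 2 x\<bar> + \<bar>g2' 1 x\<bar> + \<bar>g2' 2 x\<bar>)"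
        by (simp add: algebra_simps)
    qed
    also have "\<dots> = V\<^sup>2 * ?D" by simp
    finally show ?thesis using eq unfolding V_def d_def by simp
  qed
  have [measurable]: "g1 \<in> borel_measurable borel" "g2 \<in> borel_measurable borel" using ig0 by auto
  have [measurable]: "bs_reg (reg_seq n) om i \<in> borel_measurable borel" for n i
    by (rule borel_measurable_continuous_onI[OF C1_funD(2)[OF bs_C1[OF reg_seq(1)]]])
  have [measurable]: "bs_reg 0 om i \<in> borel_measurable borel" for i
    by (rule borel_measurable_continuous_onI[OF continuous_on_bs])
  have [measurable]: "cu n \<in> borel_measurable borel" for n
    by (rule borel_measurable_continuous_onI)
      (use C1_funD(3)[OF bs_C1[OF reg_seq(1)]] in \<open>auto simp: cu_eq[abs_def] intro!: continuous_intros\<close>)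
  define B where "B = M * ker_const + (LINT y|lborel. \<bar>om y\<bar>)"
  define K where "K = curl_mass * M * B"
  have cub: "\<bar>cu n x\<bar> \<le> curl_mass * M" for n x unfolding cu_def by (rule curl_bound)
  have "(\<lambda>n. LINT x|lborel. cu n x * (bs_reg (reg_seq n) om 1 x * g1 x + bs_reg (reg_seq n) om 2 x * g2 x))
    \<longlonglongrightarrow> (LINT x|lborel. (curl_mass * om x) * (bs_reg 0 om 1 x * g1 x + bs_reg 0 om 2 x * g2 x))"
  proof (rule integral_dominated_convergence[where w="\<lambda>x. K * \<bar>g1 x\<bar> + K * \<bar>g2 x\<bar>"])
    show "AE x in lborel. (\<lambda>n. cu n x * (bs_reg (reg_seq n) om 1 x * g1 x + bs_reg (reg_seq n) om 2 x * g2 x))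
      \<longlonglongrightarrow> (curl_mass * om x) * (bs_reg 0 om 1 x * g1 x + bs_reg 0 om 2 x * g2 x)"
      unfolding cu_def by (intro AE_I2 tendsto_intros bs_tendsto curl_tendsto)
    show "AE x in lborel. norm (cu n x * (bs_reg (reg_seq n) om 1 x * g1 x + bs_reg (reg_seq n) om 2 x * g2 x))
      \<le> K * \<bar>g1 x\<bar> + K * \<bar>g2 x\<bar>" for n
    proof (rule AE_I2)
      fix x
      have "\<bar>bs_reg (reg_seq n) om 1 x * g1 x + bs_reg (reg_seq n) om 2 x * g2 x\<bar> \<le> B * \<bar>g1 x\<bar> + B * \<bar>g2 x\<bar>"
        unfolding B_def by (intro order_trans[OF abs_triangle_ineq] add_mono)
          (auto simp: abs_mult intro!: mult_right_mono bs_le)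
      then have "\<bar>cu n x\<bar> * \<bar>bs_reg (reg_seq n) om 1 x * g1 x + bs_reg (reg_seq n) om 2 x * g2 x\<bar>
        \<le> (curl_mass * M) * (B * \<bar>g1 x\<bar> + B * \<bar>g2 x\<bar>)"
        using M_nonneg curl_mass_pos by (intro mult_mono cub) auto
      then show "norm (cu n x * (bs_reg (reg_seq n) om 1 x * g1 x + bs_reg (reg_seq n) om 2 x * g2 x))
        \<le> K * \<bar>g1 x\<bar> + K * \<bar>g2 x\<bar>" unfolding real_norm_def abs_mult K_def by (simp add: algebra_simps)
    qed
    show "integrable lborel (\<lambda>x. K * \<bar>g1 x\<bar> + K * \<bar>g2 x\<bar>)" using ig0 by auto
  qed measurable
  then have L: "(\<lambda>n. \<bar>LINT x|lborel. cu n x * (bs_reg (reg_seq n) om 1 x * g1 x + bs_reg (reg_seq n) om 2 x * g2 x)\<bar>)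
    \<longlonglongrightarrow> \<bar>LINT x|lborel. (curl_mass * om x) * (bs_reg 0 om 1 x * g1 x + bs_reg 0 om 2 x * g2 x)\<bar>"
    by (rule tendsto_rabs)
  have Rl: "(\<lambda>n. (U + M * ker_const * reg_seq n)\<^sup>2 * ?D) \<longlonglongrightarrow> (U + M * ker_const * 0)\<^sup>2 * ?D"
    by (intro tendsto_intros reg_seq)
  have "\<bar>LINT x|lborel. (curl_mass * om x) * (bs_reg 0 om 1 x * g1 x + bs_reg 0 om 2 x * g2 x)\<bar> \<le> (U + M * ker_const * 0)\<^sup>2 * ?D"
    by (rule LIMSEQ_le[OF L Rl]) (use reg in auto)
  moreover have "(LINT x|lborel. (curl_mass * om x) * (bs_reg 0 om 1 x * g1 x + bs_reg 0 om 2 x * g2 x))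
    = curl_mass * (LINT x|lborel. om x * (bs_reg 0 om 1 x * g1 x + bs_reg 0 om 2 x * g2 x))"
    by (simp add: mult.assoc)
  ultimately show ?thesis using curl_mass_pos by (simp add: abs_mult)
qed

end

section \<open>Weighted identities for advection--diffusion equations\<close>

lemma continuous_on_slice:
  fixes g :: "'a::topological_space \<Rightarrow> real \<Rightarrow> 'b::topological_space"
  assumes "continuous_on (UNIV \<times> {0<..}) (\<lambda>p. g (fst p) (snd p))" "t > 0"
  shows "continuous_on UNIV (\<lambda>x. g x t)"
proof -
  have "continuous_on UNIV (\<lambda>x. (\<lambda>p. g (fst p) (snd p)) (x, t))"
    by (rule continuous_on_compose2[OF assms(1)]) (use assms(2) in \<open>auto intro!: continuous_intros\<close>)
  then show ?thesis by simp
qed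

lemma C21_D:
  assumes f: "C21 f" and t: "t > 0"
  shows "((\<lambda>s. f x s) has_real_derivative dt f x t) (at t)"
    and "has_pd (\<lambda>x. f x t) i (grad f x t $ i) x"
    and "has_pd (\<lambda>x. grad f x t $ i) i (d2 f i x t) x"
    and "continuous_on UNIV (\<lambda>x. f x t)"
    and "continuous_on UNIV (\<lambda>x. grad f x t $ i)"
    and "continuous_on UNIV (\<lambda>x. d2 f i x t)"
proof -
  note F = f[unfolded C21_def]
  have "(\<lambda>s. f x s) differentiable (at t)" using F t by blast
  then show "((\<lambda>s. f x s) has_real_derivative dt f x t) (at t)"
    by (simp add: dt_def DERIV_deriv_iff_real_differentiable)
  have "(\<lambda>h. f (x + h *\<^sub>R axis i 1) t) differentiable (at 0)" using F t by blast
  then show "has_pd (\<lambda>x. f x t) i (grad f x t $ i) x"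
    by (simp add: grad_def has_pd_def DERIV_deriv_iff_real_differentiable)
  have "(\<lambda>h. grad f (x + h *\<^sub>R axis i 1) t $ i) differentiable (at 0)" using F t by blast
  then show "has_pd (\<lambda>x. grad f x t $ i) i (d2 f i x t) x"
    by (simp add: d2_def has_pd_def DERIV_deriv_iff_real_differentiable)
  show "continuous_on UNIV (\<lambda>x. f x t)" by (rule continuous_on_slice[where g="f", OF _ t]) (use F in simp)
  have "continuous_on UNIV (\<lambda>x. grad f x t)" by (rule continuous_on_slice[where g="grad f", OF _ t]) (use F in simp)
  then show "continuous_on UNIV (\<lambda>x. grad f x t $ i)" by (intro continuous_intros)
  show "continuous_on UNIV (\<lambda>x. d2 f i x t)" by (rule continuous_on_slice[where g="d2 f i", OF _ t]) (use F in simp)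
qed

lemma C21_C1: "C21 f \<Longrightarrow> t > 0 \<Longrightarrow> C1_fun (\<lambda>x. f x t) (\<lambda>i x. grad f x t $ i)"
  unfolding C1_fun_def using C21_D by blast

lemma C21_continuous:
  assumes "C21 f"
  shows "continuous_on (UNIV \<times> {0<..}) (\<lambda>p. f (fst p) (snd p))"
    "continuous_on (UNIV \<times> {0<..}) (\<lambda>p. dt f (fst p) (snd p))"
  using assms by (auto simp: C21_def)

lemma C21_isCont:
  assumes f: "C21 f" and t: "t > 0"
  shows "isCont (\<lambda>s. f x s) t"
  using C21_D(1)[OF assms] DERIV_isCont by blast

lemma DERIV_eq_0_of_vanishing:
  fixes k :: "real \<Rightarrow> real"
  assumes "(k has_real_derivative D) (at t)" "t > 0" "\<And>s. s > 0 \<Longrightarrow> k s = 0"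
  shows "D = 0"
proof -
  have "((\<lambda>s. 0) has_real_derivative D) (at t)"
    by (rule has_field_derivative_transform_within[OF assms(1), of t])
      (use assms in \<open>auto simp: dist_real_def abs_if split: if_splits\<close>)
  then show ?thesis using DERIV_unique DERIV_const by blast
qed

lemma integral_time_derivative:
  fixes k kt :: "real^2 \<Rightarrow> real \<Rightarrow> real"
  assumes d: "\<And>x t. t > 0 \<Longrightarrow> ((\<lambda>s. k x s) has_real_derivative kt x t) (at t)"
    and c: "\<And>t. t > 0 \<Longrightarrow> continuous_on UNIV (\<lambda>x. k x t)"
    and c': "continuous_on (UNIV \<times> {0<..}) (\<lambda>p. kt (fst p) (snd p))"
    and s: "\<And>x t. t > 0 \<Longrightarrow> norm x > r \<Longrightarrow> k x t = 0"
    and t: "t > 0"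
  shows "((\<lambda>t. LINT x|lborel. k x t) has_real_derivative (LINT x|lborel. kt x t)) (at t)"
proof -
  have s': "kt x t = 0" if "t > 0" "norm x > r" for x t
    using DERIV_eq_0_of_vanishing[OF d[OF that(1)] that(1)] s that(2) by blast
  define a :: "real^2" where "a = (\<chi> i. - r)"
  define b :: "real^2" where "b = (\<chi> i. r)"
  have out: "norm x > r" if x: "x \<notin> cbox a b" for x
  proof -
    obtain j where "\<not> (a $ j \<le> x $ j \<and> x $ j \<le> b $ j)" using x by (auto simp: mem_box_cart)
    then have "\<bar>x $ j\<bar> > r" by (auto simp: a_def b_def)
    then show ?thesis using component_le_norm_cart[of x j] by linarith
  qed
  have ckt: "continuous_on UNIV (\<lambda>x. kt x t)" if "t > 0" for t
    by (rule continuous_on_slice[where g=kt, OF c' that])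
  have int_eq: "integral (cbox a b) g = (LINT x|lborel. g x)"
    if "continuous_on UNIV g" "\<And>x. norm x > r \<Longrightarrow> g x = 0" for g :: "real^2 \<Rightarrow> real"
    by (rule integral_cbox_eq_lborel) (use that out in auto)
  have "((\<lambda>s. integral (cbox a b) (\<lambda>x. k x s)) has_field_derivative integral (cbox a b) (\<lambda>x. kt x t)) (at t within {0<..})"
  proof (rule leibniz_rule_field_derivative)
    show "((\<lambda>s. k x s) has_field_derivative kt x s) (at s within {0<..})" if "s \<in> {0<..}" for x s
      using d[of s x] that by (auto intro: has_field_derivative_at_within)
    show "(\<lambda>x. k x s) integrable_on cbox a b" if "s \<in> {0<..}" for s
      by (rule integrable_continuous) (use c[of s] that continuous_on_subset in auto)
    have "continuous_on ({0<..} \<times> cbox a b) ((\<lambda>p. kt (fst p) (snd p)) \<circ> prod.swap)"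
      by (rule continuous_on_compose) (use c' in \<open>auto intro!: continuous_intros elim: continuous_on_subset\<close>)
    then have "continuous_on ({0<..} \<times> cbox a b) (\<lambda>p. kt (snd p) (fst p))" by (simp add: o_def)
    then show "continuous_on ({0<..} \<times> cbox a b) (\<lambda>(s, x). kt x s)" by (simp add: case_prod_unfold)
  qed (use t in auto)
  then have "((\<lambda>s. integral (cbox a b) (\<lambda>x. k x s)) has_field_derivative integral (cbox a b) (\<lambda>x. kt x t)) (at t)"
    using t by (subst (asm) at_within_open) auto
  then have "((\<lambda>s. LINT x|lborel. k x s) has_field_derivative integral (cbox a b) (\<lambda>x. kt x t)) (at t)"
  proof (rule has_field_derivative_transform_within[where d=t])
    show "integral (cbox a b) (\<lambda>x. k x s) = (LINT x|lborel. k x s)" if "dist s t < t" for s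
    proof -
      have "s > 0" using that by (auto simp: dist_real_def abs_if split: if_splits)
      then show ?thesis using int_eq[of "\<lambda>x. k x s"] c s by blast
    qed
  qed (use t in auto)
  moreover have "integral (cbox a b) (\<lambda>x. kt x t) = (LINT x|lborel. kt x t)"
    by (rule int_eq) (use ckt s' t in blast)+
  ultimately show ?thesis by (simp only:)
qed

text \<open>The equation is tested with p b'(f). Diffusion is integrated by parts, and since u is
  divergence free the drift is moved onto p; the compact support of p removes every boundary
  term.\<close>

lemma renormalised_identity:
  assumes f: "C1_fun f f'" and f2: "\<And>i x. has_pd (f' i) i (f'' i x) x" "\<And>i. continuous_on UNIV (f'' i)"
    and b: "\<And>y. (b has_real_derivative b' y) (at y)" "\<And>y. (b' has_real_derivative b'' y) (at y)" "continuous_on UNIV b''"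
    and p: "C1_fun p p'" "\<And>x. norm x > r \<Longrightarrow> p x = 0"
    and u: "\<And>i. continuous_on UNIV (u i)"
    and div: "\<And>F F'. C1_fun F F' \<Longrightarrow> (\<And>x. norm x > r \<Longrightarrow> F x = 0) \<Longrightarrow> (LINT x|lborel. u 1 x * F' 1 x + u 2 x * F' 2 x) = 0"
  shows "(LINT x|lborel. p x * b' (f x) * (nu * (f'' 1 x + f'' 2 x) - (u 1 x * f' 1 x + u (2::2) x * f' 2 x))) =
    (LINT x|lborel. b (f x) * (u 1 x * p' 1 x + u 2 x * p' 2 x) - nu * b' (f x) * (p' 1 x * f' 1 x + p' 2 x * f' 2 x)
       - nu * p x * b'' (f x) * ((f' 1 x)\<^sup>2 + (f' 2 x)\<^sup>2))" (is "integral\<^sup>L _ ?L = integral\<^sup>L _ ?R")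
proof -
  note fc = C1_funD[OF f] and pc = C1_funD[OF p(1)]
  note p0 = C1_fun_support[OF p]
  have cb': "continuous_on UNIV b'" by (rule DERIV_continuous_on) (use b in auto)
  have cb: "continuous_on UNIV b" by (rule DERIV_continuous_on) (use b in auto)
  have comp: "continuous_on UNIV (\<lambda>x. b (f x))" "continuous_on UNIV (\<lambda>x. b' (f x))" "continuous_on UNIV (\<lambda>x. b'' (f x))"
    using continuous_on_compose2[of UNIV _ UNIV f] cb cb' b(3) fc(2) by auto
  note B' = C1_fun_chain[OF f b(2) b(3)]
  note pB' = C1_fun_mult[OF p(1) B']
  define F' where "F' = (\<lambda>i x. (p' i x * b' (f x) + b'' (f x) * f' i x * p x) * f' i x + f'' i x * (p x * b' (f x)))"
  have hF: "has_pd (\<lambda>x. p x * b' (f x) * f' i x) i (F' i x) x" for i x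
    unfolding F'_def by (rule has_pd_mult[OF C1_funD(1)[OF pB'] f2(1)])
  have cF: "continuous_on UNIV (\<lambda>x. p x * b' (f x) * f' i x)" for i by (intro continuous_intros fc pc comp)
  have cF': "continuous_on UNIV (F' i)" for i unfolding F'_def by (intro continuous_intros fc pc comp f2)
  have iF: "(LINT x|lborel. F' i x) = 0" for i
    by (rule integral_pd_eq_0[OF hF cF cF', of r]) (use p in auto)
  have I1: "integrable lborel (F' i)" for i
    by (rule integrable_compact_support[OF cF', of r]) (use p p0 in \<open>auto simp: F'_def\<close>)
  note G = C1_fun_mult[OF p(1) C1_fun_chain[OF f b(1) cb']]
  \<comment> \<open>This is u . grad (p b(f)), whose integral vanishes; it trades p b'(f) u . grad f
    for - b(f) u . grad p.\<close>
  define H where "H = (\<lambda>x. u 1 x * (p' 1 x * b (f x) + b' (f x) * f' 1 x * p x) + u 2 x * (p' 2 x * b (f x) + b' (f x) * f' 2 x * p x))"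
  have iH: "(LINT x|lborel. H x) = 0" unfolding H_def by (rule div[OF G]) (use p in auto)
  have cH: "continuous_on UNIV H" unfolding H_def by (intro continuous_intros fc pc comp f2 u)
  have I2: "integrable lborel H"
    by (rule integrable_compact_support[OF cH, of r]) (use p p0 in \<open>auto simp: H_def\<close>)
  have cR: "continuous_on UNIV ?R" by (intro continuous_intros fc pc comp f2 u)
  have I3: "integrable lborel ?R"
    by (rule integrable_compact_support[OF cR, of r]) (use p p0 in auto)
  have "integral\<^sup>L lborel ?L = (LINT x|lborel. nu * (F' 1 x + F' 2 x) - H x + ?R x)"
    by (rule Bochner_Integration.integral_cong) (auto simp: F'_def H_def algebra_simps power2_eq_square)
  also have "\<dots> = integral\<^sup>L lborel ?R"
  proof -
    have hb: "has_bochner_integral lborel g 0" if "integrable lborel g" "integral\<^sup>L lborel g = 0" for g :: "real^2 \<Rightarrow> real"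
      using that by (simp add: has_bochner_integral_iff)
    have "has_bochner_integral lborel (\<lambda>x. F' 1 x + F' 2 x) (0 + 0)"
      by (intro has_bochner_integral_add hb I1 iF)
    then have "has_bochner_integral lborel (\<lambda>x. nu * (F' 1 x + F' 2 x)) (nu * (0 + 0))"
      by (rule has_bochner_integral_mult_right)
    then have "has_bochner_integral lborel (\<lambda>x. nu * (F' 1 x + F' 2 x) - H x + ?R x) (nu * (0 + 0) - 0 + integral\<^sup>L lborel ?R)"
      by (intro has_bochner_integral_add has_bochner_integral_diff hb[OF I2 iH] has_bochner_integral_integrable[OF I3])
    then have "(LINT x|lborel. nu * (F' 1 x + F' 2 x) - H x + ?R x) = nu * (0 + 0) - 0 + integral\<^sup>L lborel ?R"
      by (rule has_bochner_integral_integral_eq)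
    then show ?thesis by (simp only: add_0 mult_zero_right diff_zero)
  qed
  finally show ?thesis .
qed

lemma integral_laplace_by_parts:
  assumes f: "C1_fun f f'" and p: "C1_fun p p'" and p2: "\<And>i. C1_fun (p' i) (p'' i)" and s: "\<And>x. norm x > r \<Longrightarrow> p x = 0"
    and b: "\<And>y. (b has_real_derivative b' y) (at y)" "continuous_on UNIV b'"
  shows "(LINT x|lborel. b (f x) * (p'' 1 1 x + p'' 2 2 x)) = - (LINT x|lborel. b' (f x) * (p' 1 x * f' 1 x + p' 2 x * f' 2 x))"
proof -
  note s1 = C1_fun_support[OF p s]
  have z: "p' i x * b (f x) = 0" if "norm x > r" for i x using s1[OF _ that] by simp
  have C: "C1_fun (\<lambda>x. p' i x * b (f x)) (\<lambda>j x. p'' i j x * b (f x) + b' (f x) * f' j x * p' i x)" for i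
    by (rule C1_fun_mult[OF p2 C1_fun_chain[OF f b]])
  have I: "integrable lborel (\<lambda>x. p'' i i x * b (f x) + b' (f x) * f' i x * p' i x)"
    "(LINT x|lborel. p'' i i x * b (f x) + b' (f x) * f' i x * p' i x) = 0" for i
    by (rule C1_fun_integral_pd(1)[OF C z], assumption) (rule C1_fun_integral_pd(2)[OF C z])
  have "integrable lborel (\<lambda>x. b' (f x) * (p' 1 x * f' 1 x + p' 2 x * f' 2 x))"
  proof (rule integrable_compact_support[of _ r])
    have "continuous_on UNIV (\<lambda>x. b' (f x))" using continuous_on_compose2[of UNIV _ UNIV f] b(2) C1_funD(2)[OF f] by auto
    then show "continuous_on UNIV (\<lambda>x. b' (f x) * (p' 1 x * f' 1 x + p' 2 x * f' 2 x))"
      by (intro continuous_intros C1_funD[OF f] C1_funD[OF p])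
  qed (use s1 in auto)
  moreover have "integrable lborel (\<lambda>x. (p'' 1 1 x * b (f x) + b' (f x) * f' 1 x * p' 1 x) + (p'' 2 2 x * b (f x) + b' (f x) * f' 2 x * p' 2 x))"
    by (intro Bochner_Integration.integrable_add I(1))
  moreover have "(LINT x|lborel. (p'' 1 1 x * b (f x) + b' (f x) * f' 1 x * p' 1 x) + (p'' 2 2 x * b (f x) + b' (f x) * f' 2 x * p' 2 x)) = 0"
    by (subst Bochner_Integration.integral_add[OF I(1) I(1)]) (simp only: I(2) add_0)
  moreover have "(LINT x|lborel. b (f x) * (p'' 1 1 x + p'' 2 2 x)) = 
     (LINT x|lborel. ((p'' 1 1 x * b (f x) + b' (f x) * f' 1 x * p' 1 x) + (p'' 2 2 x * b (f x) + b' (f x) * f' 2 x * p' 2 x))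
        - b' (f x) * (p' 1 x * f' 1 x + p' 2 x * f' 2 x))"
    by (rule Bochner_Integration.integral_cong) (auto simp: algebra_simps)
  ultimately show ?thesis by simp
qed

text \<open>Instantiated both for the vorticity and for each component, with the same velocity.
  Divergence freeness is weak because \<open>u\<close> is merely continuous.\<close>

locale advection =
  fixes nu :: real and u :: "2 \<Rightarrow> real^2 \<Rightarrow> real \<Rightarrow> real" and f :: "real^2 \<Rightarrow> real \<Rightarrow> real"
  assumes nu: "nu > 0" and C21: "C21 f"
    and pde: "t > 0 \<Longrightarrow> dt f x t = nu * (d2 f 1 x t + d2 f 2 x t) - (u 1 x t * grad f x t $ 1 + u 2 x t * grad f x t $ 2)"
    and u_cont: "t > 0 \<Longrightarrow> continuous_on UNIV (\<lambda>x. u i x t)"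
    and u_div: "t > 0 \<Longrightarrow> C1_fun F F' \<Longrightarrow> (\<And>x. norm x > r \<Longrightarrow> F x = 0) \<Longrightarrow>
       (LINT x|lborel. u 1 x t * F' 1 x + u 2 x t * F' 2 x) = 0"
begin

text \<open>Common source of the three estimates: b is the identity for the far velocity, a smoothed
  modulus for the mass, and the square for the energy, where the weight moves in time.\<close>

lemma weighted_derivative:
  assumes b: "\<And>y. (b has_real_derivative b' y) (at y)" "\<And>y. (b' has_real_derivative b'' y) (at y)" "continuous_on UNIV b''"
    and p: "\<And>t. t > 0 \<Longrightarrow> C1_fun (\<lambda>x. p x t) (\<lambda>i x. p' i x t)" "\<And>x t. t > 0 \<Longrightarrow> norm x > r \<Longrightarrow> p x t = 0"
    and pt: "\<And>x t. t > 0 \<Longrightarrow> ((\<lambda>s. p x s) has_real_derivative pt x t) (at t)"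
      "continuous_on (UNIV \<times> {0<..}) (\<lambda>q. p (fst q) (snd q))" "continuous_on (UNIV \<times> {0<..}) (\<lambda>q. pt (fst q) (snd q))"
    and t: "t > 0"
  shows "((\<lambda>t. LINT x|lborel. p x t * b (f x t)) has_real_derivative
     (LINT x|lborel. pt x t * b (f x t) + b (f x t) * (u 1 x t * p' 1 x t + u 2 x t * p' 2 x t)
       - nu * b' (f x t) * (p' 1 x t * grad f x t $ 1 + p' 2 x t * grad f x t $ 2)
       - nu * p x t * b'' (f x t) * ((grad f x t $ 1)\<^sup>2 + (grad f x t $ 2)\<^sup>2))) (at t)"
proof -
  have cb': "continuous_on UNIV b'" by (rule DERIV_continuous_on) (use b in auto)
  have cb: "continuous_on UNIV b" by (rule DERIV_continuous_on) (use b in auto)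
  have comp: "continuous_on S (\<lambda>x. b (g x))" "continuous_on S (\<lambda>x. b' (g x))" "continuous_on S (\<lambda>x. b'' (g x))" 
    if "continuous_on S g" for S and g :: "'z::topological_space \<Rightarrow> real"
    using continuous_on_compose2[of UNIV _ S g] cb cb' b(3) that by auto
  note F = C21_D[OF C21 t]
  define k where "k = (\<lambda>x t. p x t * b (f x t))"
  define kt where "kt = (\<lambda>x t. pt x t * b (f x t) + p x t * (b' (f x t) * dt f x t))"
  have p0: "p' i x t = 0" if "norm x > r" for i x
    using C1_fun_support[OF p(1)[OF t] p(2)[OF t]] that by simp
  have pt0: "pt x t = 0" if "norm x > r" for x
    using DERIV_eq_0_of_vanishing[OF pt(1)[OF t] t] p(2) that by blast
  have fx: "continuous_on UNIV (\<lambda>x. pt x t)"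
    by (rule continuous_on_slice[where g=pt, OF pt(3) t])
  note pC = C1_funD[OF p(1)[OF t]]
  have "((\<lambda>t. LINT x|lborel. k x t) has_real_derivative (LINT x|lborel. kt x t)) (at t)"
  proof (rule integral_time_derivative[OF _ _ _ _ t])
    fix x and s :: real assume s: "s > 0"
    show "((\<lambda>s. k x s) has_real_derivative kt x s) (at s)"
      using DERIV_mult[OF pt(1)[OF s, of x] DERIV_chain2[OF b(1) C21_D(1)[OF C21 s, of x]]]
      by (simp add: k_def kt_def algebra_simps)
    show "continuous_on UNIV (\<lambda>x. k x s)" unfolding k_def
      by (intro continuous_intros comp C21_D(4)[OF C21 s] C1_funD(2)[OF p(1)[OF s]])
    show "norm x > r \<Longrightarrow> k x s = 0" using p(2)[OF s] by (simp add: k_def)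
  next
    show "continuous_on (UNIV \<times> {0<..}) (\<lambda>p. kt (fst p) (snd p))" unfolding kt_def
      by (intro continuous_intros comp pt C21_continuous[OF C21])
  qed
  moreover have "(LINT x|lborel. kt x t) = 
     (LINT x|lborel. pt x t * b (f x t)) + (LINT x|lborel. p x t * b' (f x t) * (nu * (d2 f 1 x t + d2 f 2 x t) - (u 1 x t * grad f x t $ 1 + u 2 x t * grad f x t $ 2)))"
    unfolding kt_def pde[OF t] mult.assoc[of "p _ _", symmetric]
  proof (rule Bochner_Integration.integral_add)
    show "integrable lborel (\<lambda>x. pt x t * b (f x t))"
      by (rule integrable_compact_support[of _ r]) (use pt0 in \<open>auto intro!: continuous_intros fx comp F\<close>)
    show "integrable lborel (\<lambda>x. p x t * b' (f x t) * (nu * (d2 f 1 x t + d2 f 2 x t) - (u 1 x t * grad f x t $ 1 + u 2 x t * grad f x t $ 2)))"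
      by (rule integrable_compact_support[of _ r]) (use p(2)[OF t] in \<open>auto intro!: continuous_intros comp F pC u_cont t\<close>)
  qed
  also have "(LINT x|lborel. p x t * b' (f x t) * (nu * (d2 f 1 x t + d2 f 2 x t) - (u 1 x t * grad f x t $ 1 + u 2 x t * grad f x t $ 2))) =
    (LINT x|lborel. b (f x t) * (u 1 x t * p' 1 x t + u 2 x t * p' 2 x t)
       - nu * b' (f x t) * (p' 1 x t * grad f x t $ 1 + p' 2 x t * grad f x t $ 2)
       - nu * p x t * b'' (f x t) * ((grad f x t $ 1)\<^sup>2 + (grad f x t $ 2)\<^sup>2))"
  proof (rule renormalised_identity[where f="\<lambda>x. f x t" and f'="\<lambda>i x. grad f x t $ i" and f''="\<lambda>i x. d2 f i x t"
          and p="\<lambda>x. p x t" and p'="\<lambda>i x. p' i x t" and u="\<lambda>i x. u i x t" and r=r])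
    show "C1_fun (\<lambda>x. f x t) (\<lambda>i x. grad f x t $ i)" by (rule C21_C1[OF C21 t])
    show "C1_fun (\<lambda>x. p x t) (\<lambda>i x. p' i x t)" by (rule p(1)[OF t])
    show "p x t = 0" if "norm x > r" for x by (rule p(2)[OF t that])
    show "(LINT x|lborel. u 1 x t * F' 1 x + u 2 x t * F' 2 x) = 0"
      if "C1_fun F F'" "\<And>x. norm x > r \<Longrightarrow> F x = 0" for F F'
      by (rule u_div[OF t that])
  qed (fact F b u_cont[OF t])+
  also have "(LINT x|lborel. pt x t * b (f x t)) + \<dots> = (LINT x|lborel. pt x t * b (f x t) + (b (f x t) * (u 1 x t * p' 1 x t + u 2 x t * p' 2 x t)
       - nu * b' (f x t) * (p' 1 x t * grad f x t $ 1 + p' 2 x t * grad f x t $ 2)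
       - nu * p x t * b'' (f x t) * ((grad f x t $ 1)\<^sup>2 + (grad f x t $ 2)\<^sup>2)))"
  proof (rule Bochner_Integration.integral_add[symmetric])
    show "integrable lborel (\<lambda>x. pt x t * b (f x t))"
      by (rule integrable_compact_support[of _ r]) (use pt0 in \<open>auto intro!: continuous_intros fx comp F\<close>)
    show "integrable lborel (\<lambda>x. b (f x t) * (u 1 x t * p' 1 x t + u 2 x t * p' 2 x t)
       - nu * b' (f x t) * (p' 1 x t * grad f x t $ 1 + p' 2 x t * grad f x t $ 2)
       - nu * p x t * b'' (f x t) * ((grad f x t $ 1)\<^sup>2 + (grad f x t $ 2)\<^sup>2))"
      by (rule integrable_compact_support[of _ r]) (use p(2)[OF t] p0 in \<open>auto intro!: continuous_intros comp F pC u_cont t\<close>)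
  qed
  finally show ?thesis unfolding k_def by (simp add: add_diff_eq add.assoc)
qed

end

context advection begin

text \<open>A second integration by parts removes grad f from the cross term at the price of second
  derivatives of p. What remains of grad f has a sign when p >= 0 and b is convex.\<close>

lemma steady_weighted_derivative:
  assumes b: "\<And>y. (b has_real_derivative b' y) (at y)" "\<And>y. (b' has_real_derivative b'' y) (at y)" "continuous_on UNIV b''"
    and p: "C1_fun p p'" "\<And>i. C1_fun (p' i) (p'' i)" "\<And>x. norm x > r \<Longrightarrow> p x = 0"
    and t: "t > 0"
  obtains D where "((\<lambda>t. LINT x|lborel. p x * b (f x t)) has_real_derivative D) (at t)"
    "D = (LINT x|lborel. b (f x t) * (nu * (p'' 1 1 x + p'' 2 2 x) + (u 1 x t * p' 1 x + u 2 x t * p' 2 x)))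
      - nu * (LINT x|lborel. p x * b'' (f x t) * ((grad f x t $ 1)\<^sup>2 + (grad f x t $ 2)\<^sup>2))"
proof -
  have cb': "continuous_on UNIV b'" by (rule DERIV_continuous_on) (use b in auto)
  have cb: "continuous_on UNIV b" by (rule DERIV_continuous_on) (use b in auto)
  note F = C21_D[OF C21 t]
  have comp: "continuous_on UNIV (\<lambda>x. b (f x t))" "continuous_on UNIV (\<lambda>x. b' (f x t))" "continuous_on UNIV (\<lambda>x. b'' (f x t))"
    using continuous_on_compose2[of UNIV _ UNIV "\<lambda>x. f x t"] cb cb' b(3) F(4) by auto
  note pC = C1_funD[OF p(1)]
  note p0 = C1_fun_support[OF p(1) p(3)]
  have p0': "p'' i j x = 0" if "norm x > r" for i j x
    using C1_fun_support[OF p(2)[of i], of r x j] p0 that by blast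
  have p2: "continuous_on UNIV (p'' i j)" for i j using C1_funD(3)[OF p(2)] .
  let ?I1 = "\<lambda>x. b (f x t) * (u 1 x t * p' 1 x + u 2 x t * p' 2 x)"
  let ?I2 = "\<lambda>x. b' (f x t) * (p' 1 x * grad f x t $ 1 + p' 2 x * grad f x t $ 2)"
  let ?I3 = "\<lambda>x. p x * b'' (f x t) * ((grad f x t $ 1)\<^sup>2 + (grad f x t $ 2)\<^sup>2)"
  let ?I4 = "\<lambda>x. b (f x t) * (p'' 1 1 x + p'' 2 2 x)"
  have i: "integrable lborel ?I1" "integrable lborel ?I2" "integrable lborel ?I3" "integrable lborel ?I4"
    by (rule integrable_compact_support[of _ r],
        use p(3) p0 p0' in \<open>auto intro!: continuous_intros comp F pC u_cont t p2\<close>)+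
  have "((\<lambda>t. LINT x|lborel. p x * b (f x t)) has_real_derivative
     (LINT x|lborel. 0 * b (f x t) + ?I1 x - nu * b' (f x t) * (p' 1 x * grad f x t $ 1 + p' 2 x * grad f x t $ 2)
       - nu * p x * b'' (f x t) * ((grad f x t $ 1)\<^sup>2 + (grad f x t $ 2)\<^sup>2))) (at t)"
  proof (rule weighted_derivative[where p="\<lambda>x _. p x" and p'="\<lambda>i x _. p' i x" and pt="\<lambda>x _. 0" and r=r and b'=b' and b''=b''])
    show "continuous_on (UNIV \<times> {0<..}) (\<lambda>q. p (fst q))"
      by (rule continuous_on_compose2[OF pC(2)]) (auto intro!: continuous_intros)
  qed (use b p t in auto)
  also have "(LINT x|lborel. 0 * b (f x t) + ?I1 x - nu * b' (f x t) * (p' 1 x * grad f x t $ 1 + p' 2 x * grad f x t $ 2)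
       - nu * p x * b'' (f x t) * ((grad f x t $ 1)\<^sup>2 + (grad f x t $ 2)\<^sup>2)) = (LINT x|lborel. ?I1 x - nu * ?I2 x - nu * ?I3 x)"
    by (rule Bochner_Integration.integral_cong) (auto simp: algebra_simps)
  also have "\<dots> = (LINT x|lborel. ?I1 x) - nu * (LINT x|lborel. ?I2 x) - nu * (LINT x|lborel. ?I3 x)"
    using i by simp
  also have "(LINT x|lborel. ?I2 x) = - (LINT x|lborel. ?I4 x)"
    using integral_laplace_by_parts[OF C21_C1[OF C21 t] p b(1) cb'] by simp
  also have "(LINT x|lborel. ?I1 x) - nu * (- (LINT x|lborel. ?I4 x)) - nu * (LINT x|lborel. ?I3 x)
     = (LINT x|lborel. nu * ?I4 x + ?I1 x) - nu * (LINT x|lborel. ?I3 x)"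
    using i by simp
  also have "(LINT x|lborel. nu * ?I4 x + ?I1 x) = (LINT x|lborel. b (f x t) * (nu * (p'' 1 1 x + p'' 2 2 x) + (u 1 x t * p' 1 x + u 2 x t * p' 2 x)))"
    by (rule Bochner_Integration.integral_cong) (auto simp: algebra_simps)
  finally show thesis by (rule that) simp
qed

text \<open>The dissipation absorbs the cross term, at the price of \<open>rho\<close>, an upper bound for
  \<open>\<bar>\<nabla>p\<bar>\<^sup>2 / p\<close>.\<close>

lemma square_weighted_derivative:
  assumes p: "\<And>t. t > 0 \<Longrightarrow> C1_fun (\<lambda>x. p x t) (\<lambda>i x. p' i x t)" "\<And>x t. t > 0 \<Longrightarrow> norm x > r \<Longrightarrow> p x t = 0"
    and pt: "\<And>x t. t > 0 \<Longrightarrow> ((\<lambda>s. p x s) has_real_derivative pt x t) (at t)"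
      "continuous_on (UNIV \<times> {0<..}) (\<lambda>q. p (fst q) (snd q))" "continuous_on (UNIV \<times> {0<..}) (\<lambda>q. pt (fst q) (snd q))"
    and t: "t > 0"
    and nn: "\<And>x. p x t \<ge> 0"
    and rho: "\<And>x. (p' 1 x t)\<^sup>2 + (p' 2 x t)\<^sup>2 \<le> p x t * rho x"
    and rho0: "\<And>x. rho x \<ge> 0"
    and E: "\<And>x. pt x t + (u 1 x t * p' 1 x t + u 2 x t * p' 2 x t) + nu / 2 * rho x \<le> E x"
    and iE: "integrable lborel (\<lambda>x. (f x t)\<^sup>2 * E x)"
  obtains D where "((\<lambda>t. LINT x|lborel. p x t * (f x t)\<^sup>2) has_real_derivative D) (at t)"
    "D \<le> (LINT x|lborel. (f x t)\<^sup>2 * E x)"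
proof -
  note F = C21_D[OF C21 t] and pC = C1_funD[OF p(1)[OF t]]
  have p0: "p' i x t = 0" if "norm x > r" for i x
    using C1_fun_support[OF p(1)[OF t] p(2)[OF t]] that by simp
  have pt0: "pt x t = 0" if "norm x > r" for x
    using DERIV_eq_0_of_vanishing[OF pt(1)[OF t] t] p(2) that by blast
  have cpt: "continuous_on UNIV (\<lambda>x. pt x t)"
    by (rule continuous_on_slice[where g=pt, OF pt(3) t])
  let ?D = "\<lambda>x. pt x t * (f x t)\<^sup>2 + (f x t)\<^sup>2 * (u 1 x t * p' 1 x t + u 2 x t * p' 2 x t)
       - nu * (2 * f x t) * (p' 1 x t * grad f x t $ 1 + p' 2 x t * grad f x t $ 2)
       - nu * p x t * 2 * ((grad f x t $ 1)\<^sup>2 + (grad f x t $ 2)\<^sup>2)"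
  have "((\<lambda>t. LINT x|lborel. p x t * (f x t)\<^sup>2) has_real_derivative (LINT x|lborel. ?D x)) (at t)"
    by (rule weighted_derivative[where b="\<lambda>y. y\<^sup>2" and b'="\<lambda>y. 2 * y" and b''="\<lambda>_. 2" and r=r])
      (use p pt t in \<open>auto intro!: derivative_eq_intros\<close>)
  moreover have "(LINT x|lborel. ?D x) \<le> (LINT x|lborel. (f x t)\<^sup>2 * E x)"
  proof (rule integral_mono[OF _ iE])
    show "integrable lborel ?D"
      by (rule integrable_compact_support[of _ r]) (use p(2)[OF t] p0 pt0 in \<open>auto intro!: continuous_intros F pC u_cont t cpt\<close>)
    fix x
    define w a1 a2 g1 g2 P where "w = f x t" "a1 = p' 1 x t" "a2 = p' 2 x t" "g1 = grad f x t $ 1" "g2 = grad f x t $ 2" "P = p x t"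
    note d = this
    \<comment> \<open>Completing the square after multiplication by 2 P. Where P = 0, the hypothesis
      on \<open>rho\<close> forces the gradient of the weight to vanish too.\<close>
    have young: "2 * P * (g1\<^sup>2 + g2\<^sup>2) + 2 * w * (a1 * g1 + a2 * g2) + w\<^sup>2 * rho x / 2 \<ge> 0"
    proof (cases "P = 0")
      case True
      have "a1\<^sup>2 + a2\<^sup>2 \<le> 0" using rho[of x] True by (simp add: d)
      then have a: "a1 = 0" "a2 = 0" by (simp_all add: sum_power2_le_zero_iff)
      then show ?thesis using a True rho0[of x] by simp
    next
      case False
      then have P: "P > 0" using nn[of x] by (simp add: d)
      have "0 \<le> (2 * P * g1 + w * a1)\<^sup>2 + (2 * P * g2 + w * a2)\<^sup>2" by simp
      also have "\<dots> = 4 * P\<^sup>2 * (g1\<^sup>2 + g2\<^sup>2) + 4 * P * w * (a1 * g1 + a2 * g2) + w\<^sup>2 * (a1\<^sup>2 + a2\<^sup>2)"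
        by (simp add: power2_eq_square algebra_simps)
      also have "\<dots> \<le> 4 * P\<^sup>2 * (g1\<^sup>2 + g2\<^sup>2) + 4 * P * w * (a1 * g1 + a2 * g2) + w\<^sup>2 * (P * rho x)"
        using rho[of x] by (intro add_left_mono mult_left_mono) (auto simp: d)
      also have "\<dots> = (2 * P) * (2 * P * (g1\<^sup>2 + g2\<^sup>2) + 2 * w * (a1 * g1 + a2 * g2) + w\<^sup>2 * rho x / 2)"
        by (simp add: power2_eq_square algebra_simps)
      finally show ?thesis using P by (simp add: zero_le_mult_iff)
    qed
    have "?D x = w\<^sup>2 * (pt x t + (u 1 x t * a1 + u 2 x t * a2) + nu / 2 * rho x)
      - nu * (2 * P * (g1\<^sup>2 + g2\<^sup>2) + 2 * w * (a1 * g1 + a2 * g2) + w\<^sup>2 * rho x / 2)"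
      unfolding d by (simp add: algebra_simps)
    also have "\<dots> \<le> w\<^sup>2 * (pt x t + (u 1 x t * a1 + u 2 x t * a2) + nu / 2 * rho x)"
      using mult_nonneg_nonneg[OF less_imp_le[OF nu] young] by simp
    also have "\<dots> \<le> w\<^sup>2 * E x" using E[of x] by (intro mult_left_mono) (auto simp: d)
    finally show "?D x \<le> (f x t)\<^sup>2 * E x" by (simp add: d)
  qed
  ultimately show thesis by (rule that)
qed

end

section \<open>Radial functions and polynomial cutoffs\<close>

lemma C1_fun_chain_on:
  assumes F: "C1_fun F F'" and S: "range F \<subseteq> S" and b: "\<And>y. y \<in> S \<Longrightarrow> (b has_real_derivative b' y) (at y)"
    and b': "continuous_on S b'"
  shows "C1_fun (\<lambda>x. b (F x)) (\<lambda>i x. b' (F x) * F' i x)"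
proof -
  have "continuous_on S b"
    using b DERIV_isCont by (auto intro!: continuous_at_imp_continuous_on)
  then have "continuous_on UNIV (\<lambda>x. b (F x))" "continuous_on UNIV (\<lambda>x. b' (F x))"
    using continuous_on_compose2[of S _ UNIV F] b' C1_funD(2)[OF F] S by auto
  moreover have "has_pd (\<lambda>x. b (F x)) i (b' (F x) * F' i x) x" for i x
    using S by (intro has_pd_chain[where b=b] C1_funD[OF F] b) auto
  ultimately show ?thesis using C1_funD[OF F] unfolding C1_fun_def
    by (auto intro!: continuous_intros)
qed

lemma C1_fun_nth: "C1_fun (\<lambda>x. x $ j) (\<lambda>i x. axis i 1 $ j)"
  by (auto simp: C1_fun_def has_pd_nth intro!: continuous_intros)

lemma C1_fun_perp: "C1_fun (\<lambda>x. perp x $ j) (\<lambda>i x. perp (axis i 1) $ j)"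
  by (auto simp: C1_fun_def has_pd_perp intro!: continuous_intros)

lemma C1_fun_norm_sq: "C1_fun (\<lambda>x. (norm x)\<^sup>2) (\<lambda>i x. 2 * x $ i)"
  by (auto simp: C1_fun_def has_pd_norm_sq intro!: continuous_intros)

lemma C1_fun_translate:
  assumes "C1_fun F F'" shows "C1_fun (\<lambda>x. F (x - a)) (\<lambda>i x. F' i (x - a))"
proof -
  have "has_pd (\<lambda>x. F (x - a)) i (F' i (x - a)) x" for i x
    using C1_funD(1)[OF assms, of i "x - a"] by (simp add: has_pd_def algebra_simps)
  moreover have "continuous_on UNIV (\<lambda>x. G (x - a))" if "continuous_on UNIV G" for G :: "real^2 \<Rightarrow> real"
    by (rule continuous_on_compose2[OF that]) (auto intro!: continuous_intros)
  ultimately show ?thesis using C1_funD[OF assms] by (auto simp: C1_fun_def)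
qed

lemma DERIV_max_power: "((\<lambda>y::real. (max 0 y)^(n+2)) has_real_derivative real (n + 2) * (max 0 y)^(n+1)) (at y)"
proof -
  consider "y < 0" | "y = 0" | "y > 0" by linarith
  then show ?thesis
  proof cases
    case 1
    have "((\<lambda>y. 0) has_real_derivative real (n + 2) * (max 0 y)^(n+1)) (at y)" using 1 by (simp add: max_def)
    then show ?thesis
      by (rule has_field_derivative_transform_within[where d="-y"]) (use 1 in \<open>auto simp: max_def dist_real_def\<close>)
  next
    case 3
    have "((\<lambda>y. y^(n+2)) has_real_derivative real (n + 2) * (max 0 y)^(n+1)) (at y)"
      using 3 DERIV_pow[of "n+2" y UNIV] by (simp add: max_def)
    then show ?thesis
      by (rule has_field_derivative_transform_within[where d=y]) (use 3 in \<open>auto simp: max_def dist_real_def\<close>)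
  next
    case 2
    have "((\<lambda>h::real. ((max 0 (0 + h))^(n+2) - (max 0 0)^(n+2)) / h) \<longlongrightarrow> 0) (at 0)"
    proof (rule Lim_null_comparison)
      show "\<forall>\<^sub>F h::real in at 0. norm (((max 0 (0 + h))^(n+2) - (max 0 0)^(n+2)) / h) \<le> \<bar>h\<bar>^(n+1)"
      proof (rule eventually_mono[OF eventually_at_filter[THEN iffD2, OF always_eventually]])
        show "\<forall>h::real. h \<noteq> 0 \<longrightarrow> h \<in> UNIV \<longrightarrow> h \<noteq> 0" by simp
        fix h :: real assume "h \<noteq> 0"
        then show "norm (((max 0 (0 + h))^(n+2) - (max 0 0)^(n+2)) / h) \<le> \<bar>h\<bar>^(n+1)"
          using mult_nonpos_nonneg[of h "(- h)^n"] by (cases "h < 0") (simp_all add: power_add)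
      qed
      have "((\<lambda>h::real. \<bar>h\<bar>^(n+1)) \<longlongrightarrow> \<bar>0\<bar>^(n+1)) (at 0)" by (intro tendsto_intros)
      then show "((\<lambda>h::real. \<bar>h\<bar>^(n+1)) \<longlongrightarrow> 0) (at 0)" by simp
    qed
    then show ?thesis unfolding 2 DERIV_def by simp
  qed
qed

text \<open>Meant for s = |x|^2, so that L is a radius. The cube has two continuous derivatives, and
  \<open>cutoff1\<close>^2 / \<open>cutoff\<close> stays bounded at the edge, which the estimate of
  |grad p|^2 / p for the Gaussian weight relies on.\<close>

definition cutoff :: "real \<Rightarrow> real \<Rightarrow> real" where "cutoff L s = (max 0 (1 - s / L\<^sup>2))^3"
definition cutoff1 :: "real \<Rightarrow> real \<Rightarrow> real" where "cutoff1 L s = - 3 / L\<^sup>2 * (max 0 (1 - s / L\<^sup>2))^2"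
definition cutoff2 :: "real \<Rightarrow> real \<Rightarrow> real" where "cutoff2 L s = 6 / L^4 * max 0 (1 - s / L\<^sup>2)"

lemma DERIV_cutoff: "(cutoff L has_real_derivative cutoff1 L s) (at s)"
proof -
  have "((\<lambda>s. 1 - c * s) has_real_derivative - c) (at s)" for c by (auto intro!: derivative_eq_intros)
  from this[of "1 / L\<^sup>2"] have "((\<lambda>s. 1 - s / L\<^sup>2) has_real_derivative - (1 / L\<^sup>2)) (at s)" by simp
  have e: "1 + 2 = (3::nat)" "1 + 1 = (2::nat)" by simp_all
  from DERIV_chain2[OF DERIV_max_power[of 1] \<open>((\<lambda>s. 1 - s / L\<^sup>2) has_real_derivative - (1 / L\<^sup>2)) (at s)\<close>]
  have "((\<lambda>s. (max 0 (1 - s / L\<^sup>2))^3) has_real_derivative 3 * (max 0 (1 - s / L\<^sup>2))^2 * - (1 / L\<^sup>2)) (at s)"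
    unfolding e of_nat_numeral .
  then show ?thesis unfolding cutoff_def[abs_def] cutoff1_def by simp
qed

lemma DERIV_cutoff1: "(cutoff1 L has_real_derivative cutoff2 L s) (at s)"
proof -
  have "((\<lambda>s. 1 - c * s) has_real_derivative - c) (at s)" for c by (auto intro!: derivative_eq_intros)
  from this[of "1 / L\<^sup>2"] have "((\<lambda>s. 1 - s / L\<^sup>2) has_real_derivative - (1 / L\<^sup>2)) (at s)" by simp
  have e: "0 + 2 = (2::nat)" "0 + 1 = (1::nat)" by simp_all
  from DERIV_chain2[OF DERIV_max_power[of 0] \<open>((\<lambda>s. 1 - s / L\<^sup>2) has_real_derivative - (1 / L\<^sup>2)) (at s)\<close>]
  have "((\<lambda>s. (max 0 (1 - s / L\<^sup>2))\<^sup>2) has_real_derivative 2 * max 0 (1 - s / L\<^sup>2) * - (1 / L\<^sup>2)) (at s)"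
    unfolding e of_nat_numeral power_one_right .
  from DERIV_cmult[OF this, of "- 3 / L\<^sup>2"]
  have "(cutoff1 L has_real_derivative - 3 / L\<^sup>2 * (2 * max 0 (1 - s / L\<^sup>2) * - (1 / L\<^sup>2))) (at s)"
    unfolding cutoff1_def[abs_def] .
  moreover have "- 3 / L\<^sup>2 * (2 * max 0 (1 - s / L\<^sup>2) * - (1 / L\<^sup>2)) = cutoff2 L s"
    by (simp add: cutoff2_def power4_eq_xxxx power2_eq_square mult.assoc)
  ultimately show ?thesis by (simp only:)
qed

lemma continuous_on_cutoff: "continuous_on S (cutoff L)" "continuous_on S (cutoff1 L)" "continuous_on S (cutoff2 L)"
  unfolding cutoff_def[abs_def] cutoff1_def[abs_def] cutoff2_def[abs_def]
  by (cases "L = 0"; auto intro!: continuous_intros)+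

lemma cutoff_outside: "L > 0 \<Longrightarrow> s \<ge> L\<^sup>2 \<Longrightarrow> cutoff L s = 0" "L > 0 \<Longrightarrow> s \<ge> L\<^sup>2 \<Longrightarrow> cutoff1 L s = 0"
    "L > 0 \<Longrightarrow> s \<ge> L\<^sup>2 \<Longrightarrow> cutoff2 L s = 0"
  by (auto simp: cutoff_def cutoff1_def cutoff2_def max_def)

lemma cutoff_bounds:
  assumes L: "L > 0" and s: "s \<ge> 0"
  shows "0 \<le> cutoff L s" "cutoff L s \<le> 1" "1 - cutoff L s \<le> 3 * s / L\<^sup>2"
    "\<bar>cutoff1 L s\<bar> \<le> 3 / L\<^sup>2" "\<bar>cutoff2 L s\<bar> \<le> 6 / L^4"
proof -
  define m where "m = max 0 (1 - s / L\<^sup>2)"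
  have m: "0 \<le> m" "m \<le> 1" "1 - m \<le> s / L\<^sup>2" using L s by (auto simp: m_def)
  show "0 \<le> cutoff L s" "cutoff L s \<le> 1" using m power_le_one[of m 3] by (auto simp: cutoff_def m_def[symmetric])
  have "1 - m^3 = (1 - m) * (1 + m + m\<^sup>2)" by (simp add: power2_eq_square power3_eq_cube algebra_simps)
  also have "\<dots> \<le> (1 - m) * 3" using m power_le_one[of m 2] by (intro mult_left_mono) auto
  also have "\<dots> \<le> (s / L\<^sup>2) * 3" using m by (intro mult_right_mono) auto
  finally show "1 - cutoff L s \<le> 3 * s / L\<^sup>2" by (simp add: cutoff_def m_def mult.commute)
  have "\<bar>cutoff1 L s\<bar> = 3 / L\<^sup>2 * m\<^sup>2" "\<bar>cutoff2 L s\<bar> = 6 / L^4 * m"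
    using m L by (simp_all add: cutoff1_def cutoff2_def m_def[symmetric] abs_mult)
  then show "\<bar>cutoff1 L s\<bar> \<le> 3 / L\<^sup>2" "\<bar>cutoff2 L s\<bar> \<le> 6 / L^4"
    using mult_left_mono[of "m\<^sup>2" 1 "3 / L\<^sup>2"] mult_left_mono[of m 1 "6 / L^4"] m power_le_one[of m 2] L by auto
qed

text \<open>Radial functions are written through |x|^2 rather than |x|, so nothing singular happens
  at the origin; the outer function is only evaluated at nonnegative arguments.\<close>

lemma C1_fun_radial:
  assumes "\<And>y. y \<ge> 0 \<Longrightarrow> (b has_real_derivative b' y) (at y)" "continuous_on {0..} b'"
  shows "C1_fun (\<lambda>x. b ((norm x)\<^sup>2)) (\<lambda>i x. b' ((norm x)\<^sup>2) * (2 * x $ i))"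
  by (rule C1_fun_chain_on[OF C1_fun_norm_sq, of "{0..}"]) (use assms in auto)

section \<open>Temporal oscillation of the velocity\<close>

text \<open>Radial factor of \<open>far_kernel\<close> as a function of the squared radius, followed
  by its first two derivatives.\<close>

definition profile :: "real \<Rightarrow> real \<Rightarrow> real \<Rightarrow> real" where
  "profile R L s = 1 / (2 * pi * (s + R\<^sup>2)) * cutoff L s"
definition profile1 :: "real \<Rightarrow> real \<Rightarrow> real \<Rightarrow> real" where
  "profile1 R L s = - 1 / (2 * pi * (s + R\<^sup>2)\<^sup>2) * cutoff L s + 1 / (2 * pi * (s + R\<^sup>2)) * cutoff1 L s"
definition profile2 :: "real \<Rightarrow> real \<Rightarrow> real \<Rightarrow> real" where
  "profile2 R L s = 1 / (pi * (s + R\<^sup>2)^3) * cutoff L s - 1 / (pi * (s + R\<^sup>2)\<^sup>2) * cutoff1 L s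
     + 1 / (2 * pi * (s + R\<^sup>2)) * cutoff2 L s"

lemma DERIV_profile:
  assumes "R > 0" "s \<ge> 0"
  shows "(profile R L has_real_derivative profile1 R L s) (at s)"
    and "(profile1 R L has_real_derivative profile2 R L s) (at s)"
proof -
  have p: "s + R\<^sup>2 > 0" using assms by (simp add: add_nonneg_pos)
  have 1: "((\<lambda>s. 1 / (2 * pi * (s + R\<^sup>2))) has_real_derivative - 1 / (2 * pi * (s + R\<^sup>2)\<^sup>2)) (at s)"
  proof -
    have "((\<lambda>s. 1 / (2 * pi) * inverse (s + R\<^sup>2)) has_real_derivative 1 / (2 * pi) * (- (inverse (s + R\<^sup>2) * 1 * inverse (s + R\<^sup>2)))) (at s)"
      using p by (intro DERIV_cmult DERIV_inverse') (auto intro!: derivative_eq_intros)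
    then show ?thesis by (simp add: inverse_eq_divide power2_eq_square)
  qed
  have 2: "((\<lambda>s. - 1 / (2 * pi * (s + R\<^sup>2)\<^sup>2)) has_real_derivative 1 / (pi * (s + R\<^sup>2)^3)) (at s)"
  proof -
    have "((\<lambda>s. - 1 / (2 * pi) * (inverse (s + R\<^sup>2) * inverse (s + R\<^sup>2))) has_real_derivative
       - 1 / (2 * pi) * ((- (inverse (s + R\<^sup>2) * 1 * inverse (s + R\<^sup>2))) * inverse (s + R\<^sup>2) 
         + (- (inverse (s + R\<^sup>2) * 1 * inverse (s + R\<^sup>2))) * inverse (s + R\<^sup>2))) (at s)"
      using p by (intro DERIV_cmult DERIV_mult DERIV_inverse') (auto intro!: derivative_eq_intros)
    then show ?thesis by (simp add: inverse_eq_divide power2_eq_square power3_eq_cube mult.assoc)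
  qed
  show "(profile R L has_real_derivative profile1 R L s) (at s)"
    using DERIV_mult[OF 1 DERIV_cutoff[of L s]] unfolding profile_def[abs_def] profile1_def
    by (simp add: algebra_simps)
  have e: "- 1 / (2 * pi * (s + R\<^sup>2)\<^sup>2) * c + - 1 / (2 * pi * (s + R\<^sup>2)\<^sup>2) * c = - (1 / (pi * (s + R\<^sup>2)\<^sup>2) * c)" for c
    by (simp add: field_simps)
  show "(profile1 R L has_real_derivative profile2 R L s) (at s)"
    using DERIV_add[OF DERIV_mult[OF 2 DERIV_cutoff[of L s]] DERIV_mult[OF 1 DERIV_cutoff1[of L s]]] e[of "cutoff1 L s"]
    unfolding profile1_def[abs_def] profile2_def
    by (simp add: algebra_simps)
qed

lemma continuous_on_profile:
  assumes "R > 0" shows "continuous_on {0..} (profile1 R L)" "continuous_on {0..} (profile2 R L)"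
proof -
  have "s + R\<^sup>2 > 0" if "s \<ge> 0" for s using assms that by (simp add: add_nonneg_pos)
  then have ne: "s + R\<^sup>2 \<noteq> 0" if "s \<ge> 0" for s using that by (metis less_irrefl)
  show "continuous_on {0..} (profile1 R L)" "continuous_on {0..} (profile2 R L)"
    unfolding profile1_def[abs_def] profile2_def[abs_def]
    by (auto intro!: continuous_intros continuous_on_cutoff simp: ne)
qed

text \<open>Uniform in L >= R: where the cutoff is active, s < L^2 and hence s + R^2 <= 2 L^2, so
  negative powers of L turn into negative powers of s + R^2.\<close>

lemma profile_bounds:
  assumes R: "R > 0" "R \<le> L" and s: "s \<ge> 0"
  shows "\<bar>profile1 R L s\<bar> \<le> 7 / (s + R\<^sup>2)\<^sup>2" "\<bar>profile2 R L s\<bar> \<le> 37 / (s + R\<^sup>2)^3"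
proof -
  define a where "a = s + R\<^sup>2"
  have a: "a > 0" using R s by (simp add: a_def add_nonneg_pos)
  have L: "L > 0" using R by simp
  note cb = cutoff_bounds[OF L s]
  have c0: "\<bar>cutoff L s\<bar> \<le> 1" using cb by simp
  have c12: "\<bar>cutoff1 L s\<bar> \<le> 6 / a \<and> \<bar>cutoff2 L s\<bar> \<le> 24 / a\<^sup>2"
  proof (cases "s \<ge> L\<^sup>2")
    case True then show ?thesis using cutoff_outside[OF L True] a by simp
  next
    case False
    have "R\<^sup>2 \<le> L\<^sup>2" using R by (intro power_mono) auto
    then have al: "a \<le> 2 * L\<^sup>2" using False by (simp add: a_def)
    have "3 / L\<^sup>2 \<le> 6 / a" using al a L by (simp add: field_simps)
    moreover have "6 / L^4 \<le> 24 / a\<^sup>2"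
    proof -
      have "a\<^sup>2 \<le> (2 * L\<^sup>2)\<^sup>2" using al a by (intro power_mono) auto
      then have "a\<^sup>2 \<le> 4 * L^4" by (simp add: power_mult_distrib)
      then show ?thesis using a L by (simp add: field_simps)
    qed
    ultimately show ?thesis using cb by linarith
  qed
  have pi1: "1 / pi \<le> 1" using pi_gt3 by simp
  have A: "\<bar>1 / (2 * pi * a)\<bar> \<le> 1 / a" "\<bar>1 / (2 * pi * a\<^sup>2)\<bar> \<le> 1 / a\<^sup>2" "\<bar>1 / (pi * a\<^sup>2)\<bar> \<le> 1 / a\<^sup>2" "\<bar>1 / (pi * a^3)\<bar> \<le> 1 / a^3"
    using a pi_gt3 by (auto intro!: divide_left_mono simp: abs_mult)
  have tri2: "\<bar>x + y\<bar> \<le> c + d" if "\<bar>x\<bar> \<le> c" "\<bar>y\<bar> \<le> d" for x y c d :: real using that by linarith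
  have mul: "\<bar>x * y\<bar> \<le> c * d" if "\<bar>x\<bar> \<le> c" "\<bar>y\<bar> \<le> d" for x y c d :: real
    unfolding abs_mult using that by (intro mult_mono) auto
  have "\<bar>- 1 / (2 * pi * a\<^sup>2) * cutoff L s + 1 / (2 * pi * a) * cutoff1 L s\<bar> \<le> 1 / a\<^sup>2 * 1 + 1 / a * (6 / a)"
    using A c0 c12 by (intro tri2 mul) auto
  also have "\<dots> = 7 / a\<^sup>2" using a by (simp add: field_simps power2_eq_square)
  finally show "\<bar>profile1 R L s\<bar> \<le> 7 / (s + R\<^sup>2)\<^sup>2" by (simp add: profile1_def a_def)
  have "\<bar>1 / (pi * a^3) * cutoff L s + (- (1 / (pi * a\<^sup>2))) * cutoff1 L s + 1 / (2 * pi * a) * cutoff2 L s\<bar>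
     \<le> 1 / a^3 * 1 + 1 / a\<^sup>2 * (6 / a) + 1 / a * (24 / a\<^sup>2)"
    using A c0 c12 by (intro tri2 mul) auto
  also have "\<dots> = 31 / a^3" using a by (simp add: field_simps power2_eq_square power3_eq_cube)
  also have "\<dots> \<le> 37 / a^3" using a by (intro divide_right_mono) auto
  finally show "\<bar>profile2 R L s\<bar> \<le> 37 / (s + R\<^sup>2)^3" by (simp add: profile2_def a_def)
qed

text \<open>The Biot--Savart kernel smoothed at scale R keeps the part of the velocity generated
  beyond distance about R. The cutoff at L makes it an admissible test function; L tends to infinity
  in the end.\<close>

definition far_kernel :: "real \<Rightarrow> real \<Rightarrow> 2 \<Rightarrow> real^2 \<Rightarrow> real" where
  "far_kernel R L i z = perp z $ i * profile R L ((norm z)\<^sup>2)"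

definition far_kernel1 :: "real \<Rightarrow> real \<Rightarrow> 2 \<Rightarrow> 2 \<Rightarrow> real^2 \<Rightarrow> real" where
  "far_kernel1 R L i j z = perp (axis j 1) $ i * profile R L ((norm z)\<^sup>2)
     + profile1 R L ((norm z)\<^sup>2) * (2 * z $ j) * perp z $ i"

definition far_kernel2 :: "real \<Rightarrow> real \<Rightarrow> 2 \<Rightarrow> 2 \<Rightarrow> 2 \<Rightarrow> real^2 \<Rightarrow> real" where
  "far_kernel2 R L i j k z = perp (axis j 1) $ i * (profile1 R L ((norm z)\<^sup>2) * (2 * z $ k))
     + ((profile2 R L ((norm z)\<^sup>2) * (2 * z $ k) * (2 * z $ j) + 2 * axis k 1 $ j * profile1 R L ((norm z)\<^sup>2)) * perp z $ i
        + perp (axis k 1) $ i * (profile1 R L ((norm z)\<^sup>2) * (2 * z $ j)))"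

lemma C1_far_kernel:
  assumes R: "R > 0"
  shows "C1_fun (far_kernel R L i) (far_kernel1 R L i)" "C1_fun (far_kernel1 R L i j) (far_kernel2 R L i j)"
proof -
  note Q = C1_fun_radial[OF DERIV_profile(1)[OF R] continuous_on_profile(1)[OF R]]
  note Q1 = C1_fun_radial[OF DERIV_profile(2)[OF R] continuous_on_profile(2)[OF R]]
  show "C1_fun (far_kernel R L i) (far_kernel1 R L i)"
    using C1_fun_mult[OF C1_fun_perp[of i] Q[of L]]
    unfolding far_kernel_def[abs_def] far_kernel1_def[abs_def] .
  show "C1_fun (far_kernel1 R L i j) (far_kernel2 R L i j)"
    using C1_fun_add[OF C1_fun_cmult[OF Q[of L], of "perp (axis j 1) $ i"] 
        C1_fun_mult[OF C1_fun_mult[OF Q1[of L] C1_fun_cmult[OF C1_fun_nth[of j], of 2]] C1_fun_perp[of i]]]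
    unfolding far_kernel1_def[abs_def] far_kernel2_def[abs_def] .
qed

text \<open>Second derivatives of the kernel decay like |z|^-3 beyond R, so their L1 norm is O(1/R)
  uniformly in L. The constant is 42 + 148 = 3 * 14 + 4 * 37, collected from
  \<open>profile_bounds\<close>.\<close>

lemma far_kernel2_le:
  assumes R: "R > 0" "R \<le> L"
  shows "\<bar>far_kernel2 R L i j k z\<bar> \<le> 190 * riesz_ker R z"
proof -
  define r where "r = norm z"
  define a where "a = r\<^sup>2 + R\<^sup>2"
  have r: "r \<ge> 0" by (simp add: r_def)
  have a: "a > 0" "r\<^sup>2 \<le> a" using R by (auto simp: a_def add_nonneg_pos)
  define q1 where "q1 = profile1 R L (r\<^sup>2)"
  define q2 where "q2 = profile2 R L (r\<^sup>2)"
  have q: "\<bar>q1\<bar> \<le> 7 / a\<^sup>2" "\<bar>q2\<bar> \<le> 37 / a^3"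
    using profile_bounds[OF R, of "r\<^sup>2"] by (auto simp: q1_def q2_def a_def)
  have tri: "\<bar>x + y\<bar> \<le> c + d" if "\<bar>x\<bar> \<le> c" "\<bar>y\<bar> \<le> d" for x y c d :: real using that by linarith
  have mul: "\<bar>x * y\<bar> \<le> c * d" if "\<bar>x\<bar> \<le> c" "\<bar>y\<bar> \<le> d" for x y c d :: real
    unfolding abs_mult using that by (intro mult_mono) auto
  have n: "\<bar>perp z $ i\<bar> \<le> r" "\<bar>z $ l\<bar> \<le> r" "\<bar>perp (axis l 1) $ i\<bar> \<le> 1" "\<bar>axis k (1::real) $ j\<bar> \<le> 1" for l
    using perp_nth_le[of z i] component_le_norm_cart[of z l] perp_nth_le[of "axis l 1" i] 
    by (auto simp: r_def) (simp add: axis_def)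
  have n2: "\<bar>2 * z $ l\<bar> \<le> 2 * r" "\<bar>2 * axis k (1::real) $ j\<bar> \<le> 2" for l using n(2)[of l] n(4) by auto
  have "\<bar>far_kernel2 R L i j k z\<bar> \<le> 1 * (7 / a\<^sup>2 * (2 * r)) + ((37 / a^3 * (2 * r) * (2 * r) + 2 * (7 / a\<^sup>2)) * r + 1 * (7 / a\<^sup>2 * (2 * r)))"
    unfolding far_kernel2_def r_def[symmetric] q1_def[symmetric] q2_def[symmetric]
    by (intro tri mul n n2 q)
  also have "\<dots> = 42 * (r / a\<^sup>2) + 148 * (r^3 / a^3)"
    using a by (simp add: field_simps power2_eq_square power3_eq_cube)
  also have "\<dots> \<le> 42 * riesz_ker R z + 148 * riesz_ker R z"
  proof (cases "r = 0")
    case True then show ?thesis by (simp add: riesz_ker_nonneg)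
  next
    case False
    then have rp: "r > 0" using r by simp
    have re: "riesz_ker R z = 1 / (r * a)" by (simp add: riesz_ker_def r_def a_def)
    have "r / a\<^sup>2 \<le> 1 / (r * a)" using rp a by (simp add: field_simps power2_eq_square)
    moreover have "r^3 / a^3 \<le> 1 / (r * a)"
    proof -
      have "r^3 / a^3 = (r\<^sup>2 / a) * (r / a\<^sup>2)" using a by (simp add: field_simps power2_eq_square power3_eq_cube)
      also have "\<dots> \<le> 1 * (r / a\<^sup>2)" using a rp by (intro mult_right_mono) auto
      finally show ?thesis using \<open>r / a\<^sup>2 \<le> 1 / (r * a)\<close> by simp
    qed
    ultimately show ?thesis unfolding re by (intro add_mono mult_left_mono) auto
  qed
  finally show ?thesis by simp
qed

lemma far_kernel_outside: "L > 0 \<Longrightarrow> norm z > L \<Longrightarrow> far_kernel R L i z = 0"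
  using cutoff_outside(1)[of L "(norm z)\<^sup>2"] by (simp add: far_kernel_def profile_def power_mono)

lemma far_kernel_odd: "far_kernel R L i (- z) = - far_kernel R L i z"
  using exhaust_2[of i] by (auto simp: far_kernel_def perp_nth)

lemma far_kernel_diff_le:
  assumes R: "R > 0" and L: "L > 0"
  shows "\<bar>bs_kernel R i z - far_kernel R L i z\<bar> \<le> 3 / L"
proof -
  define r where "r = norm z"
  have r: "r \<ge> 0" by (simp add: r_def)
  have p: "r\<^sup>2 + R\<^sup>2 > 0" using R by (simp add: add_nonneg_pos)
  note cb = cutoff_bounds[OF L, of "r\<^sup>2"]
  have "bs_kernel R i z - far_kernel R L i z = perp z $ i * (1 / (2 * pi * (r\<^sup>2 + R\<^sup>2))) * (1 - cutoff L (r\<^sup>2))"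
    by (simp only: bs_kernel_def far_kernel_def profile_def r_def right_diff_distrib mult.assoc mult_1_right)
  also have "\<bar>\<dots>\<bar> = \<bar>perp z $ i\<bar> * (1 / (2 * pi * (r\<^sup>2 + R\<^sup>2))) * (1 - cutoff L (r\<^sup>2))"
    using cb by (simp add: abs_mult)
  also have "\<dots> \<le> r * (1 / (r\<^sup>2 + R\<^sup>2)) * (1 - cutoff L (r\<^sup>2))"
    using perp_nth_le[of z i] cb p pi_gt3 r
    by (intro mult_right_mono mult_mono divide_left_mono) (auto simp: r_def)
  also have "\<dots> \<le> 3 / L"
  proof (cases "r = 0")
    case True then show ?thesis using L by simp
  next
    case False
    then have rp: "r > 0" using r by simp
    have "r * (1 / (r\<^sup>2 + R\<^sup>2)) \<le> 1 / r" using rp p by (simp add: field_simps power2_eq_square)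
    then have 1: "r * (1 / (r\<^sup>2 + R\<^sup>2)) * (1 - cutoff L (r\<^sup>2)) \<le> 1 / r * (1 - cutoff L (r\<^sup>2))"
      using cb by (intro mult_right_mono) auto
    show ?thesis
    proof (cases "r \<le> L")
      case True
      have "1 / r * (1 - cutoff L (r\<^sup>2)) \<le> 1 / r * (3 * r\<^sup>2 / L\<^sup>2)" using cb rp by (intro mult_left_mono) auto
      also have "\<dots> = (3 / L) * (r / L)" using rp L by (simp add: power2_eq_square)
      also have "\<dots> \<le> 3 / L * 1" using True L by (intro mult_left_mono) auto
      finally show ?thesis using 1 by simp
    next
      case F: False
      have "1 / r * (1 - cutoff L (r\<^sup>2)) \<le> 1 / r * 1" using cb rp by (intro mult_left_mono) auto
      also have "\<dots> \<le> 1 / L" using F L by (simp add: field_simps)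
      also have "\<dots> \<le> 3 / L" using L by (simp add: divide_right_mono)
      finally show ?thesis using 1 by simp
    qed
  qed
  finally show ?thesis .
qed

text \<open>Smoothing at scale R costs O(M R), and cutting off at L costs at most 3 / L times the
  mass. The plus sign reflects that the kernel is odd and appears here with argument y - x.\<close>

lemma (in bounded_vorticity) bs_far_le:
  assumes R: "R > 0" and L: "L > 0"
  shows "\<bar>bs_reg 0 om i x + (LINT y|lborel. om y * far_kernel R L i (y - x))\<bar> \<le> M * ker_const * R + 3 / L * (LINT y|lborel. \<bar>om y\<bar>)"
proof -
  have [measurable]: "far_kernel R L i \<in> borel_measurable borel"
    by (rule borel_measurable_continuous_onI[OF C1_funD(2)[OF C1_far_kernel(1)[OF R]]])
  have idiff: "integrable lborel (\<lambda>y. om y * (bs_kernel R i (x - y) - far_kernel R L i (x - y)))"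
  proof (rule Bochner_Integration.integrable_bound[where f="\<lambda>y. om y * (3 / L)"])
    show "AE y in lborel. norm (om y * (bs_kernel R i (x - y) - far_kernel R L i (x - y))) \<le> norm (om y * (3 / L))"
    proof (rule AE_I2)
      fix y
      have "\<bar>bs_kernel R i (x - y) - far_kernel R L i (x - y)\<bar> \<le> \<bar>3 / L\<bar>"
        using far_kernel_diff_le[OF R L, of i "x - y"] by linarith
      then show "norm (om y * (bs_kernel R i (x - y) - far_kernel R L i (x - y))) \<le> norm (om y * (3 / L))"
        unfolding real_norm_def abs_mult[of "om y"] by (intro mult_left_mono) auto
    qed
  qed (use int in auto)
  have ifar: "integrable lborel (\<lambda>y. om y * far_kernel R L i (x - y))"
    using Bochner_Integration.integrable_diff[OF bs_integrable[of R i x] idiff] by (simp add: algebra_simps)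
  have "(LINT y|lborel. om y * far_kernel R L i (y - x)) = - (LINT y|lborel. om y * far_kernel R L i (x - y))"
    using far_kernel_odd[of R L i "x - _"] by (simp flip: Bochner_Integration.integral_minus)
  then have "bs_reg 0 om i x + (LINT y|lborel. om y * far_kernel R L i (y - x))
    = (bs_reg 0 om i x - bs_reg R om i x) + (LINT y|lborel. om y * (bs_kernel R i (x - y) - far_kernel R L i (x - y)))"
    unfolding bs_reg_def[of R] using bs_integrable[of R i x] ifar by (simp add: right_diff_distrib)
  also have "\<bar>\<dots>\<bar> \<le> M * ker_const * R + 3 / L * (LINT y|lborel. \<bar>om y\<bar>)"
  proof (rule order_trans[OF abs_triangle_ineq], rule add_mono[OF bs_diff_le[OF R]])
    have "\<bar>LINT y|lborel. om y * (bs_kernel R i (x - y) - far_kernel R L i (x - y))\<bar> \<le> (LINT y|lborel. 3 / L * \<bar>om y\<bar>)"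
    proof (rule order_trans[OF integral_abs_bound], rule integral_mono)
      show "\<bar>om y * (bs_kernel R i (x - y) - far_kernel R L i (x - y))\<bar> \<le> 3 / L * \<bar>om y\<bar>" for y
        using mult_left_mono[OF far_kernel_diff_le[OF R L, of i "x - y"] abs_ge_zero[of "om y"]]
        by (simp add: abs_mult mult.commute)
    qed (use idiff int in auto)
    then show "\<bar>LINT y|lborel. om y * (bs_kernel R i (x - y) - far_kernel R L i (x - y))\<bar> \<le> 3 / L * (LINT y|lborel. \<bar>om y\<bar>)"
      by simp
  qed
  finally show ?thesis .
qed

text \<open>With 190 from \<open>far_kernel2_le\<close>: 380 = 2 * 190 for the two second
  derivatives in the Laplacian, 760 = 4 * 190 for the four in the quadratic flux.\<close>

definition osc_const :: real where
  "osc_const = 380 * ker_const + 760 * ker_const / curl_mass"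

lemma osc_const_pos: "osc_const > 0"
  using ker_const_pos curl_mass_pos by (auto simp: osc_const_def intro!: add_pos_pos)

text \<open>32 = 4 * 8: for R = S / (8 M ker_const), this step times osc_const / R equals 1 / (4 S),
  so a term quadratic in S contributes only S / 4.\<close>

definition backward_step :: "real \<Rightarrow> real" where
  "backward_step M = 1 / (32 * M * ker_const * osc_const)"

text \<open>The bound M is uniform up to T only; \<open>om_bdd\<close> provides some bound at each
  later time, so that the velocity satisfies the assumptions of \<open>advection\<close> at all
  positive times.\<close>

locale vorticity =
  fixes nu :: real and om :: "real^2 \<Rightarrow> real \<Rightarrow> real" and T M :: real
  assumes nu_pos: "nu > 0" and om_C21: "C21 om"
    and om_pde: "\<And>x t. t > 0 \<Longrightarrow> dt om x t = nu * (d2 om 1 x t + d2 om 2 x t)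
      - (bs_reg 0 (\<lambda>y. om y t) 1 x * grad om x t $ 1 + bs_reg 0 (\<lambda>y. om y t) 2 x * grad om x t $ 2)"
    and om_int: "\<And>t. t > 0 \<Longrightarrow> integrable lborel (\<lambda>x. om x t)"
    and om_bdd: "\<And>t. t > 0 \<Longrightarrow> \<exists>C. \<forall>x. \<bar>om x t\<bar> \<le> C"
    and T: "T > 0" and M: "M > 0" and om_le: "\<And>x t. t > 0 \<Longrightarrow> t \<le> T \<Longrightarrow> \<bar>om x t\<bar> \<le> M"
begin

definition vel :: "2 \<Rightarrow> real^2 \<Rightarrow> real \<Rightarrow> real" where
  "vel i x t = bs_reg 0 (\<lambda>y. om y t) i x"

definition mass :: "real \<Rightarrow> real" where
  "mass t = (LINT x|lborel. \<bar>om x t\<bar>)"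

lemma mass_nonneg: "mass t \<ge> 0" by (simp add: mass_def)

lemma bv: "t > 0 \<Longrightarrow> t \<le> T \<Longrightarrow> bounded_vorticity (\<lambda>x. om x t) M"
  using om_int om_le C21_D(4)[OF om_C21] by unfold_locales auto

lemma bv_ex: "t > 0 \<Longrightarrow> \<exists>C. bounded_vorticity (\<lambda>x. om x t) C"
  using om_int om_bdd C21_D(4)[OF om_C21] unfolding bounded_vorticity_def by blast

lemma vel_cont: "t > 0 \<Longrightarrow> continuous_on UNIV (\<lambda>x. vel i x t)"
  using bv_ex[of t] bounded_vorticity.continuous_on_bs by (auto simp: vel_def)

lemma vel_div: "t > 0 \<Longrightarrow> C1_fun F F' \<Longrightarrow> (\<And>x. norm x > r \<Longrightarrow> F x = 0) \<Longrightarrow>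
  (LINT x|lborel. vel 1 x t * F' 1 x + vel 2 x t * F' 2 x) = 0"
  using bv_ex[of t] bounded_vorticity.bs_div_free unfolding vel_def by blast

sublocale advection nu vel om
proof unfold_locales
  show "(LINT x|lborel. vel 1 x t * F' 1 x + vel 2 x t * F' 2 x) = 0"
    if "t > 0" "C1_fun F F'" "\<And>x. norm x > r \<Longrightarrow> F x = 0" for t F F' r
    by (rule vel_div[OF that])
qed (use nu_pos om_C21 om_pde vel_cont in \<open>auto simp: vel_def\<close>)

lemma vel_le: "t > 0 \<Longrightarrow> t \<le> T \<Longrightarrow> \<bar>vel i x t\<bar> \<le> M * ker_const + mass t"
  using bounded_vorticity.bs_le[OF bv] by (simp add: vel_def mass_def)

lemma vel_oscillation:
  assumes t: "0 < t1" "t1 \<le> t2" "t2 \<le> T" and U: "\<And>i x s. t1 \<le> s \<Longrightarrow> s \<le> t2 \<Longrightarrow> \<bar>vel i x s\<bar> \<le> U" and R: "R > 0"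
  shows "\<bar>vel i x0 t2 - vel i x0 t1\<bar> \<le> 2 * M * ker_const * R + (t2 - t1) * (osc_const / R * (nu * M + U\<^sup>2))"
proof -
  let ?B = "osc_const / R * (nu * M + U\<^sup>2)"
  \<comment> \<open>The masses at the two end times are finite but uncontrolled; they occur with the
    factor 1 / L and disappear as L tends to infinity.\<close>
  have main: "\<bar>vel i x0 t2 - vel i x0 t1\<bar> \<le> 2 * M * ker_const * R + (t2 - t1) * ?B + 3 * (mass t1 + mass t2) / L"
    if L: "L \<ge> R" for L
  proof -
    have L0: "L > 0" using L R by simp
    define G where "G = (\<lambda>y. far_kernel R L i (y - x0))"
    define G1 where "G1 = (\<lambda>j y. far_kernel1 R L i j (y - x0))"
    define G2 where "G2 = (\<lambda>j k y. far_kernel2 R L i j k (y - x0))"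
    have C: "C1_fun G G1" "C1_fun (G1 j) (G2 j)" for j
      unfolding G_def G1_def G2_def by (intro C1_fun_translate C1_far_kernel R)+
    define r where "r = L + norm x0"
    have s: "G y = 0" if "norm y > r" for y
    proof -
      have "norm (y - x0) > L" using that norm_triangle_ineq2[of y x0] by (simp add: r_def)
      then show ?thesis unfolding G_def by (rule far_kernel_outside[OF L0])
    qed
    have s1: "G1 j y = 0" if "norm y > r" for j y using C1_fun_support[OF C(1) s that] .
    have iG2: "integrable lborel (G2 j k)" for j k by (rule C1_fun_integral_pd(1)[OF C(2) s1])
    have iriesz: "integrable lborel (\<lambda>y. 190 * riesz_ker R (y - x0))"
      using integrable_riesz_ker[OF R] integrable_shift[of "riesz_ker R" "- x0"] by simp
    have riesz: "(LINT y|lborel. 190 * riesz_ker R (y - x0)) \<le> 190 * (ker_const / R)"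
      using integral_riesz_ker[OF R] integral_shift[of "riesz_ker R" "- x0"] by simp
    have G2i: "(LINT y|lborel. \<bar>G2 j k y\<bar>) \<le> 190 * (ker_const / R)" for j k
    proof (rule order_trans[OF integral_mono riesz])
      show "\<bar>G2 j k y\<bar> \<le> 190 * riesz_ker R (y - x0)" for y
        unfolding G2_def by (rule far_kernel2_le[OF R L])
    qed (use iG2 iriesz in auto)
    \<comment> \<open>Up to the error in \<open>far\<close> below, \<open>I s\<close> is minus the
      velocity component at x0. As an integral of \<open>om\<close> against a fixed test function,
      it is differentiable in time.\<close>
    define I where "I = (\<lambda>t. LINT y|lborel. G y * om y t)"
    have dI: "\<exists>D. (I has_real_derivative D) (at s) \<and> \<bar>D\<bar> \<le> ?B" if st: "t1 \<le> s" "s \<le> t2" for s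
    proof -
      have s0: "s > 0" "s \<le> T" using st t by auto
      interpret b: bounded_vorticity "\<lambda>x. om x s" M by (rule bv[OF s0])
      obtain D where D: "(I has_real_derivative D) (at s)"
        and De: "D = (LINT x|lborel. om x s * (nu * (G2 1 1 x + G2 2 2 x) + (vel 1 x s * G1 1 x + vel 2 x s * G1 2 x)))
          - nu * (LINT x|lborel. G x * 0 * ((grad om x s $ 1)\<^sup>2 + (grad om x s $ 2)\<^sup>2))"
        using steady_weighted_derivative[where b="\<lambda>y. y" and b'="\<lambda>_. 1" and b''="\<lambda>_. 0", OF _ _ _ C s s0(1)]
        unfolding I_def by auto
      have i1: "integrable lborel (\<lambda>x. om x s * (G2 1 1 x + G2 2 2 x))"
        by (rule integrable_compact_support[of _ r])
          (use C1_fun_support[OF C(2) s1] C1_funD(3)[OF C(2)] b.cont in \<open>auto intro!: continuous_intros\<close>)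
      have i2: "integrable lborel (\<lambda>x. om x s * (vel 1 x s * G1 1 x + vel 2 x s * G1 2 x))"
        by (rule integrable_compact_support[of _ r])
          (use s1 C1_funD(3)[OF C(1)] b.cont vel_cont[OF s0(1)] in \<open>auto intro!: continuous_intros\<close>)
      have "D = (LINT x|lborel. nu * (om x s * (G2 1 1 x + G2 2 2 x)) + om x s * (vel 1 x s * G1 1 x + vel 2 x s * G1 2 x))"
        unfolding De by (simp add: algebra_simps)
      then have De2: "D = nu * (LINT x|lborel. om x s * (G2 1 1 x + G2 2 2 x)) + (LINT x|lborel. om x s * (vel 1 x s * G1 1 x + vel 2 x s * G1 2 x))"
        using i1 i2 by simp
      have "\<bar>LINT x|lborel. om x s * (G2 1 1 x + G2 2 2 x)\<bar> \<le> (LINT x|lborel. M * (\<bar>G2 1 1 x\<bar> + \<bar>G2 2 2 x\<bar>))"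
      proof (rule order_trans[OF integral_abs_bound], rule integral_mono)
        show "\<bar>om x s * (G2 1 1 x + G2 2 2 x)\<bar> \<le> M * (\<bar>G2 1 1 x\<bar> + \<bar>G2 2 2 x\<bar>)" for x
          unfolding abs_mult using b.bd b.M_nonneg by (intro mult_mono) auto
      qed (use i1 iG2 in auto)
      also have "\<dots> = M * ((LINT x|lborel. \<bar>G2 1 1 x\<bar>) + (LINT x|lborel. \<bar>G2 2 2 x\<bar>))" using iG2 by simp
      also have "\<dots> \<le> M * (190 * (ker_const / R) + 190 * (ker_const / R))"
        using M by (intro mult_left_mono add_mono G2i) auto
      finally have b1: "\<bar>LINT x|lborel. om x s * (G2 1 1 x + G2 2 2 x)\<bar> \<le> M * (380 * (ker_const / R))" by simp
      \<comment> \<open>grad G decays only like |z|^-2, which is not integrable uniformly in L, and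
        using the mass of \<open>om\<close> instead would be circular. \<open>bs_quadratic\<close>
        puts one more derivative on the kernel and gains integrability.\<close>
      have "curl_mass * \<bar>LINT x|lborel. om x s * (vel 1 x s * G1 1 x + vel 2 x s * G1 2 x)\<bar>
        \<le> U\<^sup>2 * (LINT x|lborel. \<bar>G2 1 1 x\<bar> + \<bar>G2 1 2 x\<bar> + \<bar>G2 2 1 x\<bar> + \<bar>G2 2 2 x\<bar>)"
        unfolding vel_def
        by (rule b.bs_quadratic[OF C(2)[of 1] C(2)[of 2] s1 s1 U[OF st, unfolded vel_def]])
      also have "\<dots> = U\<^sup>2 * ((LINT x|lborel. \<bar>G2 1 1 x\<bar>) + (LINT x|lborel. \<bar>G2 1 2 x\<bar>) + (LINT x|lborel. \<bar>G2 2 1 x\<bar>) + (LINT x|lborel. \<bar>G2 2 2 x\<bar>))"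
        using iG2 by simp
      also have "\<dots> \<le> U\<^sup>2 * (190 * (ker_const / R) + 190 * (ker_const / R) + 190 * (ker_const / R) + 190 * (ker_const / R))"
        by (intro mult_left_mono add_mono G2i) auto
      finally have b20: "curl_mass * \<bar>LINT x|lborel. om x s * (vel 1 x s * G1 1 x + vel 2 x s * G1 2 x)\<bar>
        \<le> U\<^sup>2 * (190 * (ker_const / R) + 190 * (ker_const / R) + 190 * (ker_const / R) + 190 * (ker_const / R))" .
      then have b2: "\<bar>LINT x|lborel. om x s * (vel 1 x s * G1 1 x + vel 2 x s * G1 2 x)\<bar> \<le> U\<^sup>2 * (760 * ker_const / curl_mass / R)"
      proof -
        have "a \<le> c / curl_mass" if "curl_mass * a \<le> c" for a c
          using that curl_mass_pos by (simp add: pos_le_divide_eq mult.commute)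
        from this[OF b20] show ?thesis by (simp add: field_simps)
      qed
      have "\<bar>D\<bar> \<le> nu * (M * (380 * (ker_const / R))) + U\<^sup>2 * (760 * ker_const / curl_mass / R)"
        unfolding De2 using mult_left_mono[OF b1, of nu] b2 nu_pos
        by (intro order_trans[OF abs_triangle_ineq] add_mono) (auto simp: abs_mult)
      also have "\<dots> \<le> ?B"
      proof -
        have "0 \<le> nu * M * (760 * ker_const / curl_mass / R) + U\<^sup>2 * (380 * (ker_const / R))"
          using nu_pos M R ker_const_pos curl_mass_pos by simp
        also have "\<dots> = ?B - (nu * (M * (380 * (ker_const / R))) + U\<^sup>2 * (760 * ker_const / curl_mass / R))"
          by (simp add: osc_const_def add_divide_distrib algebra_simps)
        finally show ?thesis by simp
      qed
      finally show ?thesis using D by blast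
    qed
    have lip: "\<bar>I t2 - I t1\<bar> \<le> (t2 - t1) * ?B"
    proof (cases "t1 = t2")
      case True then show ?thesis by simp
    next
      case False
      then have lt: "t1 < t2" using t by simp
      obtain D where D: "\<And>s. t1 \<le> s \<Longrightarrow> s \<le> t2 \<Longrightarrow> (I has_real_derivative D s) (at s)" "\<And>s. t1 \<le> s \<Longrightarrow> s \<le> t2 \<Longrightarrow> \<bar>D s\<bar> \<le> ?B"
        using dI by metis
      obtain z where z: "t1 < z" "z < t2" "I t2 - I t1 = (t2 - t1) * D z"
        using MVT2[OF lt, of I D] D(1) by blast
      then have "\<bar>I t2 - I t1\<bar> = (t2 - t1) * \<bar>D z\<bar>" using lt by (simp add: abs_mult)
      also have "\<dots> \<le> (t2 - t1) * ?B" using z lt by (intro mult_left_mono D) auto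
      finally show ?thesis .
    qed
    have far: "\<bar>vel i x0 s + I s\<bar> \<le> M * ker_const * R + 3 / L * mass s" if "0 < s" "s \<le> T" for s
      using bounded_vorticity.bs_far_le[OF bv[OF that] R L0, of i x0]
      by (simp add: vel_def I_def G_def mass_def mult.commute)
    have "0 < t2" "t1 \<le> T" using t by auto
    have "\<bar>vel i x0 t2 - vel i x0 t1\<bar> \<le> (M * ker_const * R + 3 / L * mass t1) + (M * ker_const * R + 3 / L * mass t2) + (t2 - t1) * ?B"
      using far[of t1] far[of t2] lip t by linarith
    also have "\<dots> = 2 * M * ker_const * R + (t2 - t1) * ?B + 3 * (mass t1 + mass t2) / L"
      using L0 by (simp add: field_simps)
    finally show ?thesis .
  qed
  show ?thesis
  proof (rule field_le_epsilon)
    fix e :: real assume e: "e > 0"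
    define m where "m = 3 * (mass t1 + mass t2)"
    have m: "m \<ge> 0" using mass_nonneg by (simp add: m_def)
    define L where "L = R + m / e"
    have "L \<ge> R" "L > 0" using m e R by (auto simp: L_def add_pos_nonneg)
    moreover have "m / L \<le> e"
      using \<open>L > 0\<close> e R by (simp add: L_def field_simps)
    ultimately show "\<bar>vel i x0 t2 - vel i x0 t1\<bar> \<le> 2 * M * ker_const * R + (t2 - t1) * ?B + e"
      using main[of L] unfolding m_def by linarith
  qed
qed

text \<open>The time step does not depend on the velocity: enlarging the length \<open>R\<close> in
  \<open>vel_oscillation\<close> proportionally to the velocity makes the quadratic term linear.\<close>

lemma vel_backward:
  assumes t: "0 < t1" "t1 \<le> t0" "t0 \<le> T" "t0 - t1 \<le> backward_step M"
    and S0: "\<And>i x s. t1 \<le> s \<Longrightarrow> s \<le> t0 \<Longrightarrow> \<bar>vel i x s\<bar> \<le> S0"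
    and U0: "\<And>i x. \<bar>vel i x t0\<bar> \<le> U0"
    and s: "t1 \<le> s" "s \<le> t0"
  shows "\<bar>vel i x s\<bar> \<le> 1 + 2 * U0 + nu * M"
proof -
  \<comment> \<open>The hypothesis with \<open>S0\<close> makes the supremum S of this set finite,
    which the absorption of S / 2 below requires.\<close>
  define A where "A = {\<bar>vel i x s\<bar> |i x s. t1 \<le> s \<and> s \<le> t0}"
  define S where "S = Sup A"
  have bd: "bdd_above A" unfolding A_def by (rule bdd_aboveI[of _ S0]) (use S0 in auto)
  have ne: "A \<noteq> {}" using s unfolding A_def by blast
  have S: "\<bar>vel i x s\<bar> \<le> S" if "t1 \<le> s" "s \<le> t0" for i x s
    unfolding S_def by (rule cSup_upper[OF _ bd]) (use that in \<open>auto simp: A_def\<close>)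
  have U00: "U0 \<ge> 0" using U0[of 1 0] by linarith
  have nM: "nu * M > 0" using nu_pos M by simp
  \<comment> \<open>The case S > 1 bounds the viscous contribution nu * M / (4 * S) by nu * M /
    4.\<close>
  have "S \<le> 1 + 2 * U0 + nu * M"
  proof (cases "S \<le> 1")
    case True then show ?thesis using U00 nM by linarith
  next
    case False
    then have S1: "S > 1" by simp
    \<comment> \<open>Chosen so that the near part 2 M ker_const R is S / 4. The far part gives
      another S / 4, and half of S is absorbed.\<close>
    define R where "R = S / (8 * M * ker_const)"
    have R: "R > 0" using S1 M ker_const_pos by (simp add: R_def)
    have "S \<le> U0 + (S / 2 + nu * M / 4)"
      unfolding S_def
    proof (rule cSup_least[OF ne])
      fix v assume "v \<in> A"
      then obtain i x s where v: "v = \<bar>vel i x s\<bar>" "t1 \<le> s" "s \<le> t0" unfolding A_def by auto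
      have "\<bar>vel i x t0 - vel i x s\<bar> \<le> 2 * M * ker_const * R + (t0 - s) * (osc_const / R * (nu * M + S\<^sup>2))"
        by (rule vel_oscillation) (use v t S R in auto)
      also have "2 * M * ker_const * R = S / 4" using M ker_const_pos by (simp add: R_def)
      also have "(t0 - s) * (osc_const / R * (nu * M + S\<^sup>2)) \<le> backward_step M * (osc_const / R * (nu * M + S\<^sup>2))"
        using v t R osc_const_pos nM by (intro mult_right_mono) auto
      also have "\<dots> = (nu * M + S\<^sup>2) / (4 * S)"
        using M ker_const_pos osc_const_pos S1 by (simp add: backward_step_def R_def field_simps)
      also have "\<dots> \<le> nu * M / 4 + S / 4"
        using S1 mult_right_mono[of 1 S "nu * M"] nM by (simp add: field_simps power2_eq_square)
      finally show "v \<le> U0 + (Sup A / 2 + nu * M / 4)" using U0[of i x] v(1) by (simp add: S_def)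
    qed
    then show ?thesis using nM by linarith
  qed
  then show ?thesis using S[OF s, of i x] by linarith
qed

end

section \<open>Mass of the vorticity\<close>

text \<open>Smooth convex approximation of |y| from below. Convexity gives the dissipation a sign,
  and subtracting e keeps it between 0 and |y|.\<close>

definition smooth_abs :: "real \<Rightarrow> real \<Rightarrow> real" where "smooth_abs e y = sqrt (y\<^sup>2 + e\<^sup>2) - e"
definition smooth_abs1 :: "real \<Rightarrow> real \<Rightarrow> real" where "smooth_abs1 e y = y / sqrt (y\<^sup>2 + e\<^sup>2)"
definition smooth_abs2 :: "real \<Rightarrow> real \<Rightarrow> real" where "smooth_abs2 e y = e\<^sup>2 / (sqrt (y\<^sup>2 + e\<^sup>2))^3"

lemma smooth_abs:
  assumes e: "e > 0"
  shows "(smooth_abs e has_real_derivative smooth_abs1 e y) (at y)"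
    "(smooth_abs1 e has_real_derivative smooth_abs2 e y) (at y)"
    "continuous_on UNIV (smooth_abs2 e)" "smooth_abs2 e y \<ge> 0"
    "0 \<le> smooth_abs e y" "smooth_abs e y \<le> \<bar>y\<bar>" "\<bar>y\<bar> - e \<le> smooth_abs e y"
proof -
  have p: "y\<^sup>2 + e\<^sup>2 > 0" for y using e by (simp add: add_nonneg_pos)
  have ne: "y\<^sup>2 + e\<^sup>2 \<noteq> 0" for y using p[of y] by (metis less_irrefl)
  have D: "((\<lambda>y. sqrt (y\<^sup>2 + e\<^sup>2)) has_real_derivative y / sqrt (y\<^sup>2 + e\<^sup>2)) (at y)"
    using p[of y] e by (auto intro!: derivative_eq_intros simp: field_simps)
  show "(smooth_abs e has_real_derivative smooth_abs1 e y) (at y)"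
    unfolding smooth_abs_def[abs_def] smooth_abs1_def using DERIV_diff[OF D DERIV_const[of e]] by simp
  have s: "sqrt (y\<^sup>2 + e\<^sup>2) > 0" using p by simp
  show "(smooth_abs1 e has_real_derivative smooth_abs2 e y) (at y)"
  proof -
    define q where "q = sqrt (y\<^sup>2 + e\<^sup>2)"
    have q: "q > 0" "q * q = y\<^sup>2 + e\<^sup>2" using s p[of y] by (auto simp: q_def)
    have "(smooth_abs1 e has_real_derivative (1 * q - y * (y / q)) / (q * q)) (at y)"
      unfolding smooth_abs1_def[abs_def] unfolding q_def by (rule DERIV_divide[OF DERIV_ident D]) (use s in \<open>metis less_irrefl\<close>)
    also have "(1 * q - y * (y / q)) / (q * q) = (q * q - y * y) / (q * q * q)"
      using q by (simp add: divide_simps)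
    also have "\<dots> = smooth_abs2 e y"
      unfolding q(2) smooth_abs2_def q_def[symmetric] using q(2) by (simp add: power3_eq_cube power2_eq_square)
    finally show ?thesis .
  qed
  show "continuous_on UNIV (smooth_abs2 e)" unfolding smooth_abs2_def[abs_def]
    using ne by (auto intro!: continuous_intros)
  show "smooth_abs2 e y \<ge> 0" using s by (simp add: smooth_abs2_def)
  have "e \<le> sqrt (y\<^sup>2 + e\<^sup>2)" using e by (intro real_le_rsqrt) auto
  then show "0 \<le> smooth_abs e y" by (simp add: smooth_abs_def)
  have "sqrt (y\<^sup>2 + e\<^sup>2) \<le> \<bar>y\<bar> + e"
    using e by (intro real_le_lsqrt) (auto simp: power2_sum)
  then show "smooth_abs e y \<le> \<bar>y\<bar>" by (simp add: smooth_abs_def)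
  have "\<bar>y\<bar> \<le> sqrt (y\<^sup>2 + e\<^sup>2)" by (intro real_le_rsqrt) auto
  then show "\<bar>y\<bar> - e \<le> smooth_abs e y" by (simp add: smooth_abs_def)
qed

definition space_cutoff :: "real \<Rightarrow> real^2 \<Rightarrow> real" where
  "space_cutoff L x = cutoff L ((norm x)\<^sup>2)"
definition space_cutoff1 :: "real \<Rightarrow> 2 \<Rightarrow> real^2 \<Rightarrow> real" where
  "space_cutoff1 L i x = cutoff1 L ((norm x)\<^sup>2) * (2 * x $ i)"
definition space_cutoff2 :: "real \<Rightarrow> 2 \<Rightarrow> 2 \<Rightarrow> real^2 \<Rightarrow> real" where
  "space_cutoff2 L i j x = cutoff2 L ((norm x)\<^sup>2) * (2 * x $ j) * (2 * x $ i) + 2 * axis j 1 $ i * cutoff1 L ((norm x)\<^sup>2)"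

lemma C1_space_cutoff: "C1_fun (space_cutoff L) (space_cutoff1 L)" "C1_fun (space_cutoff1 L i) (space_cutoff2 L i)"
proof -
  show "C1_fun (space_cutoff L) (space_cutoff1 L)"
    using C1_fun_radial[OF DERIV_cutoff continuous_on_cutoff(2)]
    unfolding space_cutoff_def[abs_def] space_cutoff1_def[abs_def] .
  show "C1_fun (space_cutoff1 L i) (space_cutoff2 L i)"
    using C1_fun_mult[OF C1_fun_radial[OF DERIV_cutoff1 continuous_on_cutoff(3)] C1_fun_cmult[OF C1_fun_nth[of i], of 2], of L]
    unfolding space_cutoff1_def[abs_def] space_cutoff2_def[abs_def] .
qed

lemma space_cutoff_outside:
  assumes "L > 0" "norm x > L"
  shows "space_cutoff L x = 0" "space_cutoff1 L i x = 0" "space_cutoff2 L i j x = 0"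
  using cutoff_outside[OF assms(1), of "(norm x)\<^sup>2"] assms
  by (auto simp: space_cutoff_def space_cutoff1_def space_cutoff2_def power_mono)

lemma space_cutoff_bounds:
  assumes "L > 0"
  shows "0 \<le> space_cutoff L x" "space_cutoff L x \<le> 1"
    "\<bar>space_cutoff1 L i x\<bar> \<le> 6 / L" "\<bar>space_cutoff2 L i j x\<bar> \<le> 30 / L\<^sup>2"
proof -
  note cb = cutoff_bounds[OF assms, of "(norm x)\<^sup>2"]
  show "0 \<le> space_cutoff L x" "space_cutoff L x \<le> 1" using cb by (auto simp: space_cutoff_def)
  have "\<bar>space_cutoff1 L i x\<bar> \<le> 6 / L \<and> \<bar>space_cutoff2 L i j x\<bar> \<le> 30 / L\<^sup>2"
  proof (cases "norm x > L")
    case True then show ?thesis using space_cutoff_outside[OF assms True] assms by simp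
  next
    case False
    then have x: "\<bar>x $ k\<bar> \<le> L" for k using component_le_norm_cart[of x k] by linarith
    have mul: "\<bar>x * y\<bar> \<le> c * d" if "\<bar>x\<bar> \<le> c" "\<bar>y\<bar> \<le> d" for x y c d :: real
      unfolding abs_mult using that by (intro mult_mono) auto
    have x2: "\<bar>2 * x $ k\<bar> \<le> 2 * L" for k using x[of k] by simp
    have "\<bar>space_cutoff1 L i x\<bar> \<le> 3 / L\<^sup>2 * (2 * L)"
      unfolding space_cutoff1_def by (intro mul cb x2) simp
    moreover have "\<dots> = 6 / L" using assms by (simp add: power2_eq_square)
    moreover have "\<bar>space_cutoff2 L i j x\<bar> \<le> 6 / L^4 * (2 * L) * (2 * L) + 2 * (3 / L\<^sup>2)"
      unfolding space_cutoff2_def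
      by (intro order_trans[OF abs_triangle_ineq] add_mono mul cb x2) (auto simp: axis_def)
    moreover have "\<dots> = 30 / L\<^sup>2" using assms by (simp add: field_simps power2_eq_square power4_eq_xxxx)
    ultimately show ?thesis by simp
  qed
  then show "\<bar>space_cutoff1 L i x\<bar> \<le> 6 / L" "\<bar>space_cutoff2 L i j x\<bar> \<le> 30 / L\<^sup>2" by auto
qed

text \<open>Bounds the mass in a disc by three times the cutoff mass at the doubled radius; the
  value at |x| = L is at least (3/4)^3 = 27/64.\<close>

lemma space_cutoff_half: "L > 0 \<Longrightarrow> norm x \<le> L \<Longrightarrow> space_cutoff (2 * L) x \<ge> 1 / 3"
proof -
  assume L: "L > 0" and x: "norm x \<le> L"
  have "(norm x)\<^sup>2 \<le> L\<^sup>2" using x by (intro power_mono) auto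
  then have "(norm x)\<^sup>2 / (2 * L)\<^sup>2 \<le> 1 / 4" using L by (simp add: field_simps)
  then have "3 / 4 \<le> 1 - (norm x)\<^sup>2 / (2 * L)\<^sup>2" by linarith
  then have "3 / 4 \<le> max 0 (1 - (norm x)\<^sup>2 / (2 * L)\<^sup>2)" by (rule max.coboundedI2)
  then have "(3 / 4)^3 \<le> (max 0 (1 - (norm x)\<^sup>2 / (2 * L)\<^sup>2))^3" by (rule power_mono) simp
  moreover have "(1 / 3 :: real) \<le> (3 / 4)^3" by (simp add: power3_eq_cube)
  ultimately show ?thesis unfolding space_cutoff_def cutoff_def by linarith
qed

lemma cutoff_tendsto:
  assumes L: "\<And>n. L n \<ge> real (Suc n)" and y: "y \<ge> 0"
  shows "(\<lambda>n. cutoff (L n) y) \<longlonglongrightarrow> 1"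
proof (rule tendsto_sandwich[OF _ _ _ tendsto_const])
  have "(\<lambda>n. 3 * y * inverse (real (Suc n)) * inverse (real (Suc n))) \<longlonglongrightarrow> 3 * y * 0 * 0"
    by (intro tendsto_intros LIMSEQ_inverse_real_of_nat)
  from tendsto_diff[OF tendsto_const[of 1] this]
  show "(\<lambda>n. 1 - 3 * y * inverse (real (Suc n)) * inverse (real (Suc n))) \<longlonglongrightarrow> 1" by simp
  have Lpos: "L n > 0" for n using L[of n] by linarith
  show "\<forall>\<^sub>F n in sequentially. cutoff (L n) y \<le> 1"
    using cutoff_bounds(2)[OF Lpos y] by simp
  show "\<forall>\<^sub>F n in sequentially. 1 - 3 * y * inverse (real (Suc n)) * inverse (real (Suc n)) \<le> cutoff (L n) y"
  proof (intro always_eventually allI)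
    fix n
    have "(real (Suc n))\<^sup>2 \<le> (L n)\<^sup>2" using L[of n] by (intro power_mono) auto
    then have "3 * y / (L n)\<^sup>2 \<le> 3 * y / (real (Suc n))\<^sup>2"
      using y by (intro divide_left_mono mult_pos_pos zero_less_power Lpos) auto
    also have "\<dots> = 3 * y * inverse (real (Suc n)) * inverse (real (Suc n))"
      by (simp add: power2_eq_square divide_inverse)
    finally show "1 - 3 * y * inverse (real (Suc n)) * inverse (real (Suc n)) \<le> cutoff (L n) y"
      using cutoff_bounds(3)[OF Lpos[of n] y] by simp
  qed
qed

lemma space_cutoff_tendsto: "(\<lambda>n. space_cutoff (real (Suc n)) x) \<longlonglongrightarrow> 1"
  unfolding space_cutoff_def by (rule cutoff_tendsto) auto

section \<open>Monotonicity of the mass while the velocity is bounded\<close>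

context vorticity begin

text \<open>The mass in a disc of radius \<open>L\<close> grows at most like \<open>L\<^sup>2\<close>. Feeding such a bound into the
  flux through the cutoff region gains a factor \<open>1/L\<close>, and three rounds of this suffice.\<close>

lemma mass_nonincreasing:
  assumes t: "0 < a" "a \<le> t" "t \<le> T" and S: "\<And>i x s. a \<le> s \<Longrightarrow> s \<le> t \<Longrightarrow> \<bar>vel i x s\<bar> \<le> S"
  shows "mass t \<le> mass a"
proof -
  \<comment> \<open>K / L bounds nu times the Laplacian of the cutoff plus u . grad of it: 60 = 2 *
    30 and 12 = 2 * 6 from \<open>space_cutoff_bounds\<close>, using 1 / L^2 <= 1 / L.\<close>
  define K where "K = 60 * nu + 12 * S"
  define tau where "tau = t - a"
  define k where "k = (unit_ball_vol 2 :: real)"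
  have S0: "S \<ge> 0" using S[of a 1 0] t by simp
  have K: "K \<ge> 0" using S0 nu_pos by (simp add: K_def)
  have tau: "tau \<ge> 0" using t by (simp add: tau_def)
  have kpos: "k \<ge> 0" by (simp add: k_def)
  define B where "B = (\<lambda>L s. LINT x|lborel. indicator (cball 0 L) x * \<bar>om x s\<bar>)"
  define P where "P = (\<lambda>L s. LINT x|lborel. space_cutoff L x * \<bar>om x s\<bar>)"
  have pos: "s > 0" "s \<le> T" if "a \<le> s" "s \<le> t" for s using that t by auto
  have iom: "integrable lborel (\<lambda>x. \<bar>om x s\<bar>)" if "a \<le> s" "s \<le> t" for s
    using om_int[OF pos(1)[OF that]] by simp
  have comc: "continuous_on UNIV (\<lambda>x. om x s)" if "a \<le> s" "s \<le> t" for s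
    using C21_D(4)[OF om_C21 pos(1)[OF that]] .
  have [measurable]: "space_cutoff L \<in> borel_measurable borel" for L
    by (rule borel_measurable_continuous_onI[OF C1_funD(2)[OF C1_space_cutoff(1)]])
  have iB: "integrable lborel (\<lambda>x. indicator (cball 0 L) x * \<bar>om x s\<bar>)" if "a \<le> s" "s \<le> t" for s L
  proof (rule Bochner_Integration.integrable_bound[OF iom[OF that]])
    show "(\<lambda>x. indicator (cball 0 L) x * \<bar>om x s\<bar>) \<in> borel_measurable lborel"
      using iom[OF that] by (intro borel_measurable_times borel_measurable_indicator) auto
  qed (auto simp: indicator_def)
  have iP: "integrable lborel (\<lambda>x. space_cutoff L x * \<bar>om x s\<bar>)" if "a \<le> s" "s \<le> t" "L > 0" for s L
  proof (rule Bochner_Integration.integrable_bound[OF iom[OF that(1,2)]])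
    show "(\<lambda>x. space_cutoff L x * \<bar>om x s\<bar>) \<in> borel_measurable lborel"
      using iom[OF that(1,2)] by (intro borel_measurable_times) auto
    show "AE x in lborel. norm (space_cutoff L x * \<bar>om x s\<bar>) \<le> norm \<bar>om x s\<bar>"
      using space_cutoff_bounds(1,2)[OF that(3)] by (auto simp: abs_mult intro!: mult_left_le_one_le)
  qed
  have step: "P L s \<le> mass a + tau * (K / L * C)"
    if L: "L \<ge> 1" and C: "\<And>s. a \<le> s \<Longrightarrow> s \<le> t \<Longrightarrow> B L s \<le> C" and s: "a \<le> s" "s \<le> t" for L C s
  proof -
    have L0: "L > 0" using L by simp
    have "0 \<le> B L a" unfolding B_def by (rule integral_nonneg_AE) simp
    then have C0: "C \<ge> 0" using C[of a] t by linarith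
    have KC: "0 \<le> K / L * C" using K L0 C0 by simp
    have icut: "integrable lborel (space_cutoff L)"
      by (rule integrable_compact_support[of _ L]) (use C1_funD(2)[OF C1_space_cutoff(1)] space_cutoff_outside[OF L0] in auto)
    \<comment> \<open>The error of smoothing the modulus is e times the integral of the cutoff,
      finite at fixed L, so e tends to 0 before L tends to infinity.\<close>
    have main: "P L s \<le> mass a + tau * (K / L * C) + e * (LINT x|lborel. space_cutoff L x)" if e: "e > 0" for e
    proof -
      define J where "J = (\<lambda>s. LINT x|lborel. space_cutoff L x * smooth_abs e (om x s))"
      note sa = smooth_abs[OF e]
      have csa: "continuous_on UNIV (smooth_abs e)" by (rule DERIV_continuous_on) (use sa in auto)
      have cJ: "continuous_on UNIV (\<lambda>x. smooth_abs e (om x s))" if "a \<le> s" "s \<le> t" for s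
        using continuous_on_compose2[OF csa comc[OF that]] by simp
      have iJ: "integrable lborel (\<lambda>x. space_cutoff L x * smooth_abs e (om x s))" if "a \<le> s" "s \<le> t" for s
        by (rule integrable_compact_support[of _ L])
          (use C1_funD(2)[OF C1_space_cutoff(1)] space_cutoff_outside[OF L0] cJ[OF that] in \<open>auto intro!: continuous_intros\<close>)
      have dJ: "\<exists>D. (J has_real_derivative D) (at s) \<and> D \<le> K / L * C" if st: "a \<le> s" "s \<le> t" for s
      proof -
        obtain D where D: "(J has_real_derivative D) (at s)"
          and De: "D = (LINT x|lborel. smooth_abs e (om x s) * (nu * (space_cutoff2 L 1 1 x + space_cutoff2 L 2 2 x)
             + (vel 1 x s * space_cutoff1 L 1 x + vel 2 x s * space_cutoff1 L 2 x)))
           - nu * (LINT x|lborel. space_cutoff L x * smooth_abs2 e (om x s) * ((grad om x s $ 1)\<^sup>2 + (grad om x s $ 2)\<^sup>2))"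
          using steady_weighted_derivative[OF sa(1-3) C1_space_cutoff space_cutoff_outside(1)[OF L0] pos(1)[OF st]]
          unfolding J_def by blast
        have "0 \<le> (LINT x|lborel. space_cutoff L x * smooth_abs2 e (om x s) * ((grad om x s $ 1)\<^sup>2 + (grad om x s $ 2)\<^sup>2))"
          by (rule integral_nonneg_AE) (use space_cutoff_bounds(1)[OF L0] sa(4) in auto)
        then have "D \<le> (LINT x|lborel. smooth_abs e (om x s) * (nu * (space_cutoff2 L 1 1 x + space_cutoff2 L 2 2 x)
             + (vel 1 x s * space_cutoff1 L 1 x + vel 2 x s * space_cutoff1 L 2 x)))"
          unfolding De using nu_pos by simp
        also have "\<dots> \<le> (LINT x|lborel. K / L * (indicator (cball 0 L) x * \<bar>om x s\<bar>))"
        proof (rule integral_mono)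
          show "integrable lborel (\<lambda>x. smooth_abs e (om x s) * (nu * (space_cutoff2 L 1 1 x + space_cutoff2 L 2 2 x)
             + (vel 1 x s * space_cutoff1 L 1 x + vel 2 x s * space_cutoff1 L 2 x)))"
            by (rule integrable_compact_support[of _ L])
              (use C1_funD(3)[OF C1_space_cutoff(1)] C1_funD(3)[OF C1_space_cutoff(2)] space_cutoff_outside[OF L0] cJ[OF st] vel_cont[OF pos(1)[OF st]]
                in \<open>auto intro!: continuous_intros\<close>)
          show "integrable lborel (\<lambda>x. K / L * (indicator (cball 0 L) x * \<bar>om x s\<bar>))" using iB[OF st] by (intro integrable_mult_right)
          fix x
          show "smooth_abs e (om x s) * (nu * (space_cutoff2 L 1 1 x + space_cutoff2 L 2 2 x)
             + (vel 1 x s * space_cutoff1 L 1 x + vel 2 x s * space_cutoff1 L 2 x)) \<le> K / L * (indicator (cball 0 L) x * \<bar>om x s\<bar>)"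
          proof (cases "norm x > L")
            case True then show ?thesis using space_cutoff_outside[OF L0 True] by simp
          next
            case False
            have mul: "x * y \<le> c * d" if "\<bar>x\<bar> \<le> c" "\<bar>y\<bar> \<le> d" for x y c d :: real
            proof -
              have "x * y \<le> \<bar>x\<bar> * \<bar>y\<bar>" by (metis abs_ge_self abs_mult)
              also have "\<dots> \<le> c * d" using that by (intro mult_mono) auto
              finally show ?thesis .
            qed
            have "nu * (space_cutoff2 L 1 1 x + space_cutoff2 L 2 2 x) \<le> nu * (30 / L\<^sup>2 + 30 / L\<^sup>2)"
              using space_cutoff_bounds(4)[OF L0, of 1 1 x] space_cutoff_bounds(4)[OF L0, of 2 2 x] nu_pos
              by (intro mult_left_mono add_mono) auto
            also have "\<dots> \<le> nu * (60 / L)" using L nu_pos by (intro mult_left_mono) (auto simp: field_simps power2_eq_square)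
            finally have b1: "nu * (space_cutoff2 L 1 1 x + space_cutoff2 L 2 2 x) \<le> nu * (60 / L)" .
            have b2: "vel 1 x s * space_cutoff1 L 1 x + vel 2 x s * space_cutoff1 L 2 x \<le> S * (6 / L) + S * (6 / L)"
              by (intro add_mono mul S st space_cutoff_bounds L0)
            have "nu * (60 / L) + (S * (6 / L) + S * (6 / L)) = K / L"
              by (simp add: K_def add_divide_distrib)
            then have "nu * (space_cutoff2 L 1 1 x + space_cutoff2 L 2 2 x)
             + (vel 1 x s * space_cutoff1 L 1 x + vel 2 x s * space_cutoff1 L 2 x) \<le> K / L" using b1 b2 by linarith
            then have "smooth_abs e (om x s) * (nu * (space_cutoff2 L 1 1 x + space_cutoff2 L 2 2 x)
             + (vel 1 x s * space_cutoff1 L 1 x + vel 2 x s * space_cutoff1 L 2 x)) \<le> smooth_abs e (om x s) * (K / L)"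
              using sa(5) by (intro mult_left_mono) auto
            also have "\<dots> \<le> \<bar>om x s\<bar> * (K / L)" using sa(6) K L0 by (intro mult_right_mono) auto
            finally show ?thesis using False by (simp add: mult.commute)
          qed
        qed
        also have "\<dots> = K / L * B L s" by (simp add: B_def)
        also have "\<dots> \<le> K / L * C" using C[OF st] K L0 by (intro mult_left_mono) auto
        finally show ?thesis using D by blast
      qed
      have "J s \<le> J a + tau * (K / L * C)"
      proof (cases "a = s")
        case True then show ?thesis using mult_nonneg_nonneg[OF tau KC] by simp
      next
        case False
        then have lt: "a < s" using s by simp
        obtain D where D: "\<And>s. a \<le> s \<Longrightarrow> s \<le> t \<Longrightarrow> (J has_real_derivative D s) (at s)" "\<And>s. a \<le> s \<Longrightarrow> s \<le> t \<Longrightarrow> D s \<le> K / L * C"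
          using dJ by metis
        obtain z where z: "a < z" "z < s" "J s - J a = (s - a) * D z"
          using MVT2[OF lt, of J D] D(1) s by force
        have "(s - a) * D z \<le> (s - a) * (K / L * C)" using D(2)[of z] z s by (intro mult_left_mono) auto
        also have "\<dots> \<le> tau * (K / L * C)" using KC s by (intro mult_right_mono) (auto simp: tau_def)
        finally show ?thesis using z by linarith
      qed
      moreover have "J a \<le> mass a" unfolding J_def mass_def
      proof (rule integral_mono)
        show "space_cutoff L x * smooth_abs e (om x a) \<le> \<bar>om x a\<bar>" for x
          using mult_mono[OF space_cutoff_bounds(2)[OF L0, of x] sa(6)[of "om x a"]] sa(5) by simp
      qed (use iJ[of a] iom[of a] t in auto)
      moreover have "P L s - e * (LINT x|lborel. space_cutoff L x) \<le> J s"
      proof -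
        have "P L s - e * (LINT x|lborel. space_cutoff L x) = (LINT x|lborel. space_cutoff L x * \<bar>om x s\<bar> - e * space_cutoff L x)"
          unfolding P_def using iP[OF s L0] icut by simp
        also have "\<dots> \<le> J s" unfolding J_def
        proof (rule integral_mono)
          show "space_cutoff L x * \<bar>om x s\<bar> - e * space_cutoff L x \<le> space_cutoff L x * smooth_abs e (om x s)" for x
            using mult_left_mono[OF sa(7)[of "om x s"] space_cutoff_bounds(1)[OF L0, of x]] by (simp add: algebra_simps)
        qed (use iP[OF s L0] icut iJ[OF s] in auto)
        finally show ?thesis .
      qed
      ultimately show ?thesis by linarith
    qed
    show ?thesis
    proof (rule field_le_epsilon)
      fix d :: real assume d: "d > 0"
      define Q where "Q = (LINT x|lborel. space_cutoff L x)"
      have Q: "Q \<ge> 0" unfolding Q_def by (rule integral_nonneg_AE) (use space_cutoff_bounds(1)[OF L0] in auto)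
      have "P L s \<le> mass a + tau * (K / L * C) + d / (Q + 1) * Q"
        using main[of "d / (Q + 1)"] d Q by (simp add: Q_def)
      also have "d / (Q + 1) * Q \<le> d" using d Q by (simp add: field_simps)
      finally show "P L s \<le> mass a + tau * (K / L * C) + d" by simp
    qed
  qed
  have BP: "B L s \<le> 3 * P (2 * L) s" if "L \<ge> 1" "a \<le> s" "s \<le> t" for L s
  proof -
    have "B L s \<le> (LINT x|lborel. 3 * (space_cutoff (2 * L) x * \<bar>om x s\<bar>))"
      unfolding B_def
    proof (rule integral_mono)
      fix x
      have "indicator (cball 0 L) x \<le> 3 * space_cutoff (2 * L) x"
        using space_cutoff_half[of L x] space_cutoff_bounds(1)[of "2 * L" x] that by (auto simp: indicator_def)
      then show "indicator (cball 0 L) x * \<bar>om x s\<bar> \<le> 3 * (space_cutoff (2 * L) x * \<bar>om x s\<bar>)"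
        using mult_right_mono[of _ _ "\<bar>om x s\<bar>"] by (simp flip: mult.assoc)
    qed (use iB[OF that(2,3)] iP[OF that(2,3), of "2 * L"] that in auto)
    then show ?thesis by (simp add: P_def)
  qed
  have B0: "B L s \<le> M * k * L\<^sup>2" if "L \<ge> 1" "a \<le> s" "s \<le> t" for L s
  proof -
    have m: "measure lborel (cball (0::real^2) L) = k * L\<^sup>2"
      unfolding measure_def using that by (simp add: cball_real2 k_def)
    have ii: "integrable lborel (\<lambda>x::real^2. M * indicator (cball 0 L) x)"
      by (intro integrable_mult_right integrable_real_indicator) (use emeasure_lborel_cball_finite[of "0::real^2" L] in auto)
    have "B L s \<le> (LINT x::real^2|lborel. M * indicator (cball 0 L) x)"
      unfolding B_def
    proof (rule integral_mono)
      show "integrable lborel (\<lambda>x. indicator (cball 0 L) x * \<bar>om x s\<bar>)" by (rule iB[OF that(2,3)])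
      show "integrable lborel (\<lambda>x::real^2. M * indicator (cball 0 L) x)" by (rule ii)
      show "indicator (cball 0 L) x * \<bar>om x s\<bar> \<le> M * indicator (cball 0 L) x" for x :: "real^2"
        using om_le[OF pos[OF that(2,3)]] by (auto simp: indicator_def)
    qed
    also have "\<dots> = M * (k * L\<^sup>2)" using m by simp
    finally show ?thesis by simp
  qed
  have B1: "B L s \<le> 3 * mass a + 6 * tau * K * M * k * L" if L: "L \<ge> 1" and s: "a \<le> s" "s \<le> t" for L s
  proof -
    have "P (2 * L) s \<le> mass a + tau * (K / (2 * L) * (M * k * (2 * L)\<^sup>2))"
      by (rule step) (use L s B0[of "2 * L"] in auto)
    also have "\<dots> = mass a + 2 * tau * K * M * k * L" using L by (simp add: power2_eq_square)
    finally show ?thesis using BP[OF L s] by (simp add: algebra_simps)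
  qed
  \<comment> \<open>A lossy bound for the mass in every disc, independent of L. The last round,
    \<open>fin\<close>, inserts it into the flux and leaves only \<open>mass a\<close> in the
    limit.\<close>
  define C3 where "C3 = 3 * (mass a + tau * K * (3 * mass a + 12 * tau * K * M * k))"
  have B2: "B L s \<le> C3" if L: "L \<ge> 1" and s: "a \<le> s" "s \<le> t" for L s
  proof -
    have "P (2 * L) s \<le> mass a + tau * (K / (2 * L) * (3 * mass a + 6 * tau * K * M * k * (2 * L)))"
      by (rule step) (use L s B1[of "2 * L"] in auto)
    also have "\<dots> \<le> mass a + tau * K * (3 * mass a + 12 * tau * K * M * k)"
    proof -
      have "(3 * mass a + 6 * tau * K * M * k * (2 * L)) \<le> (3 * mass a + 12 * tau * K * M * k) * (2 * L)"
      proof -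
        define X where "X = tau * K * M * k * L"
        have "X \<ge> 0" unfolding X_def using tau K M kpos L by simp
        moreover have "mass a \<le> 2 * L * mass a"
          using mult_right_mono[of 1 "2 * L" "mass a"] L mass_nonneg[of a] by simp
        moreover have "3 * mass a + 6 * tau * K * M * k * (2 * L) = 3 * mass a + 12 * X"
          "(3 * mass a + 12 * tau * K * M * k) * (2 * L) = 3 * (2 * L * mass a) + 24 * X"
          by (simp_all add: X_def algebra_simps)
        ultimately show ?thesis by linarith
      qed
      then have "K / (2 * L) * (3 * mass a + 6 * tau * K * M * k * (2 * L)) \<le> K / (2 * L) * ((3 * mass a + 12 * tau * K * M * k) * (2 * L))"
        using K L by (intro mult_left_mono) auto
      also have "\<dots> = K * (3 * mass a + 12 * tau * K * M * k)" using L by simp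
      finally show ?thesis using tau
        unfolding mult.assoc[of tau K] by (intro add_left_mono mult_left_mono)
    qed
    finally show ?thesis using BP[OF L s] by (simp add: C3_def)
  qed
  have fin: "P (real (Suc n)) t \<le> mass a + tau * K * C3 * inverse (real (Suc n))" for n
    using step[of "real (Suc n)" C3 t] B2[of "real (Suc n)"] t by (simp add: divide_inverse algebra_simps)
  have "(\<lambda>n. P (real (Suc n)) t) \<longlonglongrightarrow> (LINT x|lborel. 1 * \<bar>om x t\<bar>)"
    unfolding P_def
  proof (rule integral_dominated_convergence[where w="\<lambda>x. \<bar>om x t\<bar>"])
    show "AE x in lborel. (\<lambda>n. space_cutoff (real (Suc n)) x * \<bar>om x t\<bar>) \<longlonglongrightarrow> 1 * \<bar>om x t\<bar>"
      by (intro AE_I2 tendsto_intros space_cutoff_tendsto)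
    show "AE x in lborel. norm (space_cutoff (real (Suc n)) x * \<bar>om x t\<bar>) \<le> \<bar>om x t\<bar>" for n
      using space_cutoff_bounds(1,2)[of "real (Suc n)"] by (auto simp: abs_mult intro!: mult_left_le_one_le)
    show "(\<lambda>x. space_cutoff (real (Suc n)) x * \<bar>om x t\<bar>) \<in> borel_measurable lborel" for n
      using iP[of t "real (Suc n)"] t by simp
  qed (use iom[of t] t in auto)
  moreover have "(\<lambda>n. mass a + tau * K * C3 * inverse (real (Suc n))) \<longlonglongrightarrow> mass a + tau * K * C3 * 0"
    by (intro tendsto_intros LIMSEQ_inverse_real_of_nat)
  ultimately have "(LINT x|lborel. 1 * \<bar>om x t\<bar>) \<le> mass a + tau * K * C3 * 0"
    by (rule LIMSEQ_le) (use fin in auto)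
  then show ?thesis by (simp add: mass_def)
qed

end

section \<open>Boundedness of the mass on bounded time intervals\<close>

context vorticity begin

lemma mass_lsc:
  assumes X: "X \<longlonglongrightarrow> t" and t: "t > 0" "\<And>n. X n > 0" and c: "\<And>n. mass (X n) \<le> c"
  shows "mass t \<le> c"
proof -
  have c0: "c \<ge> 0" using c[of 0] mass_nonneg[of "X 0"] by linarith
  have m: "(\<integral>\<^sup>+x. ennreal \<bar>om x s\<bar> \<partial>lborel) = ennreal (mass s)" if "s > 0" for s
    using om_int[OF that] by (simp add: nn_integral_eq_integral mass_def)
  have lim: "liminf (\<lambda>n. ennreal \<bar>om x (X n)\<bar>) = ennreal \<bar>om x t\<bar>" for x
  proof (rule lim_imp_Liminf)
    have "(\<lambda>n. om x (X n)) \<longlonglongrightarrow> om x t"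
      by (rule isCont_tendsto_compose[OF C21_isCont[OF om_C21 t(1)] X])
    then show "(\<lambda>n. ennreal \<bar>om x (X n)\<bar>) \<longlonglongrightarrow> ennreal \<bar>om x t\<bar>" by (intro tendsto_ennrealI tendsto_rabs)
  qed simp
  have "ennreal (mass t) = (\<integral>\<^sup>+x. liminf (\<lambda>n. ennreal \<bar>om x (X n)\<bar>) \<partial>lborel)"
    using m[OF t(1)] lim by simp
  also have "\<dots> \<le> liminf (\<lambda>n. \<integral>\<^sup>+x. ennreal \<bar>om x (X n)\<bar> \<partial>lborel)"
  proof (rule nn_integral_liminf)
    show "(\<lambda>x. ennreal \<bar>om x (X n)\<bar>) \<in> borel_measurable lborel" for n
      using om_int[OF t(2)[of n]] by (intro measurable_compose[OF _ measurable_ennreal]) simp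
  qed
  also have "\<dots> \<le> limsup (\<lambda>n. ennreal (mass (X n)))"
    using m[OF t(2)] by (simp add: Liminf_le_Limsup)
  also have "\<dots> \<le> ennreal c" by (rule Limsup_bounded) (simp add: c ennreal_leI)
  finally show ?thesis using c0 by (simp add: ennreal_le_iff)
qed

text \<open>Local boundedness of the mass in time. The centre ranges over all reals, which makes the
  good times an open subset of the line.\<close>

definition good :: "real \<Rightarrow> bool" where
  "good t \<longleftrightarrow> (\<exists>e>0. \<exists>n. \<forall>s. \<bar>s - t\<bar> < e \<and> 0 < s \<and> s \<le> T \<longrightarrow> mass s \<le> n)"

lemma goodI:
  assumes "e > 0" "\<And>s. \<bar>s - t\<bar> < e \<Longrightarrow> 0 < s \<Longrightarrow> s \<le> T \<Longrightarrow> mass s \<le> n"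
  shows "good t"
  using assms unfolding good_def by blast

lemma open_good: "open {t. good t}"
  unfolding open_dist
proof safe
  fix t assume "good t"
  then obtain e n where e: "e > 0" "\<And>s. \<bar>s - t\<bar> < e \<and> 0 < s \<and> s \<le> T \<Longrightarrow> mass s \<le> n" unfolding good_def by blast
  have "good y" if "dist y t < e" for y
    by (rule goodI[where e="e - dist y t" and n=n]) (use that e in \<open>auto simp: dist_real_def intro!: e(2)\<close>)
  then show "\<exists>e>0. \<forall>y. dist y t < e \<longrightarrow> y \<in> {t. good t}" using e(1) by blast
qed

lemma good_compact:
  assumes p: "0 < p" "q \<le> T" and g: "\<And>s. p \<le> s \<Longrightarrow> s \<le> q \<Longrightarrow> good s"
  obtains n where "\<And>s. p \<le> s \<Longrightarrow> s \<le> q \<Longrightarrow> mass s \<le> n"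
proof -
  have "\<exists>n. \<forall>s\<in>{p..q}. mass s \<le> n"
  proof (rule ccontr)
    assume "\<not> ?thesis"
    then have "\<forall>k::nat. \<exists>s\<in>{p..q}. mass s > real k" by (meson not_le)
    then obtain X where X: "\<And>k::nat. X k \<in> {p..q}" "\<And>k. mass (X k) > real k" by metis
    have "seq_compact {p..q}" by (simp add: compact_imp_seq_compact)
    then obtain l r where l: "l \<in> {p..q}" "strict_mono r" "(X \<circ> r) \<longlonglongrightarrow> l"
      using X(1) unfolding seq_compact_def by blast
    obtain e n where e: "e > 0" "\<And>s. \<bar>s - l\<bar> < e \<and> 0 < s \<and> s \<le> T \<Longrightarrow> mass s \<le> n"
      using g[of l] l unfolding good_def by force
    have "\<forall>\<^sub>F k in sequentially. dist (X (r k)) l < e"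
      using l(3) e(1) by (simp add: tendsto_iff)
    moreover have "\<forall>\<^sub>F k in sequentially. real k > n"
      using filterlim_real_sequentially by (simp add: filterlim_at_top_dense)
    ultimately have "\<forall>\<^sub>F k in sequentially. False"
    proof eventually_elim
      case (elim k)
      have "mass (X (r k)) \<le> n" using elim X(1)[of "r k"] p by (intro e(2)) (auto simp: dist_real_def)
      moreover have "real k \<le> real (r k)" using l(2) by (simp add: strict_mono_imp_increasing)
      ultimately show False using X(2)[of "r k"] elim by linarith
    qed
    then show False by simp
  qed
  then obtain n where "\<forall>s\<in>{p..q}. mass s \<le> n" by blast
  then show thesis by (intro that[of n]) auto
qed

text \<open>The time \<open>a\<close> may itself be bad, with no bound known immediately to its
  right. Going backwards from t0, the velocity at every s in (a, t0] is bounded by V, which involves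
  only the mass at t0 and not s. Hence the velocity is bounded on all of [a, t] and
  \<open>mass_nonincreasing\<close> applies from \<open>a\<close> on.\<close>

lemma mass_le_of_good:
  assumes a: "0 < a" "a < t" "t \<le> T" and g: "\<And>s. a < s \<Longrightarrow> s \<le> t \<Longrightarrow> good s"
  shows "mass t \<le> mass a"
proof -
  have bs: "backward_step M > 0" using M ker_const_pos osc_const_pos by (simp add: backward_step_def)
  define t0 where "t0 = min t (a + backward_step M)"
  have t0: "a < t0" "t0 \<le> t" "t0 - a \<le> backward_step M" using a bs by (auto simp: t0_def)
  define V where "V = 1 + 2 * (M * ker_const + mass t0) + nu * M"
  have V: "\<bar>vel i x s\<bar> \<le> V" if s: "a < s" "s \<le> t0" for i x s
  proof -
    obtain n where n: "\<And>s'. s \<le> s' \<Longrightarrow> s' \<le> t0 \<Longrightarrow> mass s' \<le> n"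
      using good_compact[of s t0] s a t0 g by (metis less_le_trans less_trans order_trans)
    show ?thesis unfolding V_def
    proof (rule vel_backward[where ?t1.0=s and ?t0.0=t0])
      show "\<bar>vel i x s'\<bar> \<le> M * ker_const + n" if "s \<le> s'" "s' \<le> t0" for i x s'
        using vel_le[of s' i x] n[OF that] that s a t0 by linarith
      show "\<bar>vel i x t0\<bar> \<le> M * ker_const + mass t0" for i x
        using vel_le[of t0 i x] a t0 by linarith
    qed (use s a t0 in auto)
  qed
  obtain n where n: "\<And>s'. t0 \<le> s' \<Longrightarrow> s' \<le> t \<Longrightarrow> mass s' \<le> n"
    using good_compact[of t0 t] a t0 g by (metis less_le_trans less_trans order_trans)
  show ?thesis
  proof (rule mass_nonincreasing[where S="max V (max (M * ker_const + mass a) (M * ker_const + n))"])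
    fix i x s assume s: "a \<le> s" "s \<le> t"
    consider "s = a" | "a < s" "s \<le> t0" | "t0 < s" using s by linarith
    then show "\<bar>vel i x s\<bar> \<le> max V (max (M * ker_const + mass a) (M * ker_const + n))"
    proof cases
      case 1
      have "\<bar>vel i x a\<bar> \<le> M * ker_const + mass a" by (rule vel_le) (use a in auto)
      then show ?thesis unfolding 1 by linarith
    next
      case 2 then show ?thesis using V[of s i x] by linarith
    next
      case 3
      then have "\<bar>vel i x s\<bar> \<le> M * ker_const + n" using vel_le[of s i x] n[of s] s a by linarith
      then show ?thesis by linarith
    qed
  qed (use a in auto)
qed

text \<open>By Baire's theorem and lower semicontinuity, the mass is bounded by some \<open>n\<close> on a relatively
  open part of the closed set of bad times. Starting from a bad time, the mass does not increase as
  long as the times are good, so the bound extends to a full neighbourhood.\<close>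

lemma mass_bounded:
  assumes d: "d > 0" and near: "\<And>s. 0 < s \<Longrightarrow> s < d \<Longrightarrow> mass s \<le> n0"
  obtains n where "\<And>s. 0 < s \<Longrightarrow> s \<le> T \<Longrightarrow> mass s \<le> n"
proof -
  have good_near: "good s" if "0 < s" "s < d" for s
    by (rule goodI[where e="d - s" and n=n0]) (use that near in auto)
  \<comment> \<open>The bad times. Those below d are good, so starting at d / 2 loses none and keeps
    the set closed and away from 0.\<close>
  define B where "B = {d/2..T} \<inter> - {t. good t}"
  have clB: "closed B" unfolding B_def by (intro closed_Int closed_Compl open_good) auto
  have notB: "good s" if "s \<notin> B" "0 < s" "s \<le> T" for s
    using that good_near[of s] d unfolding B_def by (cases "s < d") auto
  have Bpos: "0 < s" "s \<le> T" if "s \<in> B" for s using that d by (auto simp: B_def)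
  have "B = {}"
  proof (rule ccontr)
    assume ne: "B \<noteq> {}"
    define E where "E = (\<lambda>n::nat. {t\<in>B. mass t > real n})"
    have opE: "openin (top_of_set B) (E n)" for n
    proof -
      have "closed {t\<in>B. mass t \<le> real n}"
        unfolding closed_sequential_limits
      proof safe
        fix X l assume X: "\<forall>k. X k \<in> {t \<in> B. mass t \<le> real n}" "X \<longlonglongrightarrow> l"
        show "l \<in> B" using clB X unfolding closed_sequential_limits by blast
        then show "mass l \<le> real n" using X Bpos by (intro mass_lsc[OF X(2)]) auto
      qed
      moreover have "E n = B \<inter> - {t\<in>B. mass t \<le> real n}" by (auto simp: E_def)
      ultimately show ?thesis by (simp add: openin_open_Int open_Compl)
    qed
    \<comment> \<open>Otherwise Baire's theorem would make the intersection of all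
      \<open>E n\<close> dense in B, but it is empty because each mass is a real number.\<close>
    have "\<not> (\<forall>n. B \<subseteq> closure (E n))"
    proof
      assume "\<forall>n. B \<subseteq> closure (E n)"
      then have "B \<subseteq> closure (\<Inter> (range E))" by (intro Baire clB) (use opE in auto)
      moreover have "\<Inter> (range E) = {}"
      proof safe
        fix t assume t: "t \<in> \<Inter> (range E)"
        obtain n :: nat where "mass t < real n" using reals_Archimedean2 by blast
        then show "t \<in> {}" using t by (auto simp: E_def dest: spec[of _ n])
      qed
      ultimately show False using ne by simp
    qed
    then obtain n p where p: "p \<in> B" "p \<notin> closure (E n)" by blast
    then obtain \<rho> where r: "\<rho> > 0" "ball p \<rho> \<subseteq> - closure (E n)"
      using open_contains_ball[of "- closure (E n)"] by (meson ComplI closed_closure open_Compl)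
    have bdB: "mass t \<le> real n" if "t \<in> B" "\<bar>t - p\<bar> < \<rho>" for t
    proof (rule ccontr)
      assume "\<not> mass t \<le> real n"
      then have "t \<in> closure (E n)" using that closure_subset[of "E n"] by (auto simp: E_def)
      then show False using r(2) that by (auto simp: dist_real_def abs_minus_commute)
    qed
    have right: "mass t \<le> real n" if q: "q \<in> B" "\<bar>q - p\<bar> < \<rho>" and t: "q \<le> t" "t < p + \<rho>" "t \<le> T" for q t
    proof -
      \<comment> \<open>The last bad time up to t: its mass is at most n by \<open>bdB\<close>, and
        all times of (a, t] are good.\<close>
      define a where "a = Sup (B \<inter> {q..t})"
      have bdd: "bdd_above (B \<inter> {q..t})" by (rule bdd_aboveI[of _ t]) auto
      have aB: "a \<in> B \<inter> {q..t}" unfolding a_def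
        by (rule closed_contains_Sup) (use q t clB bdd in \<open>auto intro!: closed_Int\<close>)
      have ap: "\<bar>a - p\<bar> < \<rho>" using aB q t by auto
      show ?thesis
      proof (cases "a = t")
        case True then show ?thesis using aB ap bdB by auto
      next
        case False
        have "mass t \<le> mass a"
        proof (rule mass_le_of_good)
          show "good s" if s: "a < s" "s \<le> t" for s
          proof (rule notB)
            show "s \<notin> B"
            proof
              assume "s \<in> B"
              then have "s \<le> a" unfolding a_def using s aB by (intro cSup_upper bdd) auto
              then show False using s by simp
            qed
            show "0 < s" "s \<le> T" using s aB Bpos[of a] t by auto
          qed
        qed (use aB Bpos[of a] t False in auto)
        also have "\<dots> \<le> real n" using aB ap bdB by auto
        finally show ?thesis .
      qed
    qed
    \<comment> \<open>A bad time q slightly to the left of p would let \<open>right\<close> bound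
      the mass on both sides of p, making p good.\<close>
    have left: "q \<notin> B" if q: "p - \<rho> < q" "q < p" for q
    proof
      assume qB: "q \<in> B"
      have "good p"
      proof (rule goodI[where e="min (p - q) \<rho>"])
        fix s assume s: "\<bar>s - p\<bar> < min (p - q) \<rho>" "0 < s" "s \<le> T"
        show "mass s \<le> real n" by (rule right[OF qB]) (use s q in auto)
      qed (use q r in auto)
      then show False using p(1) by (simp add: B_def)
    qed
    have p0: "p > 0" "p \<le> T" using Bpos[OF p(1)] by auto
    \<comment> \<open>No bad time lies between t0 and p, so the mass at t0 bounds the mass on that
      interval; p / 2 keeps t0 positive.\<close>
    define t0 where "t0 = max (p - \<rho> / 2) (p / 2)"
    have t0: "0 < t0" "t0 < p" "p - \<rho> < t0" using p0 r by (auto simp: t0_def)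
    have "good p"
    proof (rule goodI[where e="min (p - t0) \<rho>"])
      fix s assume s: "\<bar>s - p\<bar> < min (p - t0) \<rho>" "0 < s" "s \<le> T"
      show "mass s \<le> max (real n) (mass t0)"
      proof (cases "s < p")
        case True
        have "mass s \<le> mass t0"
        proof (rule mass_le_of_good)
          show "good s'" if s': "t0 < s'" "s' \<le> s" for s'
            by (rule notB, rule left) (use s' True s t0 p0 in auto)
        qed (use True s t0 p0 in auto)
        then show ?thesis by simp
      next
        case False
        have "mass s \<le> real n" by (rule right[OF p(1)]) (use s False r in auto)
        then show ?thesis by simp
      qed
    qed (use t0 r in auto)
    then show False using p(1) by (simp add: B_def)
  qed
  then have g: "good s" if "0 < s" "s \<le> T" for s using notB that by auto
  obtain n1 where n1: "\<And>s. d / 2 \<le> s \<Longrightarrow> s \<le> T \<Longrightarrow> mass s \<le> n1"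
    using good_compact[of "d/2" T] d g by (metis half_gt_zero less_le_trans order_refl)
  show thesis
  proof (rule that[of "max n0 n1"])
    fix s assume s: "0 < s" "s \<le> T"
    show "mass s \<le> max n0 n1"
      using near[of s] n1[of s] s d by (cases "s < d") (auto simp: le_max_iff_disj)
  qed
qed

end

section \<open>Gaussian energy\<close>

text \<open>\<open>r\<^sup>2/s\<close> solves the Hamilton--Jacobi equation
  \<open>h\<^sub>t + \<nu> \<bar>\<nabla>h\<bar>\<^sup>2 = 0\<close> for \<open>s = \<lambda>(t)\<^sup>2\<close>; the truncation
  \<open>trunc n s\<close>, which is bounded by \<open>n\<close>, remains a subsolution.\<close>

definition trunc :: "real \<Rightarrow> real \<Rightarrow> real \<Rightarrow> real" where "trunc n s y = n * y / (n * s + y)"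

lemma trunc_bounds:
  assumes "n > 0" "s > 0" "y \<ge> 0"
  shows "0 \<le> trunc n s y" "trunc n s y \<le> n" "trunc n s y \<le> y / s"
proof -
  have p: "n * s + y > 0" using assms by (simp add: add_pos_nonneg)
  show "0 \<le> trunc n s y" using assms p by (simp add: trunc_def)
  have "n * y \<le> n * (n * s + y)" using assms by (intro mult_left_mono) auto
  then show "trunc n s y \<le> n" using p by (simp add: trunc_def pos_divide_le_eq)
  have "n * y / (n * s + y) \<le> n * y / (n * s)" using assms p by (intro divide_left_mono) auto
  then show "trunc n s y \<le> y / s" using assms by (simp add: trunc_def)
qed

lemma trunc_tendsto:
  assumes "s > 0" "y \<ge> 0"
  shows "(\<lambda>n. trunc (real (Suc n)) s y) \<longlonglongrightarrow> y / s"
proof -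
  have "(\<lambda>n. y / (s + y * inverse (real (Suc n)))) \<longlonglongrightarrow> y / (s + y * 0)"
    using assms by (intro tendsto_intros LIMSEQ_inverse_real_of_nat) auto
  moreover have "y / (s + y * inverse (real (Suc n))) = trunc (real (Suc n)) s y" for n
    by (simp add: trunc_def field_simps)
  ultimately show ?thesis by simp
qed

lemma DERIV_trunc:
  assumes "n > 0" "s > 0" "y \<ge> 0"
  shows "(trunc n s has_real_derivative n\<^sup>2 * s / (n * s + y)\<^sup>2) (at y)"
    "((\<lambda>s. trunc n s y) has_real_derivative - n\<^sup>2 * y / (n * s + y)\<^sup>2) (at s)"
proof -
  have p: "n * s + y > 0" using assms by (simp add: add_pos_nonneg)
  then have ne: "n * s + y \<noteq> 0" by simp
  have "((\<lambda>y. n * y / (n * s + y)) has_real_derivative (n * (n * s + y) - n * y * 1) / ((n * s + y) * (n * s + y))) (at y)"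
    using ne by (intro DERIV_divide) (auto intro!: derivative_eq_intros)
  then show "(trunc n s has_real_derivative n\<^sup>2 * s / (n * s + y)\<^sup>2) (at y)"
    unfolding trunc_def[abs_def] by (simp add: power2_eq_square algebra_simps)
  have "((\<lambda>s. n * y / (n * s + y)) has_real_derivative (0 * (n * s + y) - n * y * n) / ((n * s + y) * (n * s + y))) (at s)"
    using ne by (intro DERIV_divide) (auto intro!: derivative_eq_intros)
  then show "((\<lambda>s. trunc n s y) has_real_derivative - n\<^sup>2 * y / (n * s + y)\<^sup>2) (at s)"
    unfolding trunc_def by (simp add: power2_eq_square algebra_simps)
qed

lemma gronwall_linear:
  fixes J :: "real \<Rightarrow> real"
  assumes at: "0 < a" "a \<le> t" and c: "c \<ge> 0" and k: "k \<ge> 0" and J0: "J a \<ge> 0"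
    and d: "\<And>s. a \<le> s \<Longrightarrow> s \<le> t \<Longrightarrow> \<exists>D. (J has_real_derivative D) (at s) \<and> D \<le> c * J s + k"
  shows "J t \<le> exp (c * t) * (J a + t * k)"
proof (cases "a = t")
  case True
  have "J a * 1 \<le> J a * exp (c * t)" using J0 c at by (intro mult_left_mono) auto
  moreover have "0 \<le> exp (c * t) * (t * k)" using at k by simp
  ultimately show ?thesis using True by (simp add: algebra_simps)
next
  case False
  then have lt: "a < t" using at by simp
  obtain D where D: "\<And>s. a \<le> s \<Longrightarrow> s \<le> t \<Longrightarrow> (J has_real_derivative D s) (at s)" "\<And>s. a \<le> s \<Longrightarrow> s \<le> t \<Longrightarrow> D s \<le> c * J s + k"
    using d by metis
  define G where "G = (\<lambda>s. exp (- c * s) * J s)"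
  define G' where "G' = (\<lambda>s. exp (- c * s) * (D s - c * J s))"
  have "(G has_real_derivative G' s) (at s)" if "a \<le> s" "s \<le> t" for s
    unfolding G_def G'_def using D(1)[OF that] by (auto intro!: derivative_eq_intros simp: algebra_simps)
  then obtain z where z: "a < z" "z < t" "G t - G a = (t - a) * G' z"
    using MVT2[OF lt, of G G'] by blast
  have "G' z \<le> exp (- c * z) * k" unfolding G'_def using D(2)[of z] z by (intro mult_left_mono) auto
  also have "\<dots> \<le> 1 * k" using c z at k by (intro mult_right_mono) auto
  finally have "(t - a) * G' z \<le> (t - a) * k" using lt by (intro mult_left_mono) auto
  also have "\<dots> \<le> t * k" using at k by (intro mult_right_mono) auto
  finally have "G t \<le> G a + t * k" using z by linarith
  also have "G a \<le> 1 * J a" unfolding G_def using J0 c at by (intro mult_right_mono) auto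
  finally have "exp (c * t) * G t \<le> exp (c * t) * (J a + t * k)" by (intro mult_left_mono) auto
  then show ?thesis by (simp add: G_def exp_minus field_simps)
qed

text \<open>\<open>s\<close> stands for lambda(t)^2, \<open>n\<close> bounds the exponent and
  \<open>L\<close> is the cutoff radius. Compact support permits integration by parts, and the bound
  exp n permits comparison in plain L2.\<close>

definition gauss_weight :: "real \<Rightarrow> real \<Rightarrow> real \<Rightarrow> real^2 \<Rightarrow> real" where
  "gauss_weight n L s x = exp (trunc n s ((norm x)\<^sup>2)) * cutoff L ((norm x)\<^sup>2)"

definition gauss_weight1 :: "real \<Rightarrow> real \<Rightarrow> real \<Rightarrow> 2 \<Rightarrow> real^2 \<Rightarrow> real" where
  "gauss_weight1 n L s i x = exp (trunc n s ((norm x)\<^sup>2)) * (n\<^sup>2 * s / (n * s + (norm x)\<^sup>2)\<^sup>2 * cutoff L ((norm x)\<^sup>2)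
      + cutoff1 L ((norm x)\<^sup>2)) * (2 * x $ i)"

lemma gauss_weight_bounds:
  assumes "n > 0" "s > 0" "L > 0"
  shows "0 \<le> gauss_weight n L s x" "gauss_weight n L s x \<le> exp (trunc n s ((norm x)\<^sup>2))"
    "gauss_weight n L s x \<le> exp n"
proof -
  note cb = cutoff_bounds[OF assms(3), of "(norm x)\<^sup>2"]
  show "0 \<le> gauss_weight n L s x" using cb by (simp add: gauss_weight_def)
  show 1: "gauss_weight n L s x \<le> exp (trunc n s ((norm x)\<^sup>2))"
    using cb mult_left_mono[OF cb(2), of "exp (trunc n s ((norm x)\<^sup>2))"] by (simp add: gauss_weight_def)
  have "exp (trunc n s ((norm x)\<^sup>2)) \<le> exp n" using trunc_bounds(2)[OF assms(1,2)] by simp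
  then show "gauss_weight n L s x \<le> exp n" using 1 by linarith
qed

lemma C1_gauss_weight:
  assumes "n > 0" "s > 0"
  shows "C1_fun (gauss_weight n L s) (gauss_weight1 n L s)"
proof -
  have ne: "n * s + y \<noteq> 0" if "y \<ge> 0" for y using assms that by (smt (verit) mult_pos_pos)
  let ?b = "\<lambda>y. exp (trunc n s y) * cutoff L y"
  let ?b' = "\<lambda>y. exp (trunc n s y) * (n\<^sup>2 * s / (n * s + y)\<^sup>2 * cutoff L y + cutoff1 L y)"
  have "C1_fun (\<lambda>x. ?b ((norm x)\<^sup>2)) (\<lambda>i x. ?b' ((norm x)\<^sup>2) * (2 * x $ i))"
  proof (rule C1_fun_radial)
    show "(?b has_real_derivative ?b' y) (at y)" if "y \<ge> 0" for y
      using DERIV_mult[OF DERIV_fun_exp[OF DERIV_trunc(1)[OF assms that]] DERIV_cutoff[of L y]]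
      by (simp add: algebra_simps)
    show "continuous_on {0..} ?b'"
      unfolding trunc_def by (intro continuous_intros continuous_on_cutoff) (auto simp: ne)
  qed
  then show ?thesis unfolding gauss_weight_def[abs_def] gauss_weight1_def[abs_def] .
qed

text \<open>Supplies \<open>rho\<close> and \<open>E\<close> of
  \<open>square_weighted_derivative\<close> at one point, where (u1, u2) is the velocity. For the
  exponent H = \<open>trunc n s\<close> the time derivative yields at least -nu |grad H|^2. Three
  quarters of this absorb (nu/2) rho, one quarter absorbs the drift and leaves 4 U^2 / nu; terms
  with a differentiated cutoff are O(exp n / L).\<close>

lemma gauss_weight_subsolution:
  fixes x :: "real^2"
  assumes n: "n > 0" and s: "s > 0" and L: "L \<ge> 1" and nu: "nu > 0" and U: "\<bar>u1\<bar> \<le> U" "\<bar>u2\<bar> \<le> U"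
  obtains rho where "rho \<ge> 0"
    "(gauss_weight1 n L s 1 x)\<^sup>2 + (gauss_weight1 n L s 2 x)\<^sup>2 \<le> gauss_weight n L s x * rho"
    "exp (trunc n s ((norm x)\<^sup>2)) * (- n\<^sup>2 * (norm x)\<^sup>2 / (n * s + (norm x)\<^sup>2)\<^sup>2 * (4 * nu)) * cutoff L ((norm x)\<^sup>2)
       + (u1 * gauss_weight1 n L s 1 x + u2 * gauss_weight1 n L s 2 x) + nu / 2 * rho
     \<le> 4 * U\<^sup>2 / nu * gauss_weight n L s x + exp n * (12 * U + 54 * nu) / L"
proof -
  define N where "N = (norm x)\<^sup>2"
  define r where "r = norm x"
  define m where "m = max 0 (1 - N / L\<^sup>2)"
  define e where "e = exp (trunc n s N)"
  \<comment> \<open>The derivative of \<open>trunc n s\<close> with respect to |x|^2; the gradient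
    of the exponent is 2 h x, with square 4 N h^2.\<close>
  define h where "h = n\<^sup>2 * s / (n * s + N)\<^sup>2"
  have L0: "L > 0" using L by simp
  have U0: "U \<ge> 0" using U by linarith
  have N: "N \<ge> 0" "N = r\<^sup>2" "r \<ge> 0" by (auto simp: N_def r_def)
  have p: "n * s + N > 0" using n s N by (simp add: add_pos_nonneg)
  have e: "e > 0" "e \<le> exp n" using trunc_bounds(2)[OF n s N(1)] by (auto simp: e_def)
  have h: "h \<ge> 0" using n s p by (simp add: h_def)
  have m: "0 \<le> m" "m \<le> 1" using N L0 by (auto simp: m_def)
  have rm: "r * m \<le> L" "N * m \<le> L\<^sup>2"
  proof -
    show Nm: "N * m \<le> L\<^sup>2"
    proof (cases "N \<le> L\<^sup>2")
      case True
      have "N * m \<le> N * 1" using N m by (intro mult_left_mono) auto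
      then show ?thesis using True by simp
    next
      case False then show ?thesis using L0 by (simp add: m_def max_def field_simps)
    qed
    show "r * m \<le> L"
    proof (cases "r \<le> L")
      case True
      have "r * m \<le> r * 1" using N m by (intro mult_left_mono) auto
      then show ?thesis using True by simp
    next
      case False
      then have "L\<^sup>2 \<le> N" unfolding N(2) using L0 by (intro power_mono) auto
      then show ?thesis using L0 by (simp add: m_def max_def field_simps)
    qed
  qed
  have cut: "cutoff L N = m^3" "cutoff1 L N = - 3 / L\<^sup>2 * m\<^sup>2" by (simp_all add: cutoff_def cutoff1_def m_def)
  have w: "gauss_weight n L s x = e * m^3"
    unfolding gauss_weight_def N_def[symmetric] e_def[symmetric] cut ..
  have w1: "gauss_weight1 n L s i x = e * m\<^sup>2 * (h * m - 3 / L\<^sup>2) * (2 * x $ i)" for i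
    unfolding gauss_weight1_def N_def[symmetric] e_def[symmetric] h_def[symmetric] cut
    by (simp add: power2_eq_square power3_eq_cube algebra_simps)
  \<comment> \<open>The exact value of |grad p|^2 / p, written without division: the cube in the
    cutoff leaves one factor m.\<close>
  define rho where "rho = e * (4 * N) * m * (h * m - 3 / L\<^sup>2)\<^sup>2"
  have "rho \<ge> 0" using e N m by (simp add: rho_def)
  moreover have "(gauss_weight1 n L s 1 x)\<^sup>2 + (gauss_weight1 n L s 2 x)\<^sup>2 = gauss_weight n L s x * rho"
  proof -
    have 1: "(c * (2 * y))\<^sup>2 + (c * (2 * z))\<^sup>2 = c\<^sup>2 * (4 * (y\<^sup>2 + z\<^sup>2))" for c y z :: real
      by (simp add: power2_eq_square algebra_simps)
    have 2: "(e * m\<^sup>2 * q)\<^sup>2 * (4 * N) = e * m^3 * (e * (4 * N) * m * q\<^sup>2)" for q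
      by (simp add: power2_eq_square power3_eq_cube)
    have "(x $ 1)\<^sup>2 + (x $ 2)\<^sup>2 = N" by (simp add: N_def norm_sq_2)
    then show ?thesis unfolding w w1 rho_def 1 by (simp only: 2)
  qed
  moreover have "e * (- n\<^sup>2 * N / (n * s + N)\<^sup>2 * (4 * nu)) * m^3
       + (u1 * gauss_weight1 n L s 1 x + u2 * gauss_weight1 n L s 2 x) + nu / 2 * rho
     \<le> 4 * U\<^sup>2 / nu * (e * m^3) + exp n * (12 * U + 54 * nu) / L"
  proof -
    have rho_le: "nu / 2 * rho \<le> e * (3 * nu * N * h\<^sup>2 * m^3) + e * (54 * nu / L\<^sup>2)"
    proof -
      \<comment> \<open>The factor 3/2 turns the 2 nu N h^2 of this term into 3 nu N h^2, which
        leaves nu N h^2 of the budget 4 nu N h^2 for the drift.\<close>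
      have young: "(a - b)\<^sup>2 \<le> 3 / 2 * a\<^sup>2 + 3 * b\<^sup>2" for a b :: real
        using zero_le_power2[of "a + 2 * b"] by (simp add: power2_eq_square algebra_simps)
      have "(h * m - 3 / L\<^sup>2)\<^sup>2 \<le> 3 / 2 * (h * m)\<^sup>2 + 3 * (3 / L\<^sup>2)\<^sup>2" by (rule young)
      then have "e * (4 * N) * m * (h * m - 3 / L\<^sup>2)\<^sup>2 \<le> e * (4 * N) * m * (3 / 2 * (h * m)\<^sup>2 + 3 * (3 / L\<^sup>2)\<^sup>2)"
        using e N m by (intro mult_left_mono) auto
      then have "nu / 2 * rho \<le> nu / 2 * (e * (4 * N) * m * (3 / 2 * (h * m)\<^sup>2 + 3 * (3 / L\<^sup>2)\<^sup>2))"
        unfolding rho_def by (rule mult_left_mono) (use nu in simp)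
      also have "\<dots> = e * (3 * nu * N * h\<^sup>2 * m^3) + e * (54 * nu * (N * m) / (L\<^sup>2)\<^sup>2)"
        by (simp add: power2_eq_square power3_eq_cube algebra_simps)
      also have "e * (54 * nu * (N * m) / (L\<^sup>2)\<^sup>2) \<le> e * (54 * nu * L\<^sup>2 / (L\<^sup>2)\<^sup>2)"
        using e nu rm L0 by (intro mult_left_mono divide_right_mono) auto
      also have "54 * nu * L\<^sup>2 / (L\<^sup>2)\<^sup>2 = 54 * nu / L\<^sup>2" using L0 by (simp add: power2_eq_square)
      finally show ?thesis by simp
    qed
    have ux: "\<bar>u1 * x $ 1 + u2 * x $ 2\<bar> \<le> 2 * U * r"
    proof -
      have "\<bar>u1 * x $ 1\<bar> \<le> U * r" "\<bar>u2 * x $ 2\<bar> \<le> U * r"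
        unfolding abs_mult r_def using U U0 component_le_norm_cart by (auto intro!: mult_mono)
      then show ?thesis by linarith
    qed
    have up: "u1 * gauss_weight1 n L s 1 x + u2 * gauss_weight1 n L s 2 x \<le> e * m^3 * (4 * U * r * h) + e * (12 * U / L)"
    proof -
      have "u1 * gauss_weight1 n L s 1 x + u2 * gauss_weight1 n L s 2 x = (e * m\<^sup>2 * 2 * (u1 * x $ 1 + u2 * x $ 2)) * (h * m - 3 / L\<^sup>2)"
        unfolding w1 by (simp add: algebra_simps)
      also have "\<dots> \<le> \<bar>e * m\<^sup>2 * 2 * (u1 * x $ 1 + u2 * x $ 2)\<bar> * \<bar>h * m - 3 / L\<^sup>2\<bar>"
        unfolding abs_mult[symmetric] by (rule abs_ge_self)
      also have "\<dots> \<le> (e * m\<^sup>2 * 2 * (2 * U * r)) * (h * m + 3 / L\<^sup>2)"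
      proof (intro mult_mono)
        show "\<bar>e * m\<^sup>2 * 2 * (u1 * x $ 1 + u2 * x $ 2)\<bar> \<le> e * m\<^sup>2 * 2 * (2 * U * r)"
          unfolding abs_mult using e m ux by (intro mult_mono) auto
        show "\<bar>h * m - 3 / L\<^sup>2\<bar> \<le> h * m + 3 / L\<^sup>2"
          using h m L0 by (intro order_trans[OF abs_triangle_ineq4]) (auto simp: abs_mult)
      qed (use e m U0 N in auto)
      also have "\<dots> = e * m^3 * (4 * U * r * h) + e * (12 * U * (r * m) * m / L\<^sup>2)"
        by (simp add: power2_eq_square power3_eq_cube algebra_simps)
      also have "e * (12 * U * (r * m) * m / L\<^sup>2) \<le> e * (12 * U * L * 1 / L\<^sup>2)"
        using e U0 rm m N L0 by (intro mult_left_mono divide_right_mono mult_mono) auto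
      also have "12 * U * L * 1 / L\<^sup>2 = 12 * U / L" using L0 by (simp add: power2_eq_square)
      finally show ?thesis by simp
    qed
    have am: "4 * U * r * h \<le> nu * N * h\<^sup>2 + 4 * U\<^sup>2 / nu"
    proof -
      have "0 \<le> (nu * r * h - 2 * U)\<^sup>2 / nu" using nu by simp
      also have "(nu * r * h - 2 * U)\<^sup>2 / nu = nu * N * h\<^sup>2 + 4 * U\<^sup>2 / nu - 4 * U * r * h"
        using nu unfolding N(2) by (simp add: field_simps power2_eq_square)
      finally show ?thesis by simp
    qed
    \<comment> \<open>The Hamilton--Jacobi inequality for the truncation: the two sides differ by
      the factor (n s / (n s + N))^2 <= 1.\<close>
    have hj: "4 * nu * N * h\<^sup>2 \<le> n\<^sup>2 * N / (n * s + N)\<^sup>2 * (4 * nu)"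
    proof -
      have "n * s \<le> n * s + N" using N by simp
      then have q: "(n * s / (n * s + N))\<^sup>2 \<le> 1" using p n s by (intro power_le_one) auto
      have "h\<^sup>2 = n\<^sup>2 / (n * s + N)\<^sup>2 * (n * s / (n * s + N))\<^sup>2"
        using p by (simp add: h_def power2_eq_square)
      also have "\<dots> \<le> n\<^sup>2 / (n * s + N)\<^sup>2 * 1" using q by (intro mult_left_mono) auto
      finally have "4 * nu * N * h\<^sup>2 \<le> 4 * nu * N * (n\<^sup>2 / (n * s + N)\<^sup>2)"
        using nu N by (intro mult_left_mono) auto
      then show ?thesis by (simp add: mult.commute mult.left_commute)
    qed
    define Q where "Q = n\<^sup>2 * N / (n * s + N)\<^sup>2 * (4 * nu)"
    have em: "e * m^3 \<ge> 0" using e m by simp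
    have "- n\<^sup>2 * N / (n * s + N)\<^sup>2 * (4 * nu) = - Q" by (simp add: Q_def)
    moreover have "e * (- Q) * m^3 + (e * m^3 * (4 * U * r * h) + e * (12 * U / L)) + (e * (3 * nu * N * h\<^sup>2 * m^3) + e * (54 * nu / L\<^sup>2))
      \<le> 4 * U\<^sup>2 / nu * (e * m^3) + exp n * (12 * U + 54 * nu) / L"
    proof -
      have "e * (- Q) * m^3 + e * m^3 * (4 * U * r * h) + e * (3 * nu * N * h\<^sup>2 * m^3)
        = e * m^3 * (- Q + 4 * U * r * h + 3 * nu * N * h\<^sup>2)" by (simp add: algebra_simps)
      also have "\<dots> \<le> e * m^3 * (4 * U\<^sup>2 / nu)"
        using am hj[folded Q_def] by (intro mult_left_mono em) linarith
      finally have 1: "e * (- Q) * m^3 + e * m^3 * (4 * U * r * h) + e * (3 * nu * N * h\<^sup>2 * m^3) \<le> 4 * U\<^sup>2 / nu * (e * m^3)"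
        by (simp add: mult.commute)
      have "54 * nu / L\<^sup>2 \<le> 54 * nu / L"
        using nu L by (intro divide_left_mono) (auto simp: power2_eq_square)
      then have "e * (54 * nu / L\<^sup>2) \<le> e * (54 * nu / L)"
        by (rule mult_left_mono) (use e in simp)
      then have "e * (12 * U / L) + e * (54 * nu / L\<^sup>2) \<le> e * (12 * U / L) + e * (54 * nu / L)"
        by (rule add_left_mono)
      also have "\<dots> = e * ((12 * U + 54 * nu) / L)"
        by (simp add: add_divide_distrib distrib_left)
      also have "\<dots> \<le> exp n * ((12 * U + 54 * nu) / L)"
        using e U0 nu L0 by (intro mult_right_mono) auto
      finally have 2: "e * (12 * U / L) + e * (54 * nu / L\<^sup>2) \<le> exp n * (12 * U + 54 * nu) / L" by simp
      show ?thesis using 1 2 by linarith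
    qed
    ultimately show ?thesis using rho_le up by (simp only:)
  qed
  ultimately show thesis
    using that[of rho] unfolding w N_def[symmetric] e_def[symmetric] cut(1) by simp
qed

text \<open>The cutoff error multiplies the unweighted norm W and carries 1 / L, so it can be made
  small at fixed n although it contains exp n.\<close>

lemma (in advection) weighted_energy:
  assumes U: "\<And>i x t. 0 < t \<Longrightarrow> t \<le> T \<Longrightarrow> \<bar>u i x t\<bar> \<le> U"
    and f2: "\<And>t. 0 < t \<Longrightarrow> t \<le> T \<Longrightarrow> integrable lborel (\<lambda>x. (f x t)\<^sup>2)"
    and W: "\<And>t. 0 < t \<Longrightarrow> t \<le> T \<Longrightarrow> (LINT x|lborel. (f x t)\<^sup>2) \<le> W"
    and n: "n > 0" and L: "L \<ge> 1" and l0: "l0 > 0" and t: "0 < a" "a \<le> t" "t \<le> T"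
  shows "(LINT x|lborel. gauss_weight n L (l0\<^sup>2 + 4 * nu * t) x * (f x t)\<^sup>2)
    \<le> exp (4 * U\<^sup>2 / nu * t) * ((LINT x|lborel. gauss_weight n L (l0\<^sup>2 + 4 * nu * a) x * (f x a)\<^sup>2)
        + t * (exp n * (12 * U + 54 * nu) / L * W))"
proof -
  have U0: "U \<ge> 0" using U[of a 1 0] t by simp
  have "0 \<le> (LINT x|lborel. (f x a)\<^sup>2)" by (rule integral_nonneg_AE) simp
  then have W0: "W \<ge> 0" using W[of a] t by linarith
  have L0: "L > 0" using L by simp
  define s where "s = (\<lambda>t. l0\<^sup>2 + 4 * nu * t)"
  have s: "s t > 0" if "t > 0" for t using l0 nu that by (simp add: s_def add_pos_pos)
  define p where "p = (\<lambda>x t. gauss_weight n L (s t) x)"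
  define pt where "pt = (\<lambda>(x::real^2) t. exp (trunc n (s t) ((norm x)\<^sup>2)) * (- n\<^sup>2 * (norm x)\<^sup>2 / (n * s t + (norm x)\<^sup>2)\<^sup>2 * (4 * nu)) * cutoff L ((norm x)\<^sup>2))"
  define k where "k = exp n * (12 * U + 54 * nu) / L"
  have k: "k \<ge> 0" using U0 nu L0 by (simp add: k_def)
  define J where "J = (\<lambda>t. LINT x|lborel. p x t * (f x t)\<^sup>2)"
  have p_cont: "continuous_on UNIV (\<lambda>x. p x t)" if "t > 0" for t
    unfolding p_def using C1_funD(2)[OF C1_gauss_weight[OF n s[OF that]]] .
  have p_out: "p x t = 0" if "norm x > L" for x t
    using cutoff_outside(1)[OF L0, of "(norm x)\<^sup>2"] that L0 by (simp add: p_def gauss_weight_def power_mono)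
  have ip: "integrable lborel (\<lambda>x. p x t * (f x t)\<^sup>2)" if "t > 0" for t
  proof (rule integrable_compact_support[of _ L])
    show "continuous_on UNIV (\<lambda>x. p x t * (f x t)\<^sup>2)"
      by (intro continuous_on_mult continuous_on_power p_cont[OF that] C21_D(4)[OF C21 that])
    show "p x t * (f x t)\<^sup>2 = 0" if "norm x > L" for x using p_out[OF that] by simp
  qed
  have ne: "n * s (snd q) + (norm (fst q))\<^sup>2 \<noteq> 0" if "q \<in> UNIV \<times> {0<..}" for q :: "(real^2) \<times> real"
  proof -
    have "snd q > 0" using that by auto
    then have "n * s (snd q) > 0" by (intro mult_pos_pos n s)
    then show ?thesis using zero_le_power2[of "norm (fst q)"] by linarith
  qed
  have cs: "continuous_on (UNIV \<times> {0<..}) (\<lambda>q::(real^2) \<times> real. s (snd q))"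
    unfolding s_def by (intro continuous_intros)
  have ctr: "continuous_on (UNIV \<times> {0<..}) (\<lambda>q::(real^2) \<times> real. trunc n (s (snd q)) ((norm (fst q))\<^sup>2))"
    unfolding trunc_def by (intro continuous_intros cs) (use ne in auto)
  have ccut: "continuous_on (UNIV \<times> {0<..}) (\<lambda>q::(real^2) \<times> real. cutoff L ((norm (fst q))\<^sup>2))"
    by (rule continuous_on_compose2[where g="cutoff L" and t=UNIV, OF continuous_on_cutoff(1)]) (intro continuous_intros, simp)
  have dJ: "\<exists>D. (J has_real_derivative D) (at t) \<and> D \<le> 4 * U\<^sup>2 / nu * J t + k * W" if t: "0 < t" "t \<le> T" for t
  proof -
    have "\<exists>rho. rho \<ge> 0 \<and> (gauss_weight1 n L (s t) 1 x)\<^sup>2 + (gauss_weight1 n L (s t) 2 x)\<^sup>2 \<le> p x t * rho \<and>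
      pt x t + (u 1 x t * gauss_weight1 n L (s t) 1 x + u 2 x t * gauss_weight1 n L (s t) 2 x) + nu / 2 * rho
        \<le> 4 * U\<^sup>2 / nu * p x t + k" for x
      using gauss_weight_subsolution[OF n s[OF t(1)] L nu U[OF t, of 1 x] U[OF t, of 2 x], of x]
      unfolding p_def pt_def k_def by blast
    then obtain rho where rho: "\<And>x. rho x \<ge> 0"
      "\<And>x. (gauss_weight1 n L (s t) 1 x)\<^sup>2 + (gauss_weight1 n L (s t) 2 x)\<^sup>2 \<le> p x t * rho x"
      "\<And>x. pt x t + (u 1 x t * gauss_weight1 n L (s t) 1 x + u 2 x t * gauss_weight1 n L (s t) 2 x) + nu / 2 * rho x
        \<le> 4 * U\<^sup>2 / nu * p x t + k" by metis
    have split: "(f x t)\<^sup>2 * (4 * U\<^sup>2 / nu * p x t + k) = 4 * U\<^sup>2 / nu * (p x t * (f x t)\<^sup>2) + k * (f x t)\<^sup>2" for x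
      by (simp add: algebra_simps)
    have iE: "integrable lborel (\<lambda>x. (f x t)\<^sup>2 * (4 * U\<^sup>2 / nu * p x t + k))"
      unfolding split using ip[OF t(1)] f2[OF t] by (intro Bochner_Integration.integrable_add integrable_mult_right)
    obtain D where D: "(J has_real_derivative D) (at t)" "D \<le> (LINT x|lborel. (f x t)\<^sup>2 * (4 * U\<^sup>2 / nu * p x t + k))"
    proof (rule square_weighted_derivative[where p=p and p'="\<lambda>i x t. gauss_weight1 n L (s t) i x" and pt=pt and r=L and rho=rho
          and E="\<lambda>x. 4 * U\<^sup>2 / nu * p x t + k" and t=t])
      show "C1_fun (\<lambda>x. p x t) (\<lambda>i x. gauss_weight1 n L (s t) i x)" if "t > 0" for t
        unfolding p_def by (rule C1_gauss_weight[OF n s[OF that]])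
      show "((\<lambda>t. p x t) has_real_derivative pt x t) (at t)" if t: "t > 0" for x t
      proof -
        have "(s has_real_derivative 4 * nu) (at t)" unfolding s_def by (auto intro!: derivative_eq_intros)
        from DERIV_chain2[OF DERIV_trunc(2)[OF n s[OF t], of "(norm x)\<^sup>2"] this]
        have "((\<lambda>t. trunc n (s t) ((norm x)\<^sup>2)) has_real_derivative - n\<^sup>2 * (norm x)\<^sup>2 / (n * s t + (norm x)\<^sup>2)\<^sup>2 * (4 * nu)) (at t)" by simp
        from DERIV_cmult_right[OF DERIV_fun_exp[OF this], of "cutoff L ((norm x)\<^sup>2)"]
        show ?thesis unfolding p_def pt_def gauss_weight_def .
      qed
      show "continuous_on (UNIV \<times> {0<..}) (\<lambda>q. p (fst q) (snd q))"
        unfolding p_def gauss_weight_def by (intro continuous_intros ctr ccut)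
      show "continuous_on (UNIV \<times> {0<..}) (\<lambda>q. pt (fst q) (snd q))"
        unfolding pt_def by (intro continuous_intros ctr ccut cs) (use ne in auto)
      show "p x t \<ge> 0" for x unfolding p_def by (rule gauss_weight_bounds[OF n s[OF t(1)] L0])
    qed (use p_out t rho iE in \<open>auto simp: J_def\<close>)
    note D(2)
    also have "(LINT x|lborel. (f x t)\<^sup>2 * (4 * U\<^sup>2 / nu * p x t + k)) = 4 * U\<^sup>2 / nu * J t + k * (LINT x|lborel. (f x t)\<^sup>2)"
      unfolding split J_def using ip[OF t(1)] f2[OF t] by simp
    also have "\<dots> \<le> 4 * U\<^sup>2 / nu * J t + k * W" using W[OF t] k by (intro add_left_mono mult_left_mono) auto
    finally show ?thesis using D(1) by blast
  qed
  have "J t \<le> exp (4 * U\<^sup>2 / nu * t) * (J a + t * (k * W))"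
  proof (rule gronwall_linear)
    have "p x a \<ge> 0" for x unfolding p_def using gauss_weight_bounds(1)[OF n s[OF t(1)] L0] .
    then show "J a \<ge> 0" unfolding J_def by (intro integral_nonneg_AE) auto
    show "\<exists>D. (J has_real_derivative D) (at s) \<and> D \<le> 4 * U\<^sup>2 / nu * J s + k * W" if "a \<le> s" "s \<le> t" for s
      by (rule dJ) (use that t in auto)
  qed (use t nu k W0 in auto)
  then show ?thesis unfolding J_def p_def s_def k_def .
qed

text \<open>The inequality exp y >= (1 + y)^2 / 2 puts the Gaussian below a multiple of the
  integrable \<open>curl_kernel l\<close>.\<close>

lemma integrable_gaussian:
  assumes l: "l > 0" shows "integrable lborel (\<lambda>x::real^2. exp (- ((norm x)\<^sup>2 / l\<^sup>2)))"
proof (rule Bochner_Integration.integrable_bound)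
  show "integrable lborel (\<lambda>x. 2 * pi * l\<^sup>2 * curl_kernel l x)"
    using integrable_curl_kernel[OF l] by (intro integrable_mult_right)
  have "exp (- ((norm x)\<^sup>2 / l\<^sup>2)) \<le> 2 * pi * l\<^sup>2 * curl_kernel l x" for x :: "real^2"
  proof -
    define y where "y = (norm x)\<^sup>2 / l\<^sup>2"
    have y: "y \<ge> 0" by (simp add: y_def)
    have "(1 + y)\<^sup>2 / 2 \<le> 1 + y + y\<^sup>2 / 2" using y by (simp add: power2_eq_square field_simps)
    also have "\<dots> \<le> exp y" by (rule exp_lower_Taylor_quadratic[OF y])
    finally have "inverse (exp y) \<le> inverse ((1 + y)\<^sup>2 / 2)"
      by (rule le_imp_inverse_le) (use y in simp)
    then have "exp (- y) \<le> 1 / ((1 + y)\<^sup>2 / 2)"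
      by (simp add: exp_minus inverse_eq_divide)
    also have "1 + y = ((norm x)\<^sup>2 + l\<^sup>2) / l\<^sup>2" using l by (simp add: y_def field_simps)
    also have "1 / ((((norm x)\<^sup>2 + l\<^sup>2) / l\<^sup>2)\<^sup>2 / 2) = 2 * pi * l\<^sup>2 * curl_kernel l x"
      using l by (simp add: curl_kernel_def power_divide power2_eq_square[of "l\<^sup>2"])
    finally show ?thesis by (simp add: y_def)
  qed
  then show "AE x::real^2 in lborel. norm (exp (- ((norm x)\<^sup>2 / l\<^sup>2))) \<le> norm (2 * pi * l\<^sup>2 * curl_kernel l x)"
    by (auto intro: order_trans[OF _ abs_ge_self])
qed simp

section \<open>Link to the given velocity, initial data, and removal of the truncations\<close>

lemma (in bounded_vorticity) biot_savart_nth: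
  assumes "\<And>y. f y t = om y"
  shows "biot_savart f x t $ i = bs_reg 0 om i x"
proof -
  let ?g = "\<lambda>i y. om y * bs_kernel 0 i (x - y)"
  have ig: "integrable lebesgue (?g i)" for i
    using bs_integrable[of 0 i x] by (subst integrable_completion) auto
  have eg: "integral\<^sup>L lebesgue (?g i) = bs_reg 0 om i x" for i
    unfolding bs_reg_def by (rule integral_completion) simp
  have "(f y t / (2 * pi * (norm (x - y))\<^sup>2)) *\<^sub>R perp (x - y) = ?g 1 y *\<^sub>R axis 1 1 + ?g 2 y *\<^sub>R axis 2 1" for y
    unfolding vec_eq_iff forall_2 assms bs_kernel_def by (simp add: axis_def)
  then have "biot_savart f x t = (LINT y|lebesgue. ?g 1 y *\<^sub>R axis 1 1 + ?g 2 y *\<^sub>R axis 2 1)"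
    unfolding biot_savart_def by simp
  also have "\<dots> = bs_reg 0 om 1 x *\<^sub>R axis 1 1 + bs_reg 0 om 2 x *\<^sub>R axis 2 1"
    using ig by (simp add: eg)
  finally show ?thesis using exhaust_2[of i] by (auto simp: axis_def)
qed

lemma inner_real2: "(a::real^2) \<bullet> b = a $ 1 * b $ 1 + a $ 2 * b $ 2"
  by (simp add: inner_vec_def sum_2)

lemma gauss_weight_tendsto:
  assumes s: "s > 0" and L: "\<And>n. L n \<ge> real (Suc n)"
  shows "(\<lambda>n. gauss_weight (real (Suc n)) (L n) s x) \<longlonglongrightarrow> exp ((norm x)\<^sup>2 / s)"
proof -
  have "(\<lambda>n. cutoff (L n) ((norm x)\<^sup>2)) \<longlonglongrightarrow> 1" by (rule cutoff_tendsto[OF L]) simp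
  from tendsto_mult[OF tendsto_exp[OF trunc_tendsto[OF s, of "(norm x)\<^sup>2"]] this]
  show ?thesis by (simp add: gauss_weight_def)
qed

lemma divide_Phi:
  assumes "l \<noteq> 0" shows "y / Phi l x = (pi * l\<^sup>2) * (exp ((norm x)\<^sup>2 / l\<^sup>2) * y)"
  using assms by (simp add: Phi_def exp_minus field_simps)

text \<open>Integrability of w follows from |w| <= h w^2 + 1 / h with h the Gaussian weight. Summed
  over the components, it makes the total initial vorticity integrable, which bounds the mass near
  time 0.\<close>

lemma integrable_gauss_weighted_datum:
  assumes l: "l > 0" and m: "w \<in> borel_measurable lebesgue"
    and E: "(\<integral>\<^sup>+ x. ennreal ((w x)\<^sup>2 / Phi l x) \<partial>lebesgue) < \<infinity>"
  shows "integrable lebesgue (\<lambda>x. exp ((norm x)\<^sup>2 / l\<^sup>2) * (w x)\<^sup>2)" "integrable lebesgue (\<lambda>x. (w x)\<^sup>2)"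
    "integrable lebesgue w"
proof -
  have [measurable]: "w \<in> borel_measurable lebesgue" by (rule m)
  have [measurable]: "(\<lambda>x::real^2. norm x) \<in> borel_measurable lebesgue"
    by (rule measurable_completion) simp
  have pos: "pi * l\<^sup>2 > 0" using l by simp
  have ph: "(w x)\<^sup>2 / Phi l x = (pi * l\<^sup>2) * (exp ((norm x)\<^sup>2 / l\<^sup>2) * (w x)\<^sup>2)" for x
    by (rule divide_Phi) (use l in simp)
  have "integrable lebesgue (\<lambda>x. (pi * l\<^sup>2) * (exp ((norm x)\<^sup>2 / l\<^sup>2) * (w x)\<^sup>2))"
  proof (rule integrableI_bounded)
    show "(\<integral>\<^sup>+ x. ennreal (norm (pi * l\<^sup>2 * (exp ((norm x)\<^sup>2 / l\<^sup>2) * (w x)\<^sup>2))) \<partial>lebesgue) < \<infinity>"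
      using E unfolding ph by simp
  qed simp
  then show i: "integrable lebesgue (\<lambda>x. exp ((norm x)\<^sup>2 / l\<^sup>2) * (w x)\<^sup>2)"
    using pos by (subst (asm) integrable_mult_left_iff) auto
  have g: "exp ((norm x)\<^sup>2 / l\<^sup>2) \<ge> 1" for x :: "real^2" by simp
  show "integrable lebesgue (\<lambda>x. (w x)\<^sup>2)"
  proof (rule Bochner_Integration.integrable_bound[OF i])
    show "AE x in lebesgue. norm ((w x)\<^sup>2) \<le> norm (exp ((norm x)\<^sup>2 / l\<^sup>2) * (w x)\<^sup>2)"
      using mult_right_mono[OF g, of "(w _)\<^sup>2"] by (intro AE_I2) simp
  qed simp
  have ig: "integrable lebesgue (\<lambda>x::real^2. exp (- ((norm x)\<^sup>2 / l\<^sup>2)))"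
    using integrable_gaussian[OF l] by (subst integrable_completion) auto
  show "integrable lebesgue w"
  proof (rule Bochner_Integration.integrable_bound[OF Bochner_Integration.integrable_add[OF i ig]])
    show "AE x in lebesgue. norm (w x) \<le> norm (exp ((norm x)\<^sup>2 / l\<^sup>2) * (w x)\<^sup>2 + exp (- ((norm x)\<^sup>2 / l\<^sup>2)))"
    proof (rule AE_I2)
      fix x :: "real^2"
      define h where "h = exp ((norm x)\<^sup>2 / l\<^sup>2)"
      have h: "h > 0" by (simp add: h_def)
      define z where "z = \<bar>w x\<bar> * h"
      have "z \<le> z\<^sup>2 + 1" using zero_le_power2[of "z - 1/2"] by (simp add: power2_eq_square algebra_simps)
      then have "z / h \<le> (z\<^sup>2 + 1) / h" using h by (intro divide_right_mono) auto
      moreover have "z / h = \<bar>w x\<bar>" "(z\<^sup>2 + 1) / h = h * (w x)\<^sup>2 + inverse h"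
        using h by (simp_all add: z_def field_simps power2_eq_square)
      ultimately show "norm (w x) \<le> norm (exp ((norm x)\<^sup>2 / l\<^sup>2) * (w x)\<^sup>2 + exp (- ((norm x)\<^sup>2 / l\<^sup>2)))"
        unfolding exp_minus h_def[symmetric] by simp
    qed
  qed simp
qed

text \<open>The equation holds only for positive times and the datum is attained only in L2. For
  each n the weight is bounded, so a starting time \<open>a\<close> and a radius L are chosen
  depending on n, with a final bound independent of n; Fatou's lemma then restores the full
  Gaussian.\<close>

lemma (in advection) gauss_energy_finite:
  assumes U: "\<And>i x t. 0 < t \<Longrightarrow> t \<le> T \<Longrightarrow> \<bar>u i x t\<bar> \<le> U"
    and f2: "\<And>t. 0 < t \<Longrightarrow> t \<le> T \<Longrightarrow> integrable lborel (\<lambda>x. (f x t)\<^sup>2)"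
    and W: "\<And>t. 0 < t \<Longrightarrow> t \<le> T \<Longrightarrow> (LINT x|lborel. (f x t)\<^sup>2) \<le> W"
    and T: "T > 0" and l0: "l0 > 0"
    and f0: "f0 \<in> borel_measurable lebesgue" "(\<integral>\<^sup>+ x. ennreal ((f0 x)\<^sup>2 / Phi l0 x) \<partial>lebesgue) < \<infinity>"
    and lim: "((\<lambda>t. LINT x|lebesgue. (f x t - f0 x)\<^sup>2) \<longlongrightarrow> 0) (at_right 0)"
  shows "(\<integral>\<^sup>+ x. ennreal ((f x T)\<^sup>2 / Phi (lam nu l0 T) x) \<partial>lebesgue) < \<infinity>"
proof -
  note I = integrable_gauss_weighted_datum[OF l0 f0]
  have [measurable]: "f0 \<in> borel_measurable lebesgue" by (rule f0)
  have U0: "U \<ge> 0" using U[of T 1 0] T by simp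
  have "0 \<le> (LINT x|lborel. (f x T)\<^sup>2)" by (rule integral_nonneg_AE) simp
  then have W0: "W \<ge> 0" using W[of T] T by linarith
  define E0 where "E0 = (LINT x|lebesgue. exp ((norm x)\<^sup>2 / l0\<^sup>2) * (f0 x)\<^sup>2)"
  define s where "s = (\<lambda>t. l0\<^sup>2 + 4 * nu * t)"
  have s: "s t > 0" if "t > 0" for t using l0 nu that by (simp add: s_def add_pos_pos)
  have s0: "l0\<^sup>2 \<le> s t" if "t > 0" for t using nu that by (simp add: s_def)
  \<comment> \<open>Large enough to bring the cutoff error down to at most 1, see
    \<open>err\<close>, and at least Suc n so that the cutoff disappears in the limit.\<close>
  define L where "L = (\<lambda>n. real (Suc n) + T * (exp (real (Suc n)) * (12 * U + 54 * nu) * W))"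
  have KW: "0 \<le> T * (exp (real (Suc n)) * (12 * U + 54 * nu) * W)" for n
    using T U0 nu W0 by simp
  have L: "L n \<ge> real (Suc n)" for n using KW[of n] by (simp add: L_def)
  have L1: "L n \<ge> 1" "L n > 0" for n using L[of n] by auto
  have fl: "(LINT x|lebesgue. g x) = (LINT x|lborel. g x)" "integrable lebesgue g = integrable lborel g"
    if "continuous_on UNIV g" for g :: "real^2 \<Rightarrow> real"
    using integral_completion[of g lborel] integrable_completion[of g lborel] borel_measurable_continuous_onI[OF that] by auto
  have fc: "continuous_on UNIV (\<lambda>x. f x t)" if "t > 0" for t using C21_D(4)[OF C21 that] .
  \<comment> \<open>2 E0 + 1 bounds the weighted energy at the starting time, and another 1 bounds
    the cutoff error.\<close>
  define bnd where "bnd = exp (4 * U\<^sup>2 / nu * T) * (2 * E0 + 2)"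
  have J: "(LINT x|lborel. gauss_weight (real (Suc n)) (L n) (s T) x * (f x T)\<^sup>2) \<le> bnd" for n
  proof -
    define nn where "nn = real (Suc n)"
    have nn: "nn > 0" by (simp add: nn_def)
    have "\<forall>\<^sub>F a in at_right 0. (LINT x|lebesgue. (f x a - f0 x)\<^sup>2) < 1 / (2 * exp nn)"
      by (rule order_tendstoD[OF lim]) simp
    moreover have "\<forall>\<^sub>F a in at_right 0. a \<in> {0<..<T}"
      by (rule eventually_at_right_real[OF T])
    ultimately obtain a where a: "(LINT x|lebesgue. (f x a - f0 x)\<^sup>2) < 1 / (2 * exp nn)" "0 < a" "a < T"
      using eventually_happens[OF eventually_conj, of _ "at_right (0::real)"] by (auto simp: trivial_limit_at_right_real)
    define p where "p = gauss_weight nn (L n) (s a)"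
    have cp: "continuous_on UNIV p" unfolding p_def using C1_funD(2)[OF C1_gauss_weight[OF nn s[OF a(2)]]] .
    have cpf: "continuous_on UNIV (\<lambda>x. p x * (f x a)\<^sup>2)"
      by (intro continuous_on_mult continuous_on_power cp fc a)
    \<comment> \<open>The Gaussian weight decreases with time, so at time \<open>a\<close> the
      truncated weight lies below the weight of the initial energy.\<close>
    have pb: "0 \<le> p x" "p x \<le> exp nn" "p x \<le> exp ((norm x)\<^sup>2 / l0\<^sup>2)" for x
    proof -
      note b = gauss_weight_bounds[OF nn s[OF a(2)] L1(2)[of n], of x]
      show "0 \<le> p x" "p x \<le> exp nn" using b by (auto simp: p_def)
      have "trunc nn (s a) ((norm x)\<^sup>2) \<le> (norm x)\<^sup>2 / s a" by (rule trunc_bounds(3)[OF nn s[OF a(2)]]) simp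
      also have "\<dots> \<le> (norm x)\<^sup>2 / l0\<^sup>2" using s0[OF a(2)] l0 s[OF a(2)] by (intro divide_left_mono) auto
      finally have "exp (trunc nn (s a) ((norm x)\<^sup>2)) \<le> exp ((norm x)\<^sup>2 / l0\<^sup>2)" by simp
      then show "p x \<le> exp ((norm x)\<^sup>2 / l0\<^sup>2)" using b(2) unfolding p_def by linarith
    qed
    have ifa: "integrable lebesgue (\<lambda>x. (f x a)\<^sup>2)"
      using f2[of a] a fl(2)[OF continuous_on_power[OF fc[OF a(2)], of 2]] by simp
    have fm[measurable]: "(\<lambda>x. f x a) \<in> borel_measurable lebesgue"
      using borel_measurable_continuous_onI[OF fc[OF a(2)]] by (intro measurable_completion) simp
    \<comment> \<open>Excludes the default value 0 of a nonexistent integral, so that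
      \<open>lim\<close> really expresses convergence in L2.\<close>
    have id: "integrable lebesgue (\<lambda>x. (f x a - f0 x)\<^sup>2)"
    proof (rule Bochner_Integration.integrable_bound)
      show "integrable lebesgue (\<lambda>x. 2 * (f x a)\<^sup>2 + 2 * (f0 x)\<^sup>2)" using ifa I(2) by auto
      have "(y - z)\<^sup>2 \<le> 2 * y\<^sup>2 + 2 * z\<^sup>2" for y z :: real
        using zero_le_power2[of "y + z"] by (simp add: power2_eq_square algebra_simps)
      then show "AE x in lebesgue. norm ((f x a - f0 x)\<^sup>2) \<le> norm (2 * (f x a)\<^sup>2 + 2 * (f0 x)\<^sup>2)"
        by (intro AE_I2) simp
    qed simp
    have ipf: "integrable lebesgue (\<lambda>x. p x * (f x a)\<^sup>2)"
    proof (rule Bochner_Integration.integrable_bound)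
      show "integrable lebesgue (\<lambda>x. exp nn * (f x a)\<^sup>2)" using ifa by simp
      show "(\<lambda>x. p x * (f x a)\<^sup>2) \<in> borel_measurable lebesgue"
        using borel_measurable_continuous_onI[OF cpf] by (intro measurable_completion) simp
      show "AE x in lebesgue. norm (p x * (f x a)\<^sup>2) \<le> norm (exp nn * (f x a)\<^sup>2)"
        using pb by (intro AE_I2) (simp add: mult_right_mono)
    qed
    have "(LINT x|lborel. p x * (f x a)\<^sup>2) = (LINT x|lebesgue. p x * (f x a)\<^sup>2)"
      using fl(1)[OF cpf] by simp
    also have "\<dots> \<le> (LINT x|lebesgue. 2 * (exp ((norm x)\<^sup>2 / l0\<^sup>2) * (f0 x)\<^sup>2) + 2 * exp nn * (f x a - f0 x)\<^sup>2)"
    proof (rule integral_mono[OF ipf])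
      show "integrable lebesgue (\<lambda>x. 2 * (exp ((norm x)\<^sup>2 / l0\<^sup>2) * (f0 x)\<^sup>2) + 2 * exp nn * (f x a - f0 x)\<^sup>2)"
        using I(1) id by auto
      fix x
      have "(f x a)\<^sup>2 \<le> 2 * (f0 x)\<^sup>2 + 2 * (f x a - f0 x)\<^sup>2"
        using zero_le_power2[of "2 * f0 x - f x a"] by (simp add: power2_eq_square algebra_simps)
      then have "p x * (f x a)\<^sup>2 \<le> p x * (2 * (f0 x)\<^sup>2 + 2 * (f x a - f0 x)\<^sup>2)"
        using pb by (intro mult_left_mono) auto
      also have "\<dots> = 2 * (p x * (f0 x)\<^sup>2) + 2 * (p x * (f x a - f0 x)\<^sup>2)" by (simp add: algebra_simps)
      also have "\<dots> \<le> 2 * (exp ((norm x)\<^sup>2 / l0\<^sup>2) * (f0 x)\<^sup>2) + 2 * (exp nn * (f x a - f0 x)\<^sup>2)"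
        using pb by (intro add_mono mult_left_mono mult_right_mono) auto
      finally show "p x * (f x a)\<^sup>2 \<le> 2 * (exp ((norm x)\<^sup>2 / l0\<^sup>2) * (f0 x)\<^sup>2) + 2 * exp nn * (f x a - f0 x)\<^sup>2" by simp
    qed
    also have "\<dots> = 2 * E0 + 2 * exp nn * (LINT x|lebesgue. (f x a - f0 x)\<^sup>2)"
      using I(1) id by (simp add: E0_def)
    also have "\<dots> \<le> 2 * E0 + 2 * exp nn * (1 / (2 * exp nn))"
      using a(1) by (intro add_left_mono mult_left_mono) auto
    also have "\<dots> = 2 * E0 + 1" by simp
    finally have Ja: "(LINT x|lborel. p x * (f x a)\<^sup>2) \<le> 2 * E0 + 1" .
    have err: "T * (exp nn * (12 * U + 54 * nu) / L n * W) \<le> 1"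
    proof -
      have "T * (exp nn * (12 * U + 54 * nu) * W) \<le> L n" by (simp add: L_def nn_def)
      then show ?thesis using L1(2)[of n] by (simp add: field_simps)
    qed
    have "(LINT x|lborel. gauss_weight nn (L n) (s T) x * (f x T)\<^sup>2)
      \<le> exp (4 * U\<^sup>2 / nu * T) * ((LINT x|lborel. p x * (f x a)\<^sup>2) + T * (exp nn * (12 * U + 54 * nu) / L n * W))"
      unfolding s_def p_def
      by (rule weighted_energy[OF U f2 W nn L1(1) l0]) (use a in auto)
    also have "\<dots> \<le> bnd" unfolding bnd_def using Ja err by (intro mult_left_mono) auto
    finally show ?thesis unfolding nn_def .
  qed
  have gw: "(\<integral>\<^sup>+x. ennreal (gauss_weight (real (Suc n)) (L n) (s T) x * (f x T)\<^sup>2) \<partial>lborel) \<le> ennreal bnd" for n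
  proof -
    note b = gauss_weight_bounds[of "real (Suc n)" "s T" "L n", OF _ s[OF T] L1(2)]
    have cpf: "continuous_on UNIV (\<lambda>x. gauss_weight (real (Suc n)) (L n) (s T) x * (f x T)\<^sup>2)"
      by (intro continuous_on_mult continuous_on_power fc T C1_funD(2)[OF C1_gauss_weight[OF _ s[OF T]]]) simp
    have i: "integrable lborel (\<lambda>x. gauss_weight (real (Suc n)) (L n) (s T) x * (f x T)\<^sup>2)"
    proof (rule Bochner_Integration.integrable_bound)
      show "integrable lborel (\<lambda>x. exp (real (Suc n)) * (f x T)\<^sup>2)" using f2[of T] T by simp
      show "(\<lambda>x. gauss_weight (real (Suc n)) (L n) (s T) x * (f x T)\<^sup>2) \<in> borel_measurable lborel"
        using borel_measurable_continuous_onI[OF cpf] by simp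
      show "AE x in lborel. norm (gauss_weight (real (Suc n)) (L n) (s T) x * (f x T)\<^sup>2) \<le> norm (exp (real (Suc n)) * (f x T)\<^sup>2)"
        using b(1,3) by (intro AE_I2) (simp add: mult_right_mono)
    qed
    have "(\<integral>\<^sup>+x. ennreal (gauss_weight (real (Suc n)) (L n) (s T) x * (f x T)\<^sup>2) \<partial>lborel)
      = ennreal (LINT x|lborel. gauss_weight (real (Suc n)) (L n) (s T) x * (f x T)\<^sup>2)"
      by (rule nn_integral_eq_integral[OF i]) (use b(1) in auto)
    then show ?thesis using J[of n] by (simp add: ennreal_leI)
  qed
  have lamsq: "(lam nu l0 T)\<^sup>2 = s T" using s[OF T] by (simp add: lam_def s_def)
  have [measurable]: "(\<lambda>x. f x T) \<in> borel_measurable borel" by (rule borel_measurable_continuous_onI[OF fc[OF T]])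
  have "(\<integral>\<^sup>+x. ennreal (exp ((norm x)\<^sup>2 / s T) * (f x T)\<^sup>2) \<partial>lborel)
    = (\<integral>\<^sup>+x. liminf (\<lambda>n. ennreal (gauss_weight (real (Suc n)) (L n) (s T) x * (f x T)\<^sup>2)) \<partial>lborel)"
  proof (rule nn_integral_cong)
    fix x
    have "(\<lambda>n. ennreal (gauss_weight (real (Suc n)) (L n) (s T) x * (f x T)\<^sup>2)) \<longlonglongrightarrow> ennreal (exp ((norm x)\<^sup>2 / s T) * (f x T)\<^sup>2)"
      by (intro tendsto_ennrealI tendsto_mult tendsto_const gauss_weight_tendsto s T L)
    then show "ennreal (exp ((norm x)\<^sup>2 / s T) * (f x T)\<^sup>2) = liminf (\<lambda>n. ennreal (gauss_weight (real (Suc n)) (L n) (s T) x * (f x T)\<^sup>2))"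
      by (simp add: lim_imp_Liminf)
  qed
  also have "\<dots> \<le> liminf (\<lambda>n. \<integral>\<^sup>+x. ennreal (gauss_weight (real (Suc n)) (L n) (s T) x * (f x T)\<^sup>2) \<partial>lborel)"
  proof (rule nn_integral_liminf)
    fix n
    have [measurable]: "gauss_weight (real (Suc n)) (L n) (s T) \<in> borel_measurable borel"
      by (rule borel_measurable_continuous_onI[OF C1_funD(2)[OF C1_gauss_weight[OF _ s[OF T]]]]) simp
    show "(\<lambda>x. ennreal (gauss_weight (real (Suc n)) (L n) (s T) x * (f x T)\<^sup>2)) \<in> borel_measurable lborel" by measurable
  qed
  also have "\<dots> \<le> limsup (\<lambda>n. \<integral>\<^sup>+x. ennreal (gauss_weight (real (Suc n)) (L n) (s T) x * (f x T)\<^sup>2) \<partial>lborel)"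
    by (simp add: Liminf_le_Limsup)
  also have "\<dots> \<le> ennreal bnd" by (intro Limsup_bounded always_eventually allI gw)
  also have "\<dots> < \<infinity>" by simp
  finally have fin: "(\<integral>\<^sup>+x. ennreal (exp ((norm x)\<^sup>2 / s T) * (f x T)\<^sup>2) \<partial>lborel) < \<infinity>" .
  have ph: "(f x T)\<^sup>2 / Phi (lam nu l0 T) x = (pi * s T) * (exp ((norm x)\<^sup>2 / s T) * (f x T)\<^sup>2)" for x
    unfolding lamsq[symmetric] by (rule divide_Phi) (use lamsq s[OF T] in auto)
  have "(\<integral>\<^sup>+ x. ennreal ((f x T)\<^sup>2 / Phi (lam nu l0 T) x) \<partial>lebesgue)
    = (\<integral>\<^sup>+ x. ennreal (pi * s T) * ennreal (exp ((norm x)\<^sup>2 / s T) * (f x T)\<^sup>2) \<partial>lborel)"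
    unfolding ph nn_integral_completion
    by (rule nn_integral_cong, rule ennreal_mult) (use s[OF T] in \<open>auto intro: less_imp_le\<close>)
  also have "\<dots> = ennreal (pi * s T) * (\<integral>\<^sup>+ x. ennreal (exp ((norm x)\<^sup>2 / s T) * (f x T)\<^sup>2) \<partial>lborel)"
    by (rule nn_integral_cmult) measurable
  also have "\<dots> < \<infinity>" using fin by (simp add: ennreal_mult_less_top)
  finally show ?thesis .
qed

theorem mainTheorem2:
  fixes \<nu> lam0 :: real and N :: nat
    and w0 :: "nat \<Rightarrow> real^2 \<Rightarrow> real"
    and \<omega> :: "real^2 \<Rightarrow> real \<Rightarrow> real"
    and w :: "nat \<Rightarrow> real^2 \<Rightarrow> real \<Rightarrow> real"
  assumes "\<nu> > 0" and "lam0 > 0" and "N \<ge> 1"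
    and "\<forall>j\<in>{1..N}. w0 j \<in> borel_measurable lebesgue"
    and "\<exists>C. AE x in lebesgue. \<bar>\<Sum>j\<in>{1..N}. w0 j x\<bar> \<le> C"
    and "\<forall>j\<in>{1..N}. (\<integral>\<^sup>+ x. ennreal ((w0 j x)\<^sup>2 / Phi lam0 x) \<partial>lebesgue) < \<infinity>"
    and "vorticity_solution \<nu> \<omega> (\<lambda>x. \<Sum>j\<in>{1..N}. w0 j x)"
    and "\<forall>j\<in>{1..N}. adv_diff_solution \<nu> (biot_savart \<omega>) (w j) (w0 j)"
  shows "\<forall>j\<in>{1..N}. \<forall>t > 0.
           (\<integral>\<^sup>+ x. ennreal ((w j x t)\<^sup>2 / Phi (lam \<nu> lam0 t) x) \<partial>lebesgue) < \<infinity>"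
proof (intro ballI allI impI)
  fix j and T :: real assume j: "j \<in> {1..N}" and T: "T > 0"
  note V = assms(7)[unfolded vorticity_solution_def]
  note A = bspec[OF assms(8) j, unfolded adv_diff_solution_def]
  have C: "C21 \<omega>" "C21 (w j)" using V A by auto
  have fl: "(LINT x|lebesgue. g x) = (LINT x|lborel. g x)" "integrable lebesgue g = integrable lborel g"
    if "continuous_on UNIV g" for g :: "real^2 \<Rightarrow> real"
    using integral_completion[of g lborel] integrable_completion[of g lborel] borel_measurable_continuous_onI[OF that] by auto
  have oint: "integrable lborel (\<lambda>x. \<omega> x t)" if "t > 0" for t
    using V that fl(2)[OF C21_D(4)[OF C(1) that]] by blast
  have obd: "\<exists>C. \<forall>x. \<bar>\<omega> x t\<bar> \<le> C" if t: "t > 0" for t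
  proof -
    obtain C where "\<forall>s\<in>{0<..t}. \<forall>x. \<bar>\<omega> x s\<bar> \<le> C" using V t by blast
    then show ?thesis using t by (intro exI[of _ C]) auto
  qed
  obtain C where Cb: "\<forall>s\<in>{0<..T}. \<forall>x. \<bar>\<omega> x s\<bar> \<le> C" using V T by blast
  \<comment> \<open>The locale requires a positive bound, since \<open>backward_step\<close> divides
    by M.\<close>
  define M where "M = max 1 C"
  have bs: "biot_savart \<omega> x t $ i = bs_reg 0 (\<lambda>y. \<omega> y t) i x" if t: "t > 0" for x t i
  proof -
    obtain C where "\<forall>x. \<bar>\<omega> x t\<bar> \<le> C" using obd[OF t] by blast
    then interpret bounded_vorticity "\<lambda>y. \<omega> y t" C
      using oint[OF t] C21_D(4)[OF C(1) t] by unfold_locales auto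
    show ?thesis by (rule biot_savart_nth) simp
  qed
  interpret vorticity \<nu> \<omega> T M
  proof
    show "dt \<omega> x t = \<nu> * (d2 \<omega> 1 x t + d2 \<omega> 2 x t)
      - (bs_reg 0 (\<lambda>y. \<omega> y t) 1 x * grad \<omega> x t $ 1 + bs_reg 0 (\<lambda>y. \<omega> y t) 2 x * grad \<omega> x t $ 2)" if "t > 0" for x t
      using V that by (simp add: lap_def sum_2 inner_real2 bs[OF that])
    show "\<bar>\<omega> x t\<bar> \<le> M" if "t > 0" "t \<le> T" for x t
    proof -
      have "\<bar>\<omega> x t\<bar> \<le> C" using Cb that by auto
      then show ?thesis by (simp add: M_def)
    qed
  qed (use assms(1) C oint obd T in \<open>auto simp: M_def\<close>)
  let ?o0 = "\<lambda>x. \<Sum>j\<in>{1..N}. w0 j x"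
  have io0: "integrable lebesgue ?o0"
  proof (rule Bochner_Integration.integrable_sum)
    show "integrable lebesgue (w0 i)" if "i \<in> {1..N}" for i
      using integrable_gauss_weighted_datum(3)[OF assms(2)] assms(4,6) that by blast
  qed
  have "((\<lambda>t. LINT x|lebesgue. \<bar>\<omega> x t - ?o0 x\<bar>) \<longlongrightarrow> 0) (at_right 0)" using V by blast
  then have "\<forall>\<^sub>F t in at_right 0. (LINT x|lebesgue. \<bar>\<omega> x t - ?o0 x\<bar>) < 1"
    by (rule order_tendstoD) simp
  then obtain d where d: "d > 0" "\<And>t. 0 < t \<Longrightarrow> t < d \<Longrightarrow> (LINT x|lebesgue. \<bar>\<omega> x t - ?o0 x\<bar>) < 1"
    unfolding eventually_at_right_field by auto
  \<comment> \<open>Attainment of the datum in L1 gives the initial time interval of bounded mass on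
    which \<open>mass_bounded\<close> builds. Integrability of both functions makes the integral of
    the difference meaningful.\<close>
  have near: "mass t \<le> 1 + (LINT x|lebesgue. \<bar>?o0 x\<bar>)" if t: "0 < t" "t < d" for t
  proof -
    have io: "integrable lebesgue (\<lambda>x. \<omega> x t)" using V t by blast
    have "continuous_on UNIV (\<lambda>x. \<bar>\<omega> x t\<bar>)" using C21_D(4)[OF C(1) t(1)] by (intro continuous_intros)
    then have "mass t = (LINT x|lebesgue. \<bar>\<omega> x t\<bar>)" using fl(1) by (simp add: mass_def)
    also have "\<dots> \<le> (LINT x|lebesgue. \<bar>\<omega> x t - ?o0 x\<bar> + \<bar>?o0 x\<bar>)"
      by (rule integral_mono) (use io io0 in auto)
    also have "\<dots> = (LINT x|lebesgue. \<bar>\<omega> x t - ?o0 x\<bar>) + (LINT x|lebesgue. \<bar>?o0 x\<bar>)"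
      using io io0 by (intro Bochner_Integration.integral_add) auto
    finally show ?thesis using d(2)[OF t] by linarith
  qed
  obtain n where n: "\<And>s. 0 < s \<Longrightarrow> s \<le> T \<Longrightarrow> mass s \<le> n"
    by (rule mass_bounded[OF d(1) near]) blast+
  obtain W where W: "\<forall>t\<in>{0<..T}. (LINT x|lebesgue. (w j x t)\<^sup>2) \<le> W" using A T by blast
  have w2: "continuous_on UNIV (\<lambda>x. (w j x t)\<^sup>2)" if "t > 0" for t
    using C21_D(4)[OF C(2) that] by (intro continuous_intros)
  interpret w: advection \<nu> vel "w j"
  proof
    show "dt (w j) x t = \<nu> * (d2 (w j) 1 x t + d2 (w j) 2 x t) - (vel 1 x t * grad (w j) x t $ 1 + vel 2 x t * grad (w j) x t $ 2)"
      if "t > 0" for x t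
      using A that by (simp add: lap_def sum_2 inner_real2 bs[OF that] vel_def)
    show "(LINT x|lborel. vel 1 x t * F' 1 x + vel 2 x t * F' 2 x) = 0"
      if "t > 0" "C1_fun F F'" "\<And>x. norm x > r \<Longrightarrow> F x = 0" for t F F' r
      by (rule vel_div[OF that])
  qed (use assms(1) C vel_cont in auto)
  show "(\<integral>\<^sup>+ x. ennreal ((w j x T)\<^sup>2 / Phi (lam \<nu> lam0 T) x) \<partial>lebesgue) < \<infinity>"
  proof (rule w.gauss_energy_finite)
    show "\<bar>vel i x t\<bar> \<le> M * ker_const + n" if "0 < t" "t \<le> T" for i x t
      using vel_le[OF that, of i x] n[OF that] by linarith
    show "integrable lborel (\<lambda>x. (w j x t)\<^sup>2)" if "0 < t" "t \<le> T" for t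
      using A that fl(2)[OF w2[OF that(1)]] by blast
    show "(LINT x|lborel. (w j x t)\<^sup>2) \<le> W" if "0 < t" "t \<le> T" for t
      using bspec[OF W, of t] that fl(1)[OF w2[OF that(1)]] by simp
    show "((\<lambda>t. LINT x|lebesgue. (w j x t - w0 j x)\<^sup>2) \<longlongrightarrow> 0) (at_right 0)" using A by blast
  qed (use assms(2,4,6) j T in auto)
qed

end
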